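(* Let $\mathcal{A}$ be a unital JB-algebra and let $\lambda\in[0,1]$. The weighted geometric mean $\#_\lambda$ on positive invertible elements of $\mathcal{A}$ has the following properties, where $A,B$ (and $D$, and $C$ in (ii)) denote positive invertible elements of $\mathcal{A}$: (i) $(\alpha A)\#_{\lambda}(\beta B)=\alpha^{1-\lambda}\beta^{\lambda}(A\#_{\lambda}B)$ for any positive numbers $\alpha$ and $\beta$. (ii) If $A\le C$ and $B\le D$, then $A\#_{\lambda}B\le C\#_{\lambda}D$. (iii) $A\#_{\lambda}B$ is operator concave with respect to $A$ and $B$ individually; that is, for all $t\in[0,1]$ and all positive invertible $A,A_1,A_2,B,B_1,B_2\in\mathcal{A}$, $A\#_\lambda((1-t)B_1+tB_2)\ge(1-t)(A\#_\lambda B_1)+t(A\#_\lambda B_2)$ and $((1-t)A_1+tA_2)\#_\lambda B\ge(1-t)(A_1\#_\lambda B)+t(A_2\#_\lambda B)$. (iv) $\{C(A\#_{\lambda}B)C\}=\{CAC\}\#_{\lambda}\{CBC\}$ for any invertible $C\in\mathcal{A}$. (v) $(A\#_{\lambda}B)^{-1}=A^{-1}\#_{\lambda}B^{-1}$.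
   Context: A Jordan algebra over $\mathbb{R}$ is a real vector space with a bilinear product $\circ$ satisfying $a\circ b=b\circ a$ and $(a^2\circ b)\circ a=a^2\circ(b\circ a)$. A JB-algebra is a Jordan algebra over $\mathbb{R}$ with a complete norm satisfying $\|A\circ B\|\le\|A\|\|B\|$, $\|A^2\|=\|A\|^2$ and $\|A^2\|\le\|A^2+B^2\|$. In a unital JB-algebra $\mathcal{A}$ with unit $I$: $A$ is invertible, with Jordan inverse $A^{-1}=B$, if $A\circ B=I$ and $A^2\circ B=A$; the spectrum is $\mathrm{Sp}(A)=\{\lambda\in\mathbb{R}: A-\lambda I \text{ is not invertible}\}$; $A$ is positive ($A\ge 0$) if $\mathrm{Sp}(A)\subset[0,\infty)$; $A\le B$ means $B-A\ge0$. For $f$ continuous on $\mathrm{Sp}(A)$, $f(A)$ is defined by the continuous functional calculus in the norm-closed (associative) JB-subalgebra generated by $A$ and $I$, which is isometrically isomorphic to $C(\mathrm{Sp}(A))$. The Jordan triple notation is $\{ABA\}:=2(A\circ B)\circ A-A^2\circ B$. If $A$ is positive invertible and $C$ is invertible, then $\{CAC\}$ is positive invertible. For positive invertible $A,B\in\mathcal{A}$ and $0\le\lambda\le1$, the weighted geometric mean is $A\#_\lambda B=\{A^{1/2}\{A^{-1/2}BA^{-1/2}\}^{\lambda}A^{1/2}\}$. *)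

theory Defs
  imports "HOL-Analysis.Analysis"
begin

class jordan_algebra = real_vector +
  fixes jmult :: "'a \<Rightarrow> 'a \<Rightarrow> 'a"  (infixl \<open>\<circ>\<^sub>J\<close> 70)
  assumes jmult_commute: "a \<circ>\<^sub>J b = b \<circ>\<^sub>J a"
    and jmult_add_left: "(a + b) \<circ>\<^sub>J c = a \<circ>\<^sub>J c + b \<circ>\<^sub>J c"
    and jmult_scaleR_left: "(r *\<^sub>R a) \<circ>\<^sub>J b = r *\<^sub>R (a \<circ>\<^sub>J b)"
    and jordan_identity: "((a \<circ>\<^sub>J a) \<circ>\<^sub>J b) \<circ>\<^sub>J a = (a \<circ>\<^sub>J a) \<circ>\<^sub>J (b \<circ>\<^sub>J a)"

class jb_algebra = jordan_algebra + banach +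
  assumes norm_jmult_le: "norm (a \<circ>\<^sub>J b) \<le> norm a * norm b"
    and norm_jsquare: "norm (a \<circ>\<^sub>J a) = (norm a)\<^sup>2"
    and norm_jsquare_le: "norm (a \<circ>\<^sub>J a) \<le> norm (a \<circ>\<^sub>J a + b \<circ>\<^sub>J b)"

class unital_jb_algebra = jb_algebra +
  fixes junit :: 'a
  assumes junit_left: "junit \<circ>\<^sub>J a = a"

definition is_jinverse :: "'a::unital_jb_algebra \<Rightarrow> 'a \<Rightarrow> bool" where
  "is_jinverse A B \<longleftrightarrow> A \<circ>\<^sub>J B = junit \<and> (A \<circ>\<^sub>J A) \<circ>\<^sub>J B = A"

definition jinvertible :: "'a::unital_jb_algebra \<Rightarrow> bool" where
  "jinvertible A \<longleftrightarrow> (\<exists>B. is_jinverse A B)"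

definition jinverse :: "'a::unital_jb_algebra \<Rightarrow> 'a" where
  "jinverse A = (THE B. is_jinverse A B)"

definition jspectrum :: "'a::unital_jb_algebra \<Rightarrow> real set" where
  "jspectrum A = {r. \<not> jinvertible (A - r *\<^sub>R junit)}"

definition jpositive :: "'a::unital_jb_algebra \<Rightarrow> bool" where
  "jpositive A \<longleftrightarrow> jspectrum A \<subseteq> {0..}"

definition jle :: "'a::unital_jb_algebra \<Rightarrow> 'a \<Rightarrow> bool"  (infix \<open>\<le>\<^sub>J\<close> 50) where
  "A \<le>\<^sub>J B \<longleftrightarrow> jpositive (B - A)"

definition jpos_inv :: "'a::unital_jb_algebra \<Rightarrow> bool" where
  "jpos_inv A \<longleftrightarrow> jpositive A \<and> jinvertible A"

definition jtriple :: "'a::unital_jb_algebra \<Rightarrow> 'a \<Rightarrow> 'a" where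
  "jtriple A B = 2 *\<^sub>R ((A \<circ>\<^sub>J B) \<circ>\<^sub>J A) - (A \<circ>\<^sub>J A) \<circ>\<^sub>J B"

definition closed_jsubalgebra :: "'a::unital_jb_algebra set \<Rightarrow> bool" where
  "closed_jsubalgebra S \<longleftrightarrow> subspace S \<and> (\<forall>a\<in>S. \<forall>b\<in>S. a \<circ>\<^sub>J b \<in> S) \<and> closed S"

text \<open>The supremum norm on \<open>C(K)\<close>; inserting 0 only matters for empty \<open>K\<close>
  (the spectrum in the zero algebra).\<close>

definition sup_norm_on :: "real set \<Rightarrow> (real \<Rightarrow> real) \<Rightarrow> real" where
  "sup_norm_on K f = Sup (insert 0 ((\<lambda>t. \<bar>f t\<bar>) ` K))"

text \<open>\<open>\<Phi>\<close> is an isometric isomorphism from \<open>C(Sp(A))\<close> onto the closed subalgebra generated by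
  \<open>A\<close> and the unit, sending the identity function to \<open>A\<close> and 1 to the unit. An element of
  \<open>C(Sp(A))\<close> is represented by any real function continuous on \<open>Sp(A)\<close>; linearity and the
  isometry condition make \<open>\<Phi>\<close> independent of the values outside \<open>Sp(A)\<close>.\<close>

definition is_jcalculus ::
    "'a::unital_jb_algebra \<Rightarrow> ((real \<Rightarrow> real) \<Rightarrow> 'a) \<Rightarrow> bool" where
  "is_jcalculus A \<Phi> \<longleftrightarrow>
     (let C = {f. continuous_on (jspectrum A) f} in
       (\<forall>f\<in>C. \<forall>g\<in>C. \<Phi> (\<lambda>t. f t + g t) = \<Phi> f + \<Phi> g) \<and>
       (\<forall>f\<in>C. \<forall>r. \<Phi> (\<lambda>t. r * f t) = r *\<^sub>R \<Phi> f) \<and>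
       (\<forall>f\<in>C. \<forall>g\<in>C. \<Phi> (\<lambda>t. f t * g t) = \<Phi> f \<circ>\<^sub>J \<Phi> g) \<and>
       (\<forall>f\<in>C. norm (\<Phi> f) = sup_norm_on (jspectrum A) f) \<and>
       \<Phi> ` C = closed_jsubalgebra hull {A, junit} \<and>
       \<Phi> (\<lambda>t. t) = A \<and> \<Phi> (\<lambda>_. 1) = junit)"

definition jcalculus :: "(real \<Rightarrow> real) \<Rightarrow> 'a::unital_jb_algebra \<Rightarrow> 'a" where
  "jcalculus f A = (THE X. \<exists>\<Phi>. is_jcalculus A \<Phi> \<and> \<Phi> f = X)"

text \<open>Only used for positive invertible \<open>A\<close>, whose spectrum lies in \<open>{0<..}\<close>, where
  \<open>t powr r\<close> is the usual power.\<close>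

definition jpowr :: "'a::unital_jb_algebra \<Rightarrow> real \<Rightarrow> 'a" where
  "jpowr A r = jcalculus (\<lambda>t. t powr r) A"

definition jgeomean :: "real \<Rightarrow> 'a::unital_jb_algebra \<Rightarrow> 'a \<Rightarrow> 'a" where
  "jgeomean l A B =
     jtriple (jpowr A (1/2)) (jpowr (jtriple (jpowr A (- 1/2)) B) l)"

end

theory Submission
  imports Defs "HOL-Computational_Algebra.Fundamental_Theorem_Algebra"
begin

text \<open>The quadratic maps \<open>jtriple C\<close> satisfy the fundamental formula
  \<open>jtriple (jtriple x y) = jtriple x \<circ> jtriple y \<circ> jtriple x\<close>, so \<open>C\<close> is invertible iff \<open>jtriple C\<close>
  is bijective, and \<open>jtriple C\<close> commutes with inversion up to replacing \<open>C\<close> by its inverse. For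
  invertible \<open>C\<close> it preserves positivity, because the least spectral value of \<open>jtriple C X\<close> varies
  continuously and never vanishes as \<open>X\<close> runs along a segment of positive invertible elements.

  For \<open>t > 0\<close> the weighted harmonic mean \<open>(A\<inverse> + t B\<inverse>)\<inverse>\<close> equals
  \<open>{A^(1/2) f({A^(-1/2) B A^(-1/2)}) A^(1/2)}\<close> with \<open>f x = x / (x + t)\<close>. It is covariant under
  \<open>jtriple C\<close>, and it is monotone and separately concave because inversion is antitone and convex.
  On compact subintervals of \<open>(0, \<infinity>)\<close>, \<open>x powr l\<close> is a uniform limit of nonnegative combinations
  of such \<open>f\<close>, so the geometric mean inherits these properties. The scaling and inversion rules
  follow directly from the functional calculus.\<close>

subsection \<open>Jordan identities and the fundamental formula\<close>

text \<open>Exceptional Jordan algebras have no faithful operator representation, so every identity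
  is derived from the Jordan identity by polarization. A second obstacle is that
  \<open>jpositive\<close> speaks of invertibility, from which closure of the cone under addition
  cannot be read off. Positivity is therefore recast as the norm condition \<open>jpos\<close>; the
  two notions meet because \<open>norm x\<close> or \<open>- norm x\<close> lies in the spectrum of
  x in every nonzero algebra. That fact is proved inside the real algebra: for an element y of norm
  1, an inverse of I - y^2 would force the norm of y^(2N) to decay like 1/N, while all powers
  y^(2^k) keep norm 1.

  The scalar approximation originates in x^l = (sin (pi l) / pi) times the integral over t > 0 of
  t^(l-1) x / (x + t). With t = exp u the integrand depends on u - ln x only, apart from the factor
  x^l. A Riemann sum is divided by its own value at x = 1, so the constant is never evaluated. The
  integral diverges for l = 0 and l = 1, where the mean is simply a projection to one
  argument.\<close>

lemma linear_functionals_separate: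
  fixes x y :: "'a::real_vector"
  assumes "\<And>\<phi>::'a \<Rightarrow> real. linear \<phi> \<Longrightarrow> \<phi> x = \<phi> y"
  shows "x = y"
proof (rule ccontr)
  assume "x \<noteq> y"
  then have "independent {x - y}" by simp
  from linear_independent_extend[OF this, of "\<lambda>_. 1::real"]
  obtain g :: "'a \<Rightarrow> real" where "linear g" "g (x - y) = 1" by auto
  then show False using assms[of g] by (simp add: linear_diff)
qed

lemma jmult_add_right: "a \<circ>\<^sub>J (b + c) = a \<circ>\<^sub>J b + a \<circ>\<^sub>J (c::'a::jordan_algebra)"
  by (metis jmult_add_left jmult_commute)

lemma jmult_scaleR_right: "a \<circ>\<^sub>J (r *\<^sub>R b) = r *\<^sub>R (a \<circ>\<^sub>J (b::'a::jordan_algebra))"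
  by (metis jmult_scaleR_left jmult_commute)

lemma linear_jmult_right: "linear (\<lambda>b. a \<circ>\<^sub>J (b::'a::jordan_algebra))"
  by (simp add: linear_iff jmult_add_right jmult_scaleR_right)

lemma linear_jmult_left: "linear (\<lambda>a. a \<circ>\<^sub>J (b::'a::jordan_algebra))"
  by (simp add: linear_iff jmult_add_left jmult_scaleR_left)

lemmas jmult_linear =
  jmult_add_left jmult_add_right jmult_scaleR_left jmult_scaleR_right
  linear_diff[OF linear_jmult_left] linear_diff[OF linear_jmult_right]
  linear_neg[OF linear_jmult_left] linear_neg[OF linear_jmult_right]

lemma jmult_zero [simp]: "0 \<circ>\<^sub>J a = 0" "a \<circ>\<^sub>J 0 = (0::'a::jordan_algebra)"
  by (rule linear_0[OF linear_jmult_left], rule linear_0[OF linear_jmult_right])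

text \<open>Full polarization of the Jordan identity, which is cubic in its first variable:
  inclusion-exclusion over the seven nonempty subsets of {a, c, d} isolates the part that is linear
  in each of the three.\<close>

lemma linearized_jordan_identity:
  fixes a b c d :: "'a::jordan_algebra"
  shows "((a \<circ>\<^sub>J c) \<circ>\<^sub>J b) \<circ>\<^sub>J d + ((c \<circ>\<^sub>J d) \<circ>\<^sub>J b) \<circ>\<^sub>J a + ((d \<circ>\<^sub>J a) \<circ>\<^sub>J b) \<circ>\<^sub>J c
    = (a \<circ>\<^sub>J c) \<circ>\<^sub>J (b \<circ>\<^sub>J d) + (c \<circ>\<^sub>J d) \<circ>\<^sub>J (b \<circ>\<^sub>J a) + (d \<circ>\<^sub>J a) \<circ>\<^sub>J (b \<circ>\<^sub>J c)"
    (is "?l = ?r")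
proof (rule linear_functionals_separate)
  \<comment> \<open>Under a functional the goal and the instances become linear relations between
    real numbers, which linear arithmetic combines. The later identities use the same
    device.\<close>
  fix \<phi> :: "'a \<Rightarrow> real" assume lin: "linear \<phi>"
  have E: "\<phi> (((x \<circ>\<^sub>J x) \<circ>\<^sub>J b) \<circ>\<^sub>J x) = \<phi> ((x \<circ>\<^sub>J x) \<circ>\<^sub>J (b \<circ>\<^sub>J x))" for x
    by (simp only: jordan_identity)
  note L = jmult_linear linear_add[OF lin] jmult_commute
  show "\<phi> ?l = \<phi> ?r"
    using E[of "a + c + d"] E[of "a + c"] E[of "c + d"] E[of "a + d"] E[of a] E[of c] E[of d]
    by (simp (no_asm_use) only: L)
qed

text \<open>The Jordan triple product {x y z}, linear in each argument; it is the polarization of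
  \<open>jtriple\<close>, which is recovered at z = x.\<close>

definition jtri :: "'a::jordan_algebra \<Rightarrow> 'a \<Rightarrow> 'a \<Rightarrow> 'a" where
  "jtri x y z = (x \<circ>\<^sub>J y) \<circ>\<^sub>J z + (y \<circ>\<^sub>J z) \<circ>\<^sub>J x - (x \<circ>\<^sub>J z) \<circ>\<^sub>J y"

lemma jtri_sym: "jtri x y z = jtri z y x"
  by (simp add: jtri_def jmult_commute add.commute)

lemma jtri_linear:
  "jtri (x + x') y z = jtri x y z + jtri x' y z"
  "jtri x (y + y') z = jtri x y z + jtri x y' z"
  "jtri x y (z + z') = jtri x y z + jtri x y z'"
  "jtri (r *\<^sub>R x) y z = r *\<^sub>R jtri x y z"
  "jtri x (r *\<^sub>R y) z = r *\<^sub>R jtri x y z"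
  "jtri x y (r *\<^sub>R z) = r *\<^sub>R jtri x y z"
  by (simp_all add: jtri_def jmult_linear algebra_simps)

text \<open>The commutator of two multiplication operators is a derivation: exchanging x and y in
  the linearized identity leaves its right-hand side unchanged, and the difference of the left-hand
  sides is the Leibniz rule.\<close>

lemma jmult_commutator_derivation:
  fixes x y c d :: "'a::jordan_algebra"
  shows "x \<circ>\<^sub>J (y \<circ>\<^sub>J (c \<circ>\<^sub>J d)) - y \<circ>\<^sub>J (x \<circ>\<^sub>J (c \<circ>\<^sub>J d))
    = (x \<circ>\<^sub>J (y \<circ>\<^sub>J c) - y \<circ>\<^sub>J (x \<circ>\<^sub>J c)) \<circ>\<^sub>J d + c \<circ>\<^sub>J (x \<circ>\<^sub>J (y \<circ>\<^sub>J d) - y \<circ>\<^sub>J (x \<circ>\<^sub>J d))"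
    (is "?l = ?r")
proof (rule linear_functionals_separate)
  fix \<phi> :: "'a \<Rightarrow> real" assume lin: "linear \<phi>"
  note L = jmult_linear linear_add[OF lin] linear_diff[OF lin] jmult_commute
  show "\<phi> ?l = \<phi> ?r"
    using arg_cong[OF linearized_jordan_identity[of c d y x], of \<phi>]
      arg_cong[OF linearized_jordan_identity[of c d x y], of \<phi>]
    by (simp (no_asm_use) only: L)
qed

text \<open>Multiplication by p is not a derivation of the triple product, but it becomes one up to
  the sign in the middle slot. This sign is what makes the middle term of \<open>jtri_jtri\<close>
  negative and swaps a and b there.\<close>

lemma jmult_jtri:
  fixes p c d e :: "'a::jordan_algebra"
  shows "p \<circ>\<^sub>J jtri c d e = jtri (p \<circ>\<^sub>J c) d e - jtri c (p \<circ>\<^sub>J d) e + jtri c d (p \<circ>\<^sub>J e)" (is "?l = ?r")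
proof (rule linear_functionals_separate)
  fix \<phi> :: "'a \<Rightarrow> real" assume lin: "linear \<phi>"
  note L = jtri_def jmult_linear linear_add[OF lin] linear_diff[OF lin] jmult_commute
  show "\<phi> ?l = \<phi> ?r"
    using arg_cong[OF linearized_jordan_identity[of c e d p], of \<phi>]
      arg_cong[OF linearized_jordan_identity[of p c d e], of \<phi>]
      arg_cong[OF linearized_jordan_identity[of p e d c], of \<phi>]
      arg_cong[OF linearized_jordan_identity[of p d c e], of \<phi>]
      arg_cong[OF linearized_jordan_identity[of p c e d], of \<phi>]
      arg_cong[OF linearized_jordan_identity[of d c p e], of \<phi>]
      arg_cong[OF linearized_jordan_identity[of d e c p], of \<phi>]
    by (simp (no_asm_use) only: L)
qed

lemma derivation_jtri:
  fixes D :: "'a::jordan_algebra \<Rightarrow> 'a"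
  assumes "linear D" and D: "\<And>c d. D (c \<circ>\<^sub>J d) = D c \<circ>\<^sub>J d + c \<circ>\<^sub>J D d"
  shows "D (jtri c d e) = jtri (D c) d e + jtri c (D d) e + jtri c d (D e)"
  by (simp add: jtri_def linear_add[OF assms(1)] linear_diff[OF assms(1)] D jmult_linear algebra_simps)

text \<open>The operator z -> {a b z} is multiplication by a o b plus the commutator derivation D,
  and {b a z} is the same with -D. The derivation obeys the plain Leibniz rule, the multiplication
  the one with the twisted middle sign, and the two add up.\<close>

lemma jtri_jtri:
  fixes a b c d e :: "'a::jordan_algebra"
  shows "jtri a b (jtri c d e)
    = jtri (jtri a b c) d e - jtri c (jtri b a d) e + jtri c d (jtri a b e)"
proof -
  define D where "D = (\<lambda>z. a \<circ>\<^sub>J (b \<circ>\<^sub>J z) - b \<circ>\<^sub>J (a \<circ>\<^sub>J z))"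
  have lin: "linear D"
    by (simp add: D_def linear_iff jmult_linear algebra_simps)
  have D: "D (x \<circ>\<^sub>J y) = D x \<circ>\<^sub>J y + x \<circ>\<^sub>J D y" for x y
    unfolding D_def by (rule jmult_commutator_derivation)
  have ab: "jtri a b z = (a \<circ>\<^sub>J b) \<circ>\<^sub>J z + D z" and ba: "jtri b a z = (a \<circ>\<^sub>J b) \<circ>\<^sub>J z - D z" for z
    by (simp_all add: jtri_def D_def jmult_commute)
  have m: "jtri x (y - y') z = jtri x y z - jtri x y' z" for x y y' z :: 'a
    by (simp add: jtri_def jmult_linear algebra_simps)
  show ?thesis
    by (simp add: ab ba derivation_jtri[OF lin D] jmult_jtri jtri_linear m)
qed

text \<open>Two instances of the five-linear identity, with y and z exchanged, give beta = 2 alpha -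
  gamma and alpha = 2 beta - gamma; this linear system forces alpha = beta = gamma.\<close>

lemma jtri_absorb:
  fixes x y z :: "'a::jordan_algebra"
  shows "jtri x y (jtri x z x) = jtri x (jtri y x z) x"
    and "jtri (jtri x y x) z x = jtri x (jtri y x z) x"
proof -
  let ?\<alpha> = "jtri x z (jtri x y x)" and ?\<beta> = "jtri x y (jtri x z x)" and ?\<gamma> = "jtri x (jtri y x z) x"
  have 1: "?\<beta> = 2 *\<^sub>R ?\<alpha> - ?\<gamma>"
    using jtri_jtri[of x y x z x] by (simp add: scaleR_2 jtri_sym[of "jtri x y x" z x])
  have 2: "?\<alpha> = 2 *\<^sub>R ?\<beta> - ?\<gamma>"
    using jtri_jtri[of x z x y x] by (simp add: scaleR_2 jtri_sym[of "jtri x z x" y x] jtri_sym[of z x y])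
  have "\<phi> ?\<beta> = \<phi> ?\<gamma> \<and> \<phi> ?\<alpha> = \<phi> ?\<gamma>" if "linear \<phi>" for \<phi> :: "'a \<Rightarrow> real"
    using arg_cong[OF 1, of \<phi>] arg_cong[OF 2, of \<phi>]
    by (simp add: linear_diff[OF that] linear_scale[OF that])
  then have "?\<beta> = ?\<gamma>" "?\<alpha> = ?\<gamma>"
    by (blast intro: linear_functionals_separate)+
  then show "?\<beta> = ?\<gamma>" "jtri (jtri x y x) z x = ?\<gamma>"
    by (simp_all add: jtri_sym[of "jtri x y x" z x])
qed

lemma jtri_shift: "jtri (jtri x y x) y z = jtri x (jtri y x y) (z::'a::jordan_algebra)"
  using jtri_jtri[of x y x y z] by (simp add: algebra_simps)

text \<open>Differentiating \<open>jtri_absorb(2)\<close> in x along a direction u, and then taking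
  u = {x y x}, produces {w z w} for w = {x y x}. The remaining terms are brought to the outer form
  {x _ x}, where the unwanted ones cancel.\<close>

lemma jtri_fundamental:
  fixes x y z :: "'a::jordan_algebra"
  shows "jtri (jtri x y x) z (jtri x y x) = jtri x (jtri y (jtri x z x) y) x"
proof -
  let ?w = "jtri x y x" and ?v = "jtri y x z"
  have s: "jtri a c b = jtri b c a" for a b c :: 'a by (rule jtri_sym)
  have m: "jtri x (u - v) x = jtri x u x - jtri x v x" for u v
    by (simp add: jtri_def jmult_linear algebra_simps)
  have polar: "2 *\<^sub>R jtri (jtri x y u) z x + jtri ?w z u = 2 *\<^sub>R jtri x ?v u + jtri x (jtri y u z) x" for u
  proof (rule linear_functionals_separate)
    fix \<phi> :: "'a \<Rightarrow> real" assume lin: "linear \<phi>"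
    note L = jtri_linear linear_add[OF lin] linear_scale[OF lin] s[of u _ x]
    have E: "\<phi> (jtri (jtri (x + r *\<^sub>R u) y (x + r *\<^sub>R u)) z (x + r *\<^sub>R u))
        = \<phi> (jtri (x + r *\<^sub>R u) (jtri y (x + r *\<^sub>R u) z) (x + r *\<^sub>R u))" for r
      by (simp only: jtri_absorb(2))
    \<comment> \<open>Both sides of \<open>E\<close> are cubic polynomials in r, so four values of r
      determine the coefficient of r.\<close>
    show "\<phi> (2 *\<^sub>R jtri (jtri x y u) z x + jtri ?w z u) = \<phi> (2 *\<^sub>R jtri x ?v u + jtri x (jtri y u z) x)"
      using E[of 1] E[of 3] E[of 0] E[of 2] by (simp add: L)
  qed
  have 1: "jtri (jtri x y ?w) z x = jtri x (jtri (jtri y x y) x z) x"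
    by (simp add: jtri_absorb)
  have 2: "jtri x ?v ?w = jtri x (jtri y x ?v) x"
    by (metis s jtri_absorb(2))
  have 3: "jtri y ?w z = jtri (jtri y x y) x z"
    by (simp add: jtri_shift)
  have 4: "jtri (jtri y x y) x z = 2 *\<^sub>R jtri y x ?v - jtri y (jtri x z x) y"
    using jtri_jtri[of z x y x y] by (simp add: scaleR_2 s[of z x y] s[of ?v x y] s[of z x "jtri y x y"])
  have "jtri ?w z ?w = 2 *\<^sub>R jtri x (jtri y x ?v) x - jtri x (jtri (jtri y x y) x z) x"
    using polar[of ?w] unfolding 1 2 3 by (simp add: algebra_simps scaleR_2)
  also have "\<dots> = jtri x (jtri y (jtri x z x) y) x"
    by (simp add: 4 m jtri_linear)
  finally show ?thesis .
qed

section \<open>Quadratic maps in the unital algebra\<close>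

lemma junit_right [simp]: "a \<circ>\<^sub>J junit = (a::'a::unital_jb_algebra)"
  by (metis junit_left jmult_commute)

declare junit_left [simp]

lemma jtriple_eq_jtri: "jtriple x y = jtri x y x"
  by (simp add: jtriple_def jtri_def jmult_commute scaleR_2)

lemma jtriple_fundamental: "jtriple (jtriple x y) z = jtriple x (jtriple y (jtriple x z))"
  by (simp add: jtriple_eq_jtri jtri_fundamental)

lemma linear_jtriple: "linear (jtriple x)"
  by (simp add: linear_iff jtriple_eq_jtri jtri_linear)

lemma jtriple_junit_left [simp]: "jtriple junit b = b"
  by (simp add: jtriple_eq_jtri jtri_def)

lemma jtriple_junit_right [simp]: "jtriple a junit = a \<circ>\<^sub>J a"
  by (simp add: jtriple_eq_jtri jtri_def)

lemma jtriple_square: "jtriple (a \<circ>\<^sub>J a) z = jtriple a (jtriple a z)"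
  by (metis jtriple_fundamental jtriple_junit_left jtriple_junit_right)

lemma jtriple_scaleR_left: "jtriple (r *\<^sub>R a) b = r\<^sup>2 *\<^sub>R jtriple a b"
  by (simp add: jtriple_eq_jtri jtri_linear power2_eq_square)

lemma norm_jtriple_le: "norm (jtriple a b) \<le> 3 * (norm a)\<^sup>2 * norm b"
proof -
  have "norm (jtriple a b) \<le> 2 * norm ((a \<circ>\<^sub>J b) \<circ>\<^sub>J a) + norm ((a \<circ>\<^sub>J a) \<circ>\<^sub>J b)"
    unfolding jtriple_def by (rule order.trans[OF norm_triangle_ineq4]) simp
  also have "norm ((a \<circ>\<^sub>J b) \<circ>\<^sub>J a) \<le> (norm a * norm b) * norm a"
    by (rule order.trans[OF norm_jmult_le]) (simp add: mult_right_mono norm_jmult_le)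
  also have "norm ((a \<circ>\<^sub>J a) \<circ>\<^sub>J b) \<le> (norm a * norm a) * norm b"
    by (rule order.trans[OF norm_jmult_le]) (simp add: mult_right_mono norm_jmult_le)
  finally show ?thesis by (simp add: power2_eq_square algebra_simps)
qed

lemma bounded_linear_jtriple: "bounded_linear (jtriple a)"
  by (intro bounded_linear_intro[where K = "3 * (norm a)\<^sup>2"])
    (use norm_jtriple_le in \<open>auto simp: linear_add[OF linear_jtriple] linear_scale[OF linear_jtriple] mult.commute\<close>)

lemma bounded_bilinear_jmult: "bounded_bilinear ((\<circ>\<^sub>J) :: 'a::jb_algebra \<Rightarrow> 'a \<Rightarrow> 'a)"
  by (rule bounded_bilinear.intro)
    (auto simp: jmult_linear intro!: exI[of _ 1] norm_jmult_le)

subsection \<open>Inverses\<close>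

text \<open>When a o b is the unit, two of the three terms on each side of the linearized identity
  coincide; what is left says that multiplication by a^2 commutes with multiplication by b.\<close>

lemma jmult_square_commute_of_product_unit:
  fixes a b z :: "'a::unital_jb_algebra"
  assumes "a \<circ>\<^sub>J b = junit"
  shows "(a \<circ>\<^sub>J a) \<circ>\<^sub>J (b \<circ>\<^sub>J z) = b \<circ>\<^sub>J ((a \<circ>\<^sub>J a) \<circ>\<^sub>J z)"
  using linearized_jordan_identity[of a a z b] assms by (simp add: jmult_commute)

text \<open>Multiplication by A^2 commutes with that by B, and, with the roles exchanged,
  multiplication by B^2 commutes with that by A. These commutations evaluate both A^2 o B^2 and A o
  (A o B^2) to the unit.\<close>

lemma is_jinverse_jtriple:
  assumes "is_jinverse A B"
  shows "jtriple A B = A" and "jtriple A (B \<circ>\<^sub>J B) = junit"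
proof -
  have AB: "A \<circ>\<^sub>J B = junit" and A2B: "(A \<circ>\<^sub>J A) \<circ>\<^sub>J B = A" and BA: "B \<circ>\<^sub>J A = junit"
    using assms by (simp_all add: is_jinverse_def jmult_commute)
  show "jtriple A B = A" by (simp add: jtriple_def AB A2B scaleR_2)
  have 1: "(A \<circ>\<^sub>J A) \<circ>\<^sub>J (B \<circ>\<^sub>J B) = junit"
    using jmult_square_commute_of_product_unit[OF AB, of B] by (simp add: A2B BA)
  have 2: "A \<circ>\<^sub>J (A \<circ>\<^sub>J (B \<circ>\<^sub>J B)) = junit"
    using jmult_square_commute_of_product_unit[OF BA, of A] 1 by (simp add: jmult_commute)
  then have "(A \<circ>\<^sub>J (B \<circ>\<^sub>J B)) \<circ>\<^sub>J A = junit" by (simp only: jmult_commute)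
  with 1 show "jtriple A (B \<circ>\<^sub>J B) = junit" by (simp add: jtriple_def scaleR_2)
qed

text \<open>Write U for the quadratic map. The fundamental formula turns {A B^2 A} = I into U_A
  U_(B^2) U_A = id, so U_A is bijective, and {A B A} = A into U_A U_B U_A = U_A, from which U_A can
  be cancelled on either side.\<close>

lemma is_jinverse_cancel:
  assumes "is_jinverse A B"
  shows "jtriple A (jtriple B z) = z" and "jtriple B (jtriple A z) = z"
proof -
  have *: "jtriple A (jtriple (B \<circ>\<^sub>J B) (jtriple A z)) = z" for z
    using jtriple_fundamental[of A "B \<circ>\<^sub>J B" z] by (simp add: is_jinverse_jtriple[OF assms])
  have **: "jtriple A (jtriple B (jtriple A z)) = jtriple A z" for z
    using jtriple_fundamental[of A B z] by (simp add: is_jinverse_jtriple[OF assms])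
  show "jtriple A (jtriple B z) = z" by (metis * **)
  show "jtriple B (jtriple A z) = z" by (metis * **)
qed

lemma jmult_jtriple_commute: "a \<circ>\<^sub>J jtriple a b = jtriple a (a \<circ>\<^sub>J b)"
  using jordan_identity[of a b] by (simp add: jtriple_def jmult_linear jmult_commute)

text \<open>For the converse, multiplication by A commutes with the quadratic map of A, so A o B and
  the unit have the same image A o A under an injective map. Uniqueness of inverses and inverses of
  triples are then questions about bijections.\<close>

lemma is_jinverse_iff: "is_jinverse A B \<longleftrightarrow> bij (jtriple A) \<and> jtriple A B = A"
proof
  assume *: "is_jinverse A B"
  show "bij (jtriple A) \<and> jtriple A B = A"
    using is_jinverse_jtriple(1)[OF *] is_jinverse_cancel[OF *] by (metis bijI')
next
  assume *: "bij (jtriple A) \<and> jtriple A B = A"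
  then have inj: "x = y" if "jtriple A x = jtriple A y" for x y
    using that by (meson bij_is_inj injD)
  have "A \<circ>\<^sub>J B = junit"
    by (rule inj) (use * jmult_jtriple_commute[of A B] in simp)
  moreover have "(A \<circ>\<^sub>J A) \<circ>\<^sub>J B = A"
    using * calculation by (simp add: jtriple_def scaleR_2)
  ultimately show "is_jinverse A B" by (simp add: is_jinverse_def)
qed

lemma jinvertible_iff_bij: "jinvertible A \<longleftrightarrow> bij (jtriple A)"
  by (metis bij_pointE is_jinverse_iff jinvertible_def)

lemma is_jinverse_unique: "is_jinverse A B \<Longrightarrow> is_jinverse A C \<Longrightarrow> B = C"
  by (metis bij_is_inj injD is_jinverse_iff)

lemma jinverse_eqI: "is_jinverse A B \<Longrightarrow> jinverse A = B"
  unfolding jinverse_def using is_jinverse_unique by blast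

lemma is_jinverse_jinverse: "jinvertible A \<Longrightarrow> is_jinverse A (jinverse A)"
  using jinverse_eqI jinvertible_def by blast

lemma jtriple_jinverse_cancel [simp]:
  assumes "jinvertible A"
  shows "jtriple A (jtriple (jinverse A) z) = z" and "jtriple (jinverse A) (jtriple A z) = z"
  using is_jinverse_cancel[OF is_jinverse_jinverse[OF assms]] by simp_all

lemma is_jinverse_sym:
  assumes "is_jinverse A B" shows "is_jinverse B A"
proof -
  have "bij (jtriple B)" using is_jinverse_cancel[OF assms] by (metis bijI')
  moreover have "jtriple B A = B"
    using is_jinverse_cancel(2)[OF assms, of B] is_jinverse_jtriple(1)[OF assms] by simp
  ultimately show ?thesis by (simp add: is_jinverse_iff)
qed

lemma jinvertible_jinverse [simp]: "jinvertible A \<Longrightarrow> jinvertible (jinverse A)"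
  using is_jinverse_jinverse is_jinverse_sym jinvertible_def by blast

lemma jinverse_jinverse [simp]: "jinvertible A \<Longrightarrow> jinverse (jinverse A) = A"
  by (simp add: is_jinverse_jinverse is_jinverse_sym jinverse_eqI)

lemma jinverse_junit [simp]: "jinverse junit = junit" and jinvertible_junit [simp]: "jinvertible junit"
proof -
  have "is_jinverse junit junit" by (simp add: is_jinverse_def)
  then show "jinverse junit = junit" "jinvertible junit"
    by (auto intro: jinverse_eqI simp: jinvertible_def)
qed

lemma is_jinverse_jtripleI:
  assumes "is_jinverse A A'" "is_jinverse B B'"
  shows "is_jinverse (jtriple A B) (jtriple A' B')"
proof -
  have "bij (jtriple A \<circ> jtriple B \<circ> jtriple A)"
    using assms by (auto simp: is_jinverse_iff intro!: bij_comp)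
  moreover have "jtriple A \<circ> jtriple B \<circ> jtriple A = jtriple (jtriple A B)"
    by (auto simp: jtriple_fundamental)
  moreover have "jtriple (jtriple A B) (jtriple A' B') = jtriple A B"
    using assms by (simp add: jtriple_fundamental is_jinverse_cancel is_jinverse_jtriple)
  ultimately show ?thesis by (simp add: is_jinverse_iff)
qed

lemma jinvertible_jtriple [simp]: "jinvertible A \<Longrightarrow> jinvertible B \<Longrightarrow> jinvertible (jtriple A B)"
  using is_jinverse_jtripleI jinvertible_def by blast

lemma jinverse_jtriple [simp]:
  "jinvertible A \<Longrightarrow> jinvertible B \<Longrightarrow> jinverse (jtriple A B) = jtriple (jinverse A) (jinverse B)"
  by (intro jinverse_eqI is_jinverse_jtripleI is_jinverse_jinverse)

lemma is_jinverse_scaleR: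
  "is_jinverse A B \<Longrightarrow> r \<noteq> 0 \<Longrightarrow> is_jinverse (r *\<^sub>R A) (inverse r *\<^sub>R B)"
  by (simp add: is_jinverse_def jmult_linear)

lemma jinvertible_scaleR [simp]: "jinvertible A \<Longrightarrow> r \<noteq> 0 \<Longrightarrow> jinvertible (r *\<^sub>R A)"
  using is_jinverse_scaleR jinvertible_def by blast

lemma jinverse_scaleR: "jinvertible A \<Longrightarrow> r \<noteq> 0 \<Longrightarrow> jinverse (r *\<^sub>R A) = inverse r *\<^sub>R jinverse A"
  by (intro jinverse_eqI is_jinverse_scaleR is_jinverse_jinverse)

text \<open>Through the fundamental formula this passes from invertibility of {a b a} back to
  invertibility of the outer element a.\<close>

lemma bij_sandwich:
  assumes b: "bij (\<lambda>z. f (h (f z)))" shows "bij f"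
proof (rule bijI)
  show "inj f"
  proof (rule injI)
    fix x y assume "f x = f y"
    then have "f (h (f x)) = f (h (f y))" by simp
    then show "x = y" using injD[OF bij_is_inj[OF b], of x y] by simp
  qed
  show "surj f"
    using bij_is_surj[OF b] unfolding surj_def by blast
qed

lemma jinvertible_square_iff: "jinvertible (a \<circ>\<^sub>J a) \<longleftrightarrow> jinvertible a"
proof
  assume "jinvertible (a \<circ>\<^sub>J a)"
  then have b: "bij (\<lambda>z. jtriple a (jtriple a z))"
    by (metis (no_types, lifting) ext jinvertible_iff_bij jtriple_square)
  then show "jinvertible a"
    using bij_sandwich[of "jtriple a" "\<lambda>z. z"] by (simp add: jinvertible_iff_bij)
next
  assume "jinvertible a"
  then show "jinvertible (a \<circ>\<^sub>J a)"
    using jinvertible_jtriple[of a junit] by simp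
qed

subsection \<open>Polynomials in one element\<close>

text \<open>Horner evaluation fixes the nesting of the products as a o (a o (...)). Power
  associativity is not built in; it is the content of \<open>jpoly_mult\<close>.\<close>

definition jpoly :: "real poly \<Rightarrow> 'a::unital_jb_algebra \<Rightarrow> 'a" where
  "jpoly p a = fold_coeffs (\<lambda>c x. c *\<^sub>R junit + a \<circ>\<^sub>J x) p 0"

lemma jpoly_0 [simp]: "jpoly 0 a = 0"
  by (simp add: jpoly_def)

lemma jpoly_pCons [simp]: "jpoly (pCons c p) a = c *\<^sub>R junit + a \<circ>\<^sub>J jpoly p a"
  by (cases "p = 0 \<and> c = 0") (auto simp add: jpoly_def)

lemma jpoly_1 [simp]: "jpoly 1 a = junit"
  by (simp add: one_pCons)

lemma jpoly_add: "jpoly (p + q) a = jpoly p a + jpoly q a"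
  by (induction p q rule: poly_induct2) (simp_all add: jmult_linear algebra_simps)

lemma jpoly_smult: "jpoly (smult c p) a = c *\<^sub>R jpoly p a"
  by (induction p) (simp_all add: jmult_linear algebra_simps)

lemma jpoly_minus: "jpoly (- p) a = - jpoly p a"
  using jpoly_smult[of "-1" p a] by simp

lemma jpoly_diff: "jpoly (p - q) a = jpoly p a - jpoly q a"
  using jpoly_add[of p "- q" a] by (simp add: jpoly_minus)

text \<open>Operator commutation: the multiplication operators of a and b commute. This is a genuine
  restriction, although the product itself is commutative.\<close>

definition jcommutes :: "'a::unital_jb_algebra \<Rightarrow> 'a \<Rightarrow> bool" where
  "jcommutes a b \<longleftrightarrow> (\<forall>z. a \<circ>\<^sub>J (b \<circ>\<^sub>J z) = b \<circ>\<^sub>J (a \<circ>\<^sub>J z))"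

text \<open>The linearized identity expresses multiplication by a o (a o p) through the
  multiplications by a, a^2, p and a o p (fact \<open>F\<close>). Each of these commutes with the
  multiplications by a and a^2.\<close>

lemma jcommutes_double_product:
  assumes p: "jcommutes a p" "jcommutes s p" and q: "jcommutes a q" "jcommutes s q"
    and "q = a \<circ>\<^sub>J p" and "s = a \<circ>\<^sub>J a"
  shows "jcommutes a (a \<circ>\<^sub>J q)" "jcommutes s (a \<circ>\<^sub>J q)"
proof -
  have F: "(a \<circ>\<^sub>J q) \<circ>\<^sub>J z
      = 2 *\<^sub>R (q \<circ>\<^sub>J (a \<circ>\<^sub>J z)) + s \<circ>\<^sub>J (p \<circ>\<^sub>J z) - a \<circ>\<^sub>J (a \<circ>\<^sub>J (p \<circ>\<^sub>J z)) - p \<circ>\<^sub>J (a \<circ>\<^sub>J (a \<circ>\<^sub>J z))" for z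
    using linearized_jordan_identity[of a p a z] assms(5,6)
    by (simp add: jmult_commute scaleR_2 algebra_simps)
  have r: "p \<circ>\<^sub>J (a \<circ>\<^sub>J z) = a \<circ>\<^sub>J (p \<circ>\<^sub>J z)" "p \<circ>\<^sub>J (s \<circ>\<^sub>J z) = s \<circ>\<^sub>J (p \<circ>\<^sub>J z)"
    "q \<circ>\<^sub>J (a \<circ>\<^sub>J z) = a \<circ>\<^sub>J (q \<circ>\<^sub>J z)" "q \<circ>\<^sub>J (s \<circ>\<^sub>J z) = s \<circ>\<^sub>J (q \<circ>\<^sub>J z)" for z
    using p q by (simp_all add: jcommutes_def)
  have s: "s \<circ>\<^sub>J (a \<circ>\<^sub>J z) = a \<circ>\<^sub>J (s \<circ>\<^sub>J z)" for z
    using jordan_identity[of a z] assms(6) by (simp add: jmult_commute)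
  show "jcommutes a (a \<circ>\<^sub>J q)"
    by (simp add: jcommutes_def F jmult_linear r s)
  show "jcommutes s (a \<circ>\<^sub>J q)"
    by (simp add: jcommutes_def F jmult_linear r s)
qed

lemma jcommutes_linear:
  "jcommutes a junit" "jcommutes a x \<Longrightarrow> jcommutes a y \<Longrightarrow> jcommutes a (x + y)"
  "jcommutes a x \<Longrightarrow> jcommutes a (r *\<^sub>R x)"
  by (simp_all add: jcommutes_def jmult_linear)

lemma jcommutes_jpoly: "jcommutes a (jpoly p a)"
proof -
  let ?s = "a \<circ>\<^sub>J a"
  have 0: "jcommutes a a" "jcommutes ?s a"
    using jordan_identity[of a] by (simp_all add: jcommutes_def jmult_commute)
  \<comment> \<open>The recursion climbs two powers of a at a time, so the induction carries both
    p(a) and a o p(a), and commutation with both a and a^2.\<close>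
  have "jcommutes a (jpoly p a) \<and> jcommutes ?s (jpoly p a) \<and>
      jcommutes a (a \<circ>\<^sub>J jpoly p a) \<and> jcommutes ?s (a \<circ>\<^sub>J jpoly p a)"
  proof (induction p)
    case 0
    show ?case by (simp add: jcommutes_def)
  next
    case (pCons c p)
    then show ?case
      using jcommutes_double_product[of a "jpoly p a" ?s "a \<circ>\<^sub>J jpoly p a"] \<open>jcommutes a a\<close> \<open>jcommutes ?s a\<close>
      by (auto simp: jmult_linear intro!: jcommutes_linear)
  qed
  then show ?thesis by blast
qed

lemma jpoly_mult: "jpoly (p * q) a = jpoly p a \<circ>\<^sub>J jpoly q a"
proof (induction p)
  case (pCons c p)
  have "(a \<circ>\<^sub>J jpoly p a) \<circ>\<^sub>J jpoly q a = a \<circ>\<^sub>J (jpoly p a \<circ>\<^sub>J jpoly q a)"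
    using jcommutes_jpoly[of a q] unfolding jcommutes_def by (metis jmult_commute)
  with pCons show ?case
    by (simp add: jpoly_add jpoly_smult jmult_linear)
qed simp

lemma jtriple_jpoly: "jtriple (jpoly p a) (jpoly q a) = jpoly (p * p * q) a"
proof -
  have "jtriple (jpoly p a) (jpoly q a) = jpoly (smult 2 (p * q * p) - p * p * q) a"
    by (simp only: jtriple_def jpoly_mult jpoly_smult jpoly_diff)
  also have "smult 2 (p * q * p) - p * p * q = p * p * q"
    by (simp add: numeral_mult_conv_smult [symmetric] algebra_simps)
  finally show ?thesis .
qed

lemma jinvertible_jpoly_mult_iff:
  "jinvertible (jpoly (p * q) a) \<longleftrightarrow> jinvertible (jpoly p a) \<and> jinvertible (jpoly q a)"
proof -
  let ?x = "jpoly p a" and ?y = "jpoly q a"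
  \<comment> \<open>The square of the product is a triple with outer element x, and invertibility of
    triples and squares is understood already; a Jordan product offers no such direct
    access.\<close>
  have *: "jpoly (p * q) a \<circ>\<^sub>J jpoly (p * q) a = jtriple ?x (?y \<circ>\<^sub>J ?y)"
    by (simp add: jpoly_mult [symmetric] jtriple_jpoly algebra_simps)
  show ?thesis
  proof
    assume "jinvertible ?x \<and> jinvertible ?y"
    then have "jinvertible (jtriple ?x (?y \<circ>\<^sub>J ?y))"
      by (simp add: jinvertible_square_iff)
    then show "jinvertible (jpoly (p * q) a)"
      by (metis * jinvertible_square_iff)
  next
    assume "jinvertible (jpoly (p * q) a)"
    then have "jinvertible (jtriple ?x (?y \<circ>\<^sub>J ?y))"
      by (metis * jinvertible_square_iff)
    then have b: "bij (\<lambda>z. jtriple ?x (jtriple (?y \<circ>\<^sub>J ?y) (jtriple ?x z)))"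
      by (metis (no_types, lifting) ext jinvertible_iff_bij jtriple_fundamental)
    then have x: "jinvertible ?x"
      using bij_sandwich[of "jtriple ?x" "jtriple (?y \<circ>\<^sub>J ?y)"] by (simp add: jinvertible_iff_bij)
    have "jtriple (jinverse ?x) (jtriple ?x (?y \<circ>\<^sub>J ?y)) = ?y \<circ>\<^sub>J ?y"
      using x by simp
    then have "jinvertible (?y \<circ>\<^sub>J ?y)"
      using \<open>jinvertible (jtriple ?x (?y \<circ>\<^sub>J ?y))\<close> x by (metis jinvertible_jtriple jinvertible_jinverse)
    then show "jinvertible ?x \<and> jinvertible ?y" using x jinvertible_square_iff by blast
  qed
qed

subsection \<open>The positive cone\<close>

text \<open>The norm of the unit equals its own square, hence is 0 or 1; the value 0 occurs in the
  zero algebra, which the class admits.\<close>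

lemma norm_junit_le: "norm (junit::'a::unital_jb_algebra) \<le> 1"
  using norm_jsquare[of "junit::'a"] by (auto simp: power2_eq_square)

lemma trivial_algebra: "junit = (0::'a::unital_jb_algebra) \<Longrightarrow> (x::'a) = 0"
  by (metis jmult_zero(1) junit_left)

lemma norm_scaleR_junit_le: "norm (r *\<^sub>R (junit::'a::unital_jb_algebra)) \<le> \<bar>r\<bar>"
  using mult_left_mono[OF norm_junit_le, of "\<bar>r\<bar>"] by simp

lemma jmult_difference_squares: "(y - z) \<circ>\<^sub>J (y + z) = y \<circ>\<^sub>J y - z \<circ>\<^sub>J (z::'a::jordan_algebra)"
  by (simp add: jmult_linear jmult_commute)

text \<open>The equation I - x = (I - y)^2 is the fixed point equation y = (x + y^2) / 2. The radius
  (1 + norm x) / 2 makes the ball invariant and is at the same time the contraction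
  constant.\<close>

lemma junit_minus_is_square:
  fixes x :: "'a::unital_jb_algebra"
  assumes "norm x < 1"
  shows "\<exists>c. junit - x = c \<circ>\<^sub>J c"
proof -
  define q \<rho> where "q = norm x" and "\<rho> = (1 + q) / 2"
  have q: "0 \<le> q" "q < 1" and \<rho>: "0 \<le> \<rho>" "\<rho> < 1" using assms by (simp_all add: q_def \<rho>_def)
  have 1: "(q + \<rho>\<^sup>2) / 2 \<le> \<rho>"
  proof -
    have "(1 + q)\<^sup>2 \<le> 2\<^sup>2" using q by (intro power_mono) auto
    then show ?thesis by (simp add: \<rho>_def power_divide)
  qed
  define f where "f = (\<lambda>y. (1/2) *\<^sub>R (x + y \<circ>\<^sub>J y))"
  have "\<exists>!y\<in>cball 0 \<rho>. f y = y"
  proof (rule Banach_fix[where c = \<rho>])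
    show "f ` cball 0 \<rho> \<subseteq> cball 0 \<rho>"
    proof clarsimp
      fix y :: 'a assume "norm y \<le> \<rho>"
      then have "norm (x + y \<circ>\<^sub>J y) \<le> q + \<rho>\<^sup>2"
        by (intro norm_triangle_mono) (auto simp: q_def norm_jsquare intro: power_mono)
      then show "norm (f y) \<le> \<rho>" using 1 by (simp add: f_def)
    qed
    fix y z :: 'a assume yz: "y \<in> cball 0 \<rho>" "z \<in> cball 0 \<rho>"
    have "f y - f z = (1/2) *\<^sub>R ((y - z) \<circ>\<^sub>J (y + z))"
      by (simp add: f_def jmult_difference_squares algebra_simps)
    then have "norm (f y - f z) \<le> (1/2) * (norm (y - z) * norm (y + z))"
      using norm_jmult_le[of "y - z" "y + z"] by simp
    also have "\<dots> \<le> (1/2) * (norm (y - z) * (\<rho> + \<rho>))"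
      using yz by (intro mult_left_mono norm_triangle_mono) auto
    finally show "dist (f y) (f z) \<le> \<rho> * dist y z" by (simp add: dist_norm algebra_simps)
  qed (use \<rho> in \<open>auto simp: complete_eq_closed\<close>)
  then obtain y where "f y = y" by blast
  then have "x + y \<circ>\<^sub>J y = 2 *\<^sub>R y" by (simp add: f_def) (metis scaleR_half_double scaleR_2 scaleR_right_distrib)
  then have "junit - x = (junit - y) \<circ>\<^sub>J (junit - y)"
    by (simp add: jmult_linear scaleR_2 algebra_simps)
  then show ?thesis by blast
qed

text \<open>Membership in a ball of radius r around r I. Closure under addition and nonnegative
  scaling is then a matter of the triangle inequality and homogeneity of the norm.\<close>

definition jpos :: "'a::unital_jb_algebra \<Rightarrow> bool" where
  "jpos x \<longleftrightarrow> (\<exists>r. norm (r *\<^sub>R junit - x) \<le> r)"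

lemma jposI: "norm (r *\<^sub>R junit - x) \<le> r \<Longrightarrow> jpos x"
  by (auto simp: jpos_def)

text \<open>After rescaling, the complement of a^2 / s in the unit is itself a square c^2. Since c^2
  + b^2 = I with b^2 = a^2 / s, the axiom \<open>norm_jsquare_le\<close> bounds c^2 by the
  unit.\<close>

lemma norm_unit_diff_square_less:
  fixes a :: "'a::unital_jb_algebra"
  assumes "(norm a)\<^sup>2 < s"
  shows "norm (s *\<^sub>R junit - a \<circ>\<^sub>J a) \<le> s"
proof -
  have s: "s > 0" using assms zero_le_power2[of "norm a"] by linarith
  have "norm ((1/s) *\<^sub>R (a \<circ>\<^sub>J a)) < 1"
    using assms s by (simp add: norm_jsquare)
  then obtain c where c: "junit - (1/s) *\<^sub>R (a \<circ>\<^sub>J a) = c \<circ>\<^sub>J c"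
    using junit_minus_is_square by blast
  define b where "b = (1 / sqrt s) *\<^sub>R a"
  have b: "b \<circ>\<^sub>J b = (1/s) *\<^sub>R (a \<circ>\<^sub>J a)" using s by (simp add: b_def jmult_linear)
  have "norm (c \<circ>\<^sub>J c) \<le> norm (c \<circ>\<^sub>J c + b \<circ>\<^sub>J b)" by (rule norm_jsquare_le)
  also have "\<dots> \<le> 1" using c b norm_junit_le by (metis diff_add_cancel)
  finally have "s * norm (junit - (1/s) *\<^sub>R (a \<circ>\<^sub>J a)) \<le> s" using s c by simp
  moreover have "s *\<^sub>R junit - a \<circ>\<^sub>J a = s *\<^sub>R (junit - (1/s) *\<^sub>R (a \<circ>\<^sub>J a))"
    using s by (simp add: algebra_simps)
  ultimately show ?thesis using s by (metis abs_of_pos norm_scaleR)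
qed

lemma norm_unit_diff_square:
  fixes a :: "'a::unital_jb_algebra"
  assumes "(norm a)\<^sup>2 \<le> s"
  shows "norm (s *\<^sub>R junit - a \<circ>\<^sub>J a) \<le> s"
proof (rule field_le_epsilon)
  fix e :: real assume "e > 0"
  have "norm (s *\<^sub>R junit - a \<circ>\<^sub>J a) = norm (((s + e/2) *\<^sub>R junit - a \<circ>\<^sub>J a) - (e/2) *\<^sub>R junit)"
    by (simp add: algebra_simps)
  also have "\<dots> \<le> norm ((s + e/2) *\<^sub>R junit - a \<circ>\<^sub>J a) + norm ((e/2) *\<^sub>R (junit::'a))"
    by (rule norm_triangle_ineq4)
  also have "\<dots> \<le> (s + e/2) + e/2"
    by (intro add_mono norm_unit_diff_square_less)
      (use assms \<open>e > 0\<close> norm_scaleR_junit_le[of "e/2", where 'a='a] in auto)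
  finally show "norm (s *\<^sub>R junit - a \<circ>\<^sub>J a) \<le> s + e" by simp
qed

lemma jpos_square: "jpos (a \<circ>\<^sub>J a)"
  using norm_unit_diff_square by (metis jposI order_refl)

lemma jpos_add_epsilon_is_square:
  assumes "jpos x" "e > 0"
  shows "\<exists>c. x + e *\<^sub>R junit = c \<circ>\<^sub>J c"
proof -
  obtain r where r: "norm (r *\<^sub>R junit - x) \<le> r" using assms(1) jpos_def by blast
  then have "r \<ge> 0" by (meson norm_ge_zero order_trans)
  define t where "t = r + e"
  have t: "t > 0" using \<open>r \<ge> 0\<close> assms(2) t_def by simp
  have "norm ((1/t) *\<^sub>R (r *\<^sub>R junit - x)) < 1"
    using r t assms(2) by (simp add: t_def)
  then obtain c where c: "junit - (1/t) *\<^sub>R (r *\<^sub>R junit - x) = c \<circ>\<^sub>J c"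
    using junit_minus_is_square by blast
  have "x + e *\<^sub>R junit = t *\<^sub>R (junit - (1/t) *\<^sub>R (r *\<^sub>R junit - x))"
    using t by (simp add: scaleR_right_diff_distrib t_def scaleR_left_distrib)
  also have "\<dots> = (sqrt t *\<^sub>R c) \<circ>\<^sub>J (sqrt t *\<^sub>R c)"
    using t by (simp add: c jmult_linear)
  finally show ?thesis by blast
qed

text \<open>The existential radius in \<open>jpos\<close> may be any s >= norm x, because x plus a
  small multiple of the unit is a square. A prescribed radius makes positivity a closed condition
  that can be computed from one norm.\<close>

lemma jpos_iff_norm:
  assumes "norm x \<le> s"
  shows "jpos x \<longleftrightarrow> norm (s *\<^sub>R junit - x) \<le> s"
proof
  assume x: "jpos x"
  show "norm (s *\<^sub>R junit - x) \<le> s"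
  proof (rule field_le_epsilon)
    fix e :: real assume "e > 0"
    obtain c where c: "x + (e/2) *\<^sub>R junit = c \<circ>\<^sub>J c"
      using jpos_add_epsilon_is_square[OF x, of "e/2"] \<open>e > 0\<close> by auto
    have "(norm c)\<^sup>2 \<le> s + e/2"
    proof -
      have "(norm c)\<^sup>2 \<le> norm x + norm ((e/2) *\<^sub>R (junit::'a))"
        by (metis c norm_jsquare norm_triangle_ineq)
      also have "\<dots> \<le> s + e/2"
        using norm_scaleR_junit_le[of "e/2", where 'a='a] \<open>e > 0\<close> assms by (intro add_mono) simp_all
      finally show ?thesis .
    qed
    then have "norm ((s + e/2) *\<^sub>R junit - c \<circ>\<^sub>J c) \<le> s + e/2" by (rule norm_unit_diff_square)
    moreover have "(s + e/2) *\<^sub>R junit - c \<circ>\<^sub>J c = s *\<^sub>R junit - x"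
      by (simp add: c[symmetric] algebra_simps)
    ultimately show "norm (s *\<^sub>R junit - x) \<le> s + e" using \<open>e > 0\<close> by simp
  qed
qed (rule jposI)

lemma jpos_add:
  assumes "jpos x" "jpos y" shows "jpos (x + y)"
proof -
  obtain r s where "norm (r *\<^sub>R junit - x) \<le> r" "norm (s *\<^sub>R junit - y) \<le> s"
    using assms jpos_def by blast
  then have "norm ((r *\<^sub>R junit - x) + (s *\<^sub>R junit - y)) \<le> r + s" by (rule norm_triangle_mono)
  moreover have "(r *\<^sub>R junit - x) + (s *\<^sub>R junit - y) = (r + s) *\<^sub>R junit - (x + y)"
    by (simp add: algebra_simps)
  ultimately show ?thesis using jposI by metis
qed

lemma jpos_scaleR:
  assumes "jpos x" "c \<ge> 0" shows "jpos (c *\<^sub>R x)"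
proof -
  obtain r where "norm (r *\<^sub>R junit - x) \<le> r"
    using assms jpos_def by blast
  then have "norm (c *\<^sub>R (r *\<^sub>R junit - x)) \<le> c * r" using assms(2) by (simp add: mult_left_mono)
  moreover have "c *\<^sub>R (r *\<^sub>R junit - x) = (c * r) *\<^sub>R junit - c *\<^sub>R x"
    by (simp add: algebra_simps)
  ultimately show ?thesis using jposI by metis
qed

lemma jpos_0 [simp]: "jpos 0"
  by (rule jposI[of 0]) simp

lemma jpos_junit [simp]: "jpos junit"
  using jpos_square[of junit] by simp

lemma jpos_sum: "(\<And>i. i \<in> I \<Longrightarrow> jpos (f i)) \<Longrightarrow> jpos (sum f I)"
  by (induction I rule: infinite_finite_induct) (auto intro: jpos_add)

lemma jpos_limit:
  assumes "X \<longlonglongrightarrow> x" "\<And>n. jpos (X n)" shows "jpos x"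
proof (rule jposI)
  have "(\<lambda>n. norm (norm (X n) *\<^sub>R junit - X n)) \<longlonglongrightarrow> norm (norm x *\<^sub>R junit - x)"
    by (intro tendsto_intros assms(1))
  moreover have "(\<lambda>n. norm (X n)) \<longlonglongrightarrow> norm x" by (intro tendsto_intros assms(1))
  ultimately show "norm (norm x *\<^sub>R junit - x) \<le> norm x"
    by (rule LIMSEQ_le) (use assms(2) jpos_iff_norm in blast)
qed

text \<open>Both summands become squares after adding d I, so \<open>norm_jsquare_le\<close>
  applies; undoing the shifts costs d on the left and 2 d on the right.\<close>

lemma norm_le_norm_add_jpos:
  fixes x y :: "'a::unital_jb_algebra"
  assumes "jpos x" "jpos y" shows "norm x \<le> norm (x + y)"
proof (rule field_le_epsilon)
  fix e :: real assume "e > 0"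
  define d where "d = e / 3"
  have "d > 0" using \<open>e > 0\<close> d_def by simp
  obtain a b where ab: "x + d *\<^sub>R junit = a \<circ>\<^sub>J a" "y + d *\<^sub>R junit = b \<circ>\<^sub>J b"
    using jpos_add_epsilon_is_square assms \<open>d > 0\<close> by metis
  have n: "norm (c *\<^sub>R (junit::'a)) \<le> c" if "c > 0" for c
    using norm_scaleR_junit_le[of c, where 'a='a] that by simp
  have "norm x = norm ((x + d *\<^sub>R junit) - d *\<^sub>R junit)" by simp
  also have "\<dots> \<le> norm (x + d *\<^sub>R junit) + d"
    by (rule order.trans[OF norm_triangle_ineq4]) (use n[OF \<open>d > 0\<close>] in simp)
  also have "norm (x + d *\<^sub>R junit) \<le> norm ((x + d *\<^sub>R junit) + (y + d *\<^sub>R junit))"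
    unfolding ab by (rule norm_jsquare_le)
  also have "(x + d *\<^sub>R junit) + (y + d *\<^sub>R junit) = (x + y) + (2 * d) *\<^sub>R junit"
    unfolding scaleR_scaleR[symmetric] scaleR_2 by (simp add: algebra_simps)
  also have "norm \<dots> \<le> norm (x + y) + 2 * d"
    using n[of "2 * d"] \<open>d > 0\<close> by (intro norm_triangle_mono) auto
  finally show "norm x \<le> norm (x + y) + e" by (simp add: d_def)
qed

subsection \<open>The spectrum\<close>

text \<open>The Neumann series y of x. A Jordan inverse needs two equations, so the products of y
  with x and with x^2 are both computed, as the series shifted by one and by two places; the second
  shift uses power associativity.\<close>

lemma jinvertible_junit_minus:
  fixes x :: "'a::unital_jb_algebra"
  assumes "norm x < 1"
  shows "jinvertible (junit - x)"
proof -
  define P where "P = (\<lambda>n. jpoly (monom 1 n) x)"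
  have P0: "P 0 = junit" by (simp add: P_def one_pCons[symmetric] monom_0)
  have PSuc: "P (Suc n) = x \<circ>\<^sub>J P n" for n by (simp add: P_def monom_Suc)
  have PSuc2: "P (Suc (Suc n)) = (x \<circ>\<^sub>J x) \<circ>\<^sub>J P n" for n
  proof -
    have "jpoly (monom 1 2 * monom 1 n) x = jpoly (monom 1 2) x \<circ>\<^sub>J P n"
      unfolding P_def by (rule jpoly_mult)
    moreover have "jpoly (monom 1 2) x = x \<circ>\<^sub>J x"
      by (simp add: numeral_2_eq_2 monom_Suc monom_0)
    ultimately show ?thesis by (simp add: P_def mult_monom)
  qed
  have norm_P: "norm (P n) \<le> norm x ^ n" for n
  proof (induction n)
    case (Suc n)
    have "norm (P (Suc n)) \<le> norm x * norm (P n)" unfolding PSuc by (rule norm_jmult_le)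
    also have "\<dots> \<le> norm x * norm x ^ n" by (intro mult_left_mono Suc) simp
    finally show ?case by simp
  qed (simp add: P0 norm_junit_le)
  have sm: "summable P"
    by (rule summable_comparison_test'[where N = 0, OF summable_geometric[of "norm x"]])
      (use assms norm_P in auto)
  define y where "y = suminf P"
  have y: "P sums y" using sm by (simp add: y_def summable_sums)
  interpret bounded_bilinear "(\<circ>\<^sub>J) :: 'a \<Rightarrow> 'a \<Rightarrow> 'a" by (rule bounded_bilinear_jmult)
  have xy: "(\<lambda>n. P (Suc n)) sums (x \<circ>\<^sub>J y)"
    unfolding PSuc by (rule bounded_linear.sums[OF bounded_linear_right y])
  have xxy: "(\<lambda>n. P (Suc (Suc n))) sums ((x \<circ>\<^sub>J x) \<circ>\<^sub>J y)"
    unfolding PSuc2 by (rule bounded_linear.sums[OF bounded_linear_right y])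
  have 1: "x \<circ>\<^sub>J y = y - junit"
    using xy sums_unique2[of "\<lambda>n. P (Suc n)"] y by (metis P0 sums_Suc_iff sums_split_initial_segment[of P y 1, simplified] diff_add_cancel)
  have 2: "(x \<circ>\<^sub>J x) \<circ>\<^sub>J y = y - junit - x"
  proof -
    have "(\<lambda>n. P (Suc n)) sums ((x \<circ>\<^sub>J x) \<circ>\<^sub>J y + P (Suc 0))"
      using xxy by (subst (asm) sums_Suc_iff)
    then have "(x \<circ>\<^sub>J x) \<circ>\<^sub>J y + P (Suc 0) = x \<circ>\<^sub>J y"
      using xy sums_unique2 by blast
    then show ?thesis by (simp add: 1 PSuc P0 algebra_simps)
  qed
  have "is_jinverse (junit - x) y"
    by (simp add: is_jinverse_def jmult_linear 1 2)
  then show ?thesis using jinvertible_def by blast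
qed

lemma jinvertible_uminus_iff: "jinvertible (- x) \<longleftrightarrow> jinvertible x"
  using jinvertible_scaleR[of x "-1"] jinvertible_scaleR[of "- x" "-1"] by auto

lemma jinvertible_minus_scaleR:
  assumes "norm x < \<bar>r\<bar>" shows "jinvertible (x - r *\<^sub>R junit)"
proof -
  have r: "r \<noteq> 0" using assms by auto
  have "norm ((1/r) *\<^sub>R x) < 1" using assms r by (simp add: field_simps)
  then have "jinvertible ((- r) *\<^sub>R (junit - (1/r) *\<^sub>R x))"
    using r by (intro jinvertible_scaleR jinvertible_junit_minus) auto
  also have "(- r) *\<^sub>R (junit - (1/r) *\<^sub>R x) = x - r *\<^sub>R junit"
    using r by (simp add: algebra_simps)
  finally show ?thesis .
qed

lemma jspectrum_bound: "r \<in> jspectrum x \<Longrightarrow> \<bar>r\<bar> \<le> norm x"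
  using jinvertible_minus_scaleR[of x r] by (auto simp: jspectrum_def not_less[symmetric])

lemma norm_jpoly_power_le: "norm a \<le> 1 \<Longrightarrow> norm (jpoly ([:0, 1:] ^ n) a) \<le> 1"
proof (induction n)
  case (Suc n)
  then show ?case
    using norm_jmult_le[of a "jpoly ([:0, 1:] ^ n) a"] mult_mono[of "norm a" 1 "norm (jpoly ([:0, 1:] ^ n) a)" 1]
    by (simp add: jpoly_mult)
qed (simp add: norm_junit_le)

lemma jpoly_square: "jpoly (p\<^sup>2) a = jpoly p a \<circ>\<^sub>J jpoly p a"
  by (simp add: power2_eq_square jpoly_mult)

lemma jpoly_sum: "jpoly (sum f I) a = (\<Sum>i\<in>I. jpoly (f i) a)"
  by (induction I rule: infinite_finite_induct) (simp_all add: jpoly_add)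

text \<open>By the arithmetic-geometric mean inequality
  \<open>(2N+1) y^2N (1-y^2)^2\<close> is dominated by the telescoping sum
  \<open>(1-y^2)^2 (1 + y^2 + ... + y^4N) = (1-y^2) (1-y^(4N+2))\<close>, which has norm at most 4.\<close>

lemma norm_jpoly_peak_le:
  fixes y :: "'a::unital_jb_algebra"
  assumes "norm y \<le> 1"
  shows "(2 * real N + 1) * norm (jpoly ([:0, 1:] ^ (2 * N) * (1 - [:0, 1:]\<^sup>2)\<^sup>2) y) \<le> 4"
proof -
  define X w :: "real poly" where "X = [:0, 1:]" and "w = 1 - X\<^sup>2"
  define S where "S = (\<Sum>n\<le>2*N. X ^ (2 * n) * w\<^sup>2)"
  \<comment> \<open>A sum of squares, hence positive at y. Expanding and reversing the index shows
    that it equals 2 S minus 2 (2N + 1) times the peak polynomial, so monotonicity of the norm on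
    the cone compares the two.\<close>
  define R where "R = (\<Sum>n\<le>2*N. ((X ^ n - X ^ (2 * N - n)) * w)\<^sup>2)"
  have rev: "(\<Sum>n\<le>2*N. X ^ (2 * (2 * N - n)) * w\<^sup>2) = S"
    unfolding S_def by (rule sum.reindex_bij_witness[of _ "\<lambda>i. 2 * N - i" "\<lambda>i. 2 * N - i"]) auto
  have sq: "((X ^ n - X ^ (2 * N - n)) * w)\<^sup>2
      = X ^ (2 * n) * w\<^sup>2 + X ^ (2 * (2 * N - n)) * w\<^sup>2 - 2 * (X ^ (2 * N) * w\<^sup>2)" if "n \<le> 2 * N" for n
  proof -
    have "X ^ (2 * N) = X ^ n * X ^ (2 * N - n)"
      using that by (simp add: power_add[symmetric])
    then show ?thesis
      by (simp only: power_mult_distrib power2_diff power_mult mult.commute[of 2]) (simp add: algebra_simps)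
  qed
  have "R = (\<Sum>n\<le>2*N. X ^ (2 * n) * w\<^sup>2 + X ^ (2 * (2 * N - n)) * w\<^sup>2 - 2 * (X ^ (2 * N) * w\<^sup>2))"
    unfolding R_def by (intro sum.cong refl sq) auto
  also have "\<dots> = S + S - of_nat (2 * N + 1) * (2 * (X ^ (2 * N) * w\<^sup>2))"
    by (simp add: sum.distrib sum_subtractf rev) (simp add: S_def)
  also have "\<dots> = 2 * S - smult (2 * (2 * real N + 1)) (X ^ (2 * N) * w\<^sup>2)"
    by (simp add: of_nat_poly numeral_mult_conv_smult algebra_simps smult_add_left smult_add_right)
  finally have R: "smult 2 S = smult (2 * (2 * real N + 1)) (X ^ (2 * N) * w\<^sup>2) + R"
    by (simp add: numeral_mult_conv_smult)
  have posR: "jpos (jpoly R y)"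
    unfolding R_def jpoly_sum jpoly_square by (intro jpos_sum jpos_square)
  have "X ^ (2 * N) * w\<^sup>2 = (X ^ N * w)\<^sup>2" by (simp add: power_mult_distrib power_mult[symmetric] mult.commute)
  then have posW: "jpos (jpoly (X ^ (2 * N) * w\<^sup>2) y)"
    by (simp only: jpoly_square jpos_square)
  have "S = w * (w * (\<Sum>n\<le>2*N. (X\<^sup>2) ^ n))"
    unfolding S_def sum_distrib_left power_mult power2_eq_square[of w]
    by (simp only: mult.assoc mult.commute mult.left_commute)
  also have "w * (\<Sum>n\<le>2*N. (X\<^sup>2) ^ n) = 1 - X ^ (2 * Suc (2 * N))"
    unfolding w_def sum_gp_basic power_mult ..
  finally have S: "S = w * (1 - X ^ (2 * Suc (2 * N)))" .
  have n: "norm (jpoly (1 - X ^ k) y) \<le> 2" for k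
    unfolding jpoly_diff X_def
    by (rule order.trans[OF norm_triangle_ineq4]) (use norm_jpoly_power_le[OF assms, of k] norm_junit_le[where 'a='a] in simp)
  have "norm (jpoly S y) \<le> 2 * 2"
    unfolding S jpoly_mult
    unfolding w_def by (rule order.trans[OF norm_jmult_le], rule mult_mono) (auto simp only: n norm_ge_zero)
  moreover have "2 * ((2 * real N + 1) * norm (jpoly (X ^ (2 * N) * w\<^sup>2) y)) \<le> 2 * norm (jpoly S y)"
  proof -
    have "norm (jpoly (smult (2 * (2 * real N + 1)) (X ^ (2 * N) * w\<^sup>2)) y) \<le> norm (jpoly (smult 2 S) y)"
      unfolding R jpoly_add
      by (rule norm_le_norm_add_jpos[OF _ posR]) (simp add: jpoly_smult jpos_scaleR[OF posW])
    moreover have "\<bar>2 * (2 * real N + 1)\<bar> = 2 * (2 * real N + 1)" by simp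
    ultimately show ?thesis by (simp only: jpoly_smult norm_scaleR mult.assoc)
  qed
  ultimately show ?thesis by (simp add: X_def w_def)
qed

text \<open>An inverse of w = I - y^2 would recover y^(2N) from y^(2N) w^2 by a fixed bounded map,
  so its norm would be O(1 / (2N + 1)). For N = 2^k this contradicts the norm 1 preserved by
  repeated squaring.\<close>

lemma norm_one_not_jinvertible:
  fixes y :: "'a::unital_jb_algebra"
  assumes "norm y = 1"
  shows "\<not> jinvertible (junit - y \<circ>\<^sub>J y)"
proof
  define X w :: "real poly" where "X = [:0, 1:]" and "w = 1 - X\<^sup>2"
  have w: "jpoly w y = junit - y \<circ>\<^sub>J y"
    by (simp add: w_def X_def jpoly_diff jpoly_square jmult_linear)
  assume "jinvertible (junit - y \<circ>\<^sub>J y)"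
  then have inv: "jinvertible (jpoly w y)" by (simp add: w)
  define K where "K = 3 * (norm (jinverse (jpoly w y)))\<^sup>2"
  have K: "K \<ge> 0" by (simp add: K_def)
  have one: "norm (jpoly (X ^ (2 ^ k)) y) = 1" for k
  proof (induction k)
    case (Suc k)
    have "X ^ (2 ^ Suc k) = (X ^ (2 ^ k))\<^sup>2" by (simp add: power_mult[symmetric] mult.commute)
    then show ?case by (simp only: jpoly_square norm_jsquare Suc) simp
  qed (simp add: X_def assms)
  have bound: "(2 * real N + 1) * norm (jpoly (X ^ (2 * N)) y) \<le> K * 4" for N
  proof -
    have "jpoly (X ^ (2 * N)) y = jtriple (jinverse (jpoly w y)) (jpoly (X ^ (2 * N) * w\<^sup>2) y)"
    proof -
      have "jpoly (X ^ (2 * N) * w\<^sup>2) y = jtriple (jpoly w y) (jpoly (X ^ (2 * N)) y)"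
        unfolding jtriple_jpoly by (simp add: power2_eq_square algebra_simps)
      then show ?thesis using inv by simp
    qed
    then have "norm (jpoly (X ^ (2 * N)) y) \<le> K * norm (jpoly (X ^ (2 * N) * w\<^sup>2) y)"
      unfolding K_def using norm_jtriple_le by metis
    then have "(2 * real N + 1) * norm (jpoly (X ^ (2 * N)) y)
        \<le> K * ((2 * real N + 1) * norm (jpoly (X ^ (2 * N) * w\<^sup>2) y))"
      using mult_left_mono[of _ _ "2 * real N + 1"] by (simp add: mult.left_commute)
    also have "\<dots> \<le> K * 4"
      using norm_jpoly_peak_le[of y N] assms K by (intro mult_left_mono) (auto simp: X_def w_def)
    finally show ?thesis .
  qed
  obtain k :: nat where k: "K * 4 < 2 ^ k"
    using real_arch_pow[of 2 "K * 4"] by auto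
  show False
  proof -
    have "2 * 2 ^ k + 1 \<le> K * 4" using bound[of "2 ^ k"] one[of "Suc k"] by simp
    moreover have "(0::real) \<le> 2 ^ k" by simp
    ultimately show False using k by linarith
  qed
qed

text \<open>For x = r y with r = norm x, the element I - y^2 is a multiple of (x - r I) o (x + r I).
  It is not invertible, so one of the two polynomial factors is not.\<close>

lemma norm_in_jspectrum:
  fixes x :: "'a::unital_jb_algebra"
  assumes "junit \<noteq> (0::'a)"
  shows "norm x \<in> jspectrum x \<or> - norm x \<in> jspectrum x"
proof (cases "x = 0")
  case True
  have "\<not> jinvertible (0::'a)"
    using assms by (auto simp: jinvertible_def is_jinverse_def)
  then show ?thesis by (simp add: True jspectrum_def)
next
  case False
  define r where "r = norm x"
  have r: "r > 0" using False by (simp add: r_def)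
  define y where "y = (1/r) *\<^sub>R x"
  have "\<not> jinvertible (junit - y \<circ>\<^sub>J y)"
    by (rule norm_one_not_jinvertible) (use r in \<open>simp add: y_def r_def\<close>)
  moreover have "junit - y \<circ>\<^sub>J y = (- (1 / r\<^sup>2)) *\<^sub>R jpoly ([:-r, 1:] * [:r, 1:]) x"
    unfolding jpoly_mult using r
    by (simp add: y_def jmult_linear algebra_simps power2_eq_square)
  ultimately have "\<not> jinvertible (jpoly ([:-r, 1:] * [:r, 1:]) x)"
    using jinvertible_scaleR[of "jpoly ([:-r, 1:] * [:r, 1:]) x" "- (1 / r\<^sup>2)"] r
    by (metis divide_eq_0_iff neg_equal_0_iff_equal not_less_iff_gr_or_eq power_not_zero zero_neq_one)
  then have "\<not> jinvertible (jpoly [:-r, 1:] x) \<or> \<not> jinvertible (jpoly [:r, 1:] x)"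
    by (simp only: jinvertible_jpoly_mult_iff) simp
  then show ?thesis by (simp add: jspectrum_def r_def add.commute)
qed

text \<open>Together with \<open>jspectrum_ge\<close> this identifies the displayed number as the
  least spectral value of y. The alternative spectral value s + w, where w is the norm of s I - y,
  exceeds the bound norm y <= s unless w = 0.\<close>

lemma jspectrum_min:
  fixes y :: "'a::unital_jb_algebra"
  assumes "junit \<noteq> (0::'a)" and "norm y \<le> s"
  shows "s - norm (s *\<^sub>R junit - y) \<in> jspectrum y"
proof -
  define w where "w = norm (s *\<^sub>R junit - y)"
  have sp: "t \<in> jspectrum (s *\<^sub>R junit - y) \<longleftrightarrow> s - t \<in> jspectrum y" for t
  proof -
    have "(s *\<^sub>R junit - y) - t *\<^sub>R junit = - (y - (s - t) *\<^sub>R junit)"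
      by (simp add: algebra_simps)
    then show ?thesis by (simp only: jspectrum_def mem_Collect_eq jinvertible_uminus_iff)
  qed
  have "w \<in> jspectrum (s *\<^sub>R junit - y) \<or> - w \<in> jspectrum (s *\<^sub>R junit - y)"
    unfolding w_def using norm_in_jspectrum[OF assms(1)] by blast
  then show ?thesis
  proof
    assume "- w \<in> jspectrum (s *\<^sub>R junit - y)"
    then have *: "s + w \<in> jspectrum y" using sp[of "- w"] by simp
    then have "s + w \<le> s" using jspectrum_bound[of "s + w" y] assms(2) by linarith
    then have "w = 0" by (simp add: w_def)
    then show ?thesis using * by (simp add: w_def)
  qed (use sp in \<open>simp add: w_def\<close>)
qed

lemma jspectrum_ge:
  assumes "r \<in> jspectrum y"
  shows "s - norm (s *\<^sub>R junit - y) \<le> r"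
proof (rule ccontr)
  assume "\<not> ?thesis"
  then have "norm (s *\<^sub>R junit - y) < \<bar>s - r\<bar>" by linarith
  then have "jinvertible ((s *\<^sub>R junit - y) - (s - r) *\<^sub>R junit)" by (rule jinvertible_minus_scaleR)
  then have "jinvertible ((-1) *\<^sub>R ((s *\<^sub>R junit - y) - (s - r) *\<^sub>R junit))" by (rule jinvertible_scaleR) simp
  also have "(-1) *\<^sub>R ((s *\<^sub>R junit - y) - (s - r) *\<^sub>R junit) = y - r *\<^sub>R junit"
    by (simp add: algebra_simps)
  finally show False using assms by (simp add: jspectrum_def)
qed

lemma jspectrum_trivial:
  assumes "junit = (0::'a::unital_jb_algebra)" shows "jspectrum (x::'a) = {}"
proof -
  have "x - r *\<^sub>R junit = junit" for r
    using trivial_algebra[OF assms, of "x - r *\<^sub>R junit"] assms by (rule trans[OF _ sym])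
  then show ?thesis by (simp add: jspectrum_def)
qed

lemma jpositive_iff_jpos: "jpositive x \<longleftrightarrow> jpos (x::'a::unital_jb_algebra)"
proof (cases "junit = (0::'a)")
  case True
  then show ?thesis using trivial_algebra[OF True, of x] by (simp add: jpositive_def jspectrum_trivial)
next
  case False
  show ?thesis
  proof
    assume "jpositive x"
    then have "norm x - norm (norm x *\<^sub>R junit - x) \<ge> 0"
      using jspectrum_min[OF False, of x "norm x"] by (auto simp: jpositive_def)
    then show "jpos x" by (intro jposI) simp
  next
    assume "jpos x"
    then have "norm (norm x *\<^sub>R junit - x) \<le> norm x" using jpos_iff_norm by blast
    then show "jpositive x" using jspectrum_ge[of _ x "norm x"] by (force simp: jpositive_def)
  qed
qed

lemma jle_iff_jpos: "x \<le>\<^sub>J y \<longleftrightarrow> jpos (y - x)"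
  by (simp add: jle_def jpositive_iff_jpos)

text \<open>The least spectral value is nonnegative by positivity and nonzero by invertibility, so
  it serves as e. Conversely, non-invertibility of x would put -e into the spectrum of the positive
  element x - e I.\<close>

lemma jpos_inv_iff: "jpos_inv x \<longleftrightarrow> (\<exists>e>0. jpos (x - e *\<^sub>R junit))" for x :: "'a::unital_jb_algebra"
proof (cases "junit = (0::'a)")
  case True
  have "x = junit"
    using trivial_algebra[OF True, of x] True by (rule trans[OF _ sym])
  then have "jinvertible x" by simp
  moreover have "jpos y" for y :: 'a
    using trivial_algebra[OF True, of y] jpos_0 by metis
  ultimately show ?thesis
    unfolding jpos_inv_def jpositive_iff_jpos by (auto intro: zero_less_one)
next
  case False
  show ?thesis
  proof
    assume x: "jpos_inv x"
    define m where "m = norm x - norm (norm x *\<^sub>R junit - x)"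
    have "m \<in> jspectrum x" unfolding m_def by (rule jspectrum_min[OF False]) simp
    then have "m \<ge> 0" "m \<noteq> 0"
      using x by (auto simp: jpos_inv_def jpositive_def jspectrum_def)
    moreover have "jpos (x - m *\<^sub>R junit)"
      by (rule jposI[of "norm x - m"]) (simp add: m_def algebra_simps)
    ultimately show "\<exists>e>0. jpos (x - e *\<^sub>R junit)" by (intro exI[of _ m]) simp
  next
    assume "\<exists>e>0. jpos (x - e *\<^sub>R junit)"
    then obtain e where e: "e > 0" "jpos (x - e *\<^sub>R junit)" by blast
    have "jinvertible x"
    proof (rule ccontr)
      assume "\<not> jinvertible x"
      then have "- e \<in> jspectrum (x - e *\<^sub>R junit)" by (simp add: jspectrum_def)
      then show False using e jpositive_iff_jpos[of "x - e *\<^sub>R junit"] by (auto simp: jpositive_def)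
    qed
    moreover have "jpos x"
      using jpos_add[OF e(2) jpos_scaleR[OF jpos_junit, of e]] e(1) by simp
    ultimately show "jpos_inv x" by (simp add: jpos_inv_def jpositive_iff_jpos)
  qed
qed

subsection \<open>Polynomial spectral mapping\<close>

lemma map_poly_of_real_add:
  "poly (map_poly complex_of_real (p + q)) z
    = poly (map_poly complex_of_real p) z + poly (map_poly complex_of_real q) z"
  by (induction p q rule: poly_induct2) (simp_all add: map_poly_pCons algebra_simps)

lemma map_poly_of_real_mult:
  fixes p q :: "real poly"
  shows "poly (map_poly complex_of_real (p * q)) z
    = poly (map_poly complex_of_real p) z * poly (map_poly complex_of_real q) z"
proof -
  have smult: "poly (map_poly complex_of_real (smult c p)) z
      = of_real c * poly (map_poly complex_of_real p) z" for c p
    by (induction p) (simp_all add: map_poly_pCons algebra_simps)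
  show ?thesis
    by (induction p) (simp_all add: map_poly_pCons map_poly_of_real_add smult algebra_simps)
qed

text \<open>A complex root z is non-real, and the divisor is its minimal polynomial (X - Re z)^2 +
  (Im z)^2. The remainder is real, of degree at most 1 and vanishes at z, hence is zero.\<close>

lemma real_poly_quadratic_factor:
  fixes q :: "real poly"
  assumes "degree q > 0" and "\<And>t. poly q t \<noteq> 0"
  obtains \<alpha> \<beta> d where "\<beta> \<noteq> 0" and "q = ([:-\<alpha>, 1:]\<^sup>2 + [:\<beta>\<^sup>2:]) * d"
proof -
  let ?E = "\<lambda>p. poly (map_poly complex_of_real p)"
  have "\<not> constant (?E q)"
    using assms(1) by (simp add: constant_degree degree_map_poly)
  then obtain z where z: "?E q z = 0" using fundamental_theorem_of_algebra by blast
  have Im: "Im z \<noteq> 0"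
  proof
    assume "Im z = 0"
    then have "z = of_real (Re z)" by (simp add: complex_eq_iff)
    then have "?E q (of_real (Re z)) = 0" using z by simp
    moreover have "?E p (of_real t) = of_real (poly p t)" for p t
      by (induction p) (simp_all add: map_poly_pCons)
    ultimately have "complex_of_real (poly q (Re z)) = 0" by simp
    then show False using assms(2) by simp
  qed
  define Q :: "real poly" where "Q = [:-Re z, 1:]\<^sup>2 + [:(Im z)\<^sup>2:]"
  have Q: "Q = [:(Re z)\<^sup>2 + (Im z)\<^sup>2, - 2 * Re z, 1:]" by (simp add: Q_def power2_eq_square)
  have EQ: "?E Q z = 0"
    by (simp add: Q map_poly_pCons complex_eq_iff power2_eq_square algebra_simps)
  have "degree (q mod Q) < 2"
    using degree_mod_less[of Q q] by (auto simp: Q)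
  then have "q mod Q = [:coeff (q mod Q) 0, coeff (q mod Q) 1:]"
    by (intro poly_eqI) (auto simp: coeff_pCons coeff_eq_0 split: nat.split)
  then obtain c e where r: "q mod Q = [:c, e:]" by blast
  have "?E q z = ?E (q div Q * Q) z + ?E (q mod Q) z"
    using map_poly_of_real_add[of "q div Q * Q" "q mod Q" z] by simp
  then have "?E (q mod Q) z = 0" using z EQ by (simp add: map_poly_of_real_mult)
  then have "complex_of_real c + z * complex_of_real e = 0"
    by (simp add: r map_poly_pCons)
  then have "e = 0" "c = 0" using Im by (auto simp: complex_eq_iff)
  then have "q = Q * (q div Q)" using r by (metis add.right_neutral mult_div_mod_eq pCons_0_0)
  then show thesis using that[OF Im, of "Re z" "q div Q"] by (simp add: Q_def)
qed

lemma jpos_inv_square_add: "\<beta> \<noteq> 0 \<Longrightarrow> jpos_inv (x \<circ>\<^sub>J x + \<beta>\<^sup>2 *\<^sub>R junit)"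
  unfolding jpos_inv_iff by (rule exI[of _ "\<beta>\<^sup>2"]) (simp add: jpos_square)

text \<open>Real linear factors are invertible because their roots avoid the spectrum; a quadratic
  factor without real roots is a square plus a positive multiple of the unit, hence always
  invertible. No complexification of the algebra takes place.\<close>

lemma jinvertible_jpoly:
  assumes "q \<noteq> 0" and "\<And>t. t \<in> jspectrum a \<Longrightarrow> poly q t \<noteq> 0"
  shows "jinvertible (jpoly q a)"
  using assms
proof (induction "degree q" arbitrary: q rule: less_induct)
  case less
  consider "degree q = 0" | r where "poly q r = 0"
    | "degree q > 0" "\<And>t. poly q t \<noteq> 0" by auto
  then show ?case
  proof cases
    case 1
    then obtain c where "q = [:c:]" by (auto elim: degree_eq_zeroE)
    then show ?thesis using less.prems(1) jinvertible_scaleR[of junit c] by simp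
  next
    case 2
    then obtain d where q: "q = [:-r, 1:] * d" by (metis dvdE poly_eq_0_iff_dvd)
    then have d: "d \<noteq> 0" using less.prems(1) by auto
    have "degree d < degree q" unfolding q using d by (subst degree_mult_eq) auto
    moreover have "poly d t \<noteq> 0" if "t \<in> jspectrum a" for t
      using less.prems(2)[OF that] q by auto
    ultimately have "jinvertible (jpoly d a)" using less.hyps d by blast
    moreover have "jinvertible (jpoly [:-r, 1:] a)"
      using less.prems(2)[of r] 2 by (auto simp: jspectrum_def)
    ultimately show ?thesis unfolding q by (simp only: jinvertible_jpoly_mult_iff)
  next
    case 3
    obtain \<alpha> \<beta> d where \<beta>: "\<beta> \<noteq> 0" and q: "q = ([:-\<alpha>, 1:]\<^sup>2 + [:\<beta>\<^sup>2:]) * d"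
      using real_poly_quadratic_factor[OF 3] by blast
    have d: "d \<noteq> 0" using less.prems(1) q by auto
    have "degree ([:-\<alpha>, 1:]\<^sup>2 + [:\<beta>\<^sup>2:]) = 2" by (simp add: power2_eq_square)
    then have "degree d < degree q" unfolding q using d by (subst degree_mult_eq) auto
    moreover have "poly d t \<noteq> 0" if "t \<in> jspectrum a" for t
      using less.prems(2)[OF that] q by auto
    ultimately have "jinvertible (jpoly d a)" using less.hyps d by blast
    moreover have "jinvertible (jpoly ([:-\<alpha>, 1:]\<^sup>2 + [:\<beta>\<^sup>2:]) a)"
      using jpos_inv_square_add[OF \<beta>, of "jpoly [:-\<alpha>, 1:] a"]
      by (simp only: jpoly_add jpoly_square jpos_inv_def) simp
    ultimately show ?thesis unfolding q by (simp only: jinvertible_jpoly_mult_iff)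
  qed
qed

lemma jspectrum_jpoly_subset:
  assumes "jspectrum a \<noteq> {}" shows "jspectrum (jpoly p a) \<subseteq> poly p ` jspectrum a"
proof
  fix r assume "r \<in> jspectrum (jpoly p a)"
  then have *: "\<not> jinvertible (jpoly (p - [:r:]) a)"
    by (simp add: jspectrum_def jpoly_diff)
  show "r \<in> poly p ` jspectrum a"
  proof (cases "p - [:r:] = 0")
    \<comment> \<open>A constant p has the single value r, and it is attained on the spectrum only
      because the spectrum is nonempty.\<close>
    case True
    then have "poly p t = r" for t by (metis eq_iff_diff_eq_0 poly_const_conv)
    then show ?thesis using assms by auto
  next
    case False
    then obtain t where "t \<in> jspectrum a" "poly (p - [:r:]) t = 0" using jinvertible_jpoly * by blast
    then show ?thesis by force
  qed
qed

lemma poly_in_jspectrum_jpoly: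
  assumes "t \<in> jspectrum a" shows "poly p t \<in> jspectrum (jpoly p a)"
proof -
  have "poly (p - [:poly p t:]) t = 0" by simp
  then obtain d where d: "p - [:poly p t:] = [:-t, 1:] * d" by (metis dvdE poly_eq_0_iff_dvd)
  have "\<not> jinvertible (jpoly [:-t, 1:] a)" using assms by (simp add: jspectrum_def)
  then have "\<not> jinvertible (jpoly (p - [:poly p t:]) a)" unfolding d by (simp only: jinvertible_jpoly_mult_iff) simp
  then show ?thesis by (simp add: jspectrum_def jpoly_diff)
qed

lemma poly_le_norm_jpoly: "t \<in> jspectrum a \<Longrightarrow> \<bar>poly p t\<bar> \<le> norm (jpoly p a)"
  by (intro jspectrum_bound poly_in_jspectrum_jpoly)

text \<open>Up to sign the norm of p(a) is a spectral value of p(a), hence a value of p on the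
  spectrum of a. With \<open>poly_le_norm_jpoly\<close> this makes the polynomial calculus
  isometric.\<close>

lemma norm_jpoly_le:
  fixes a :: "'a::unital_jb_algebra"
  assumes "0 \<le> M" "\<And>t. t \<in> jspectrum a \<Longrightarrow> \<bar>poly p t\<bar> \<le> M"
  shows "norm (jpoly p a) \<le> M"
proof (cases "junit = (0::'a)")
  case True
  then show ?thesis using trivial_algebra[OF True, of "jpoly p a"] assms(1) by simp
next
  case False
  have ne: "jspectrum a \<noteq> {}" using norm_in_jspectrum[OF False, of a] by auto
  have "norm (jpoly p a) \<in> poly p ` jspectrum a \<or> - norm (jpoly p a) \<in> poly p ` jspectrum a"
    using norm_in_jspectrum[OF False, of "jpoly p a"] jspectrum_jpoly_subset[OF ne, of p] by blast
  then show ?thesis using assms(2) by force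
qed

text \<open>Passing to squares turns invertibility into an inequality: if x = a - r I is invertible
  then x^2 >= e I, and for small h the square of x - h I still dominates (e/2) I.\<close>

lemma compact_jspectrum: "compact (jspectrum (a::'a::unital_jb_algebra))"
proof -
  have "\<exists>d>0. \<forall>s. \<bar>s - r\<bar> < d \<longrightarrow> s \<notin> jspectrum a" if r: "r \<notin> jspectrum a" for r
  proof -
    define x where "x = a - r *\<^sub>R junit"
    have "jpos_inv (x \<circ>\<^sub>J x)"
      using r by (simp add: jpos_inv_def jpositive_iff_jpos jpos_square jinvertible_square_iff x_def jspectrum_def)
    then obtain e where e: "e > 0" "jpos (x \<circ>\<^sub>J x - e *\<^sub>R junit)" unfolding jpos_inv_iff by blast
    \<comment> \<open>Chosen so that |h| < d bounds the cross term 2 h x by e/2 in norm.\<close>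
    define d where "d = e / (4 * (norm x + 1))"
    have d: "d > 0" using e(1) by (simp add: d_def add_nonneg_pos)
    have "s \<notin> jspectrum a" if "\<bar>s - r\<bar> < d" for s
    proof -
      define h where "h = s - r"
      have "norm ((2 * h) *\<^sub>R x) \<le> e / 2"
      proof -
        have "\<bar>h\<bar> * (4 * (norm x + 1)) \<le> e"
          using that by (simp add: h_def d_def pos_less_divide_eq add_nonneg_pos)
        then have "\<bar>h\<bar> * norm x * 4 \<le> e" by (simp add: algebra_simps)
        then show ?thesis by (simp add: abs_mult)
      qed
      then have "jpos ((e / 2) *\<^sub>R junit - (2 * h) *\<^sub>R x)" by (intro jposI[of "e / 2"]) simp
      then have "jpos ((x \<circ>\<^sub>J x - e *\<^sub>R junit) + (((e / 2) *\<^sub>R junit - (2 * h) *\<^sub>R x) + h\<^sup>2 *\<^sub>R junit))"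
        by (intro jpos_add e(2) jpos_scaleR jpos_junit) auto
      also have "(x \<circ>\<^sub>J x - e *\<^sub>R junit) + (((e / 2) *\<^sub>R junit - (2 * h) *\<^sub>R x) + h\<^sup>2 *\<^sub>R junit)
          = (x - h *\<^sub>R junit) \<circ>\<^sub>J (x - h *\<^sub>R junit) - (e/2) *\<^sub>R junit"
      proof -
        have "e *\<^sub>R (junit::'a) = (e / 2) *\<^sub>R junit + (e / 2) *\<^sub>R junit"
          by (simp add: scaleR_left_distrib[symmetric])
        moreover have "(2 * h) *\<^sub>R x = h *\<^sub>R x + h *\<^sub>R x"
          by (simp add: scaleR_left_distrib[symmetric])
        ultimately show ?thesis
          by (simp add: jmult_linear power2_eq_square algebra_simps)
      qed
      finally have "jpos_inv ((x - h *\<^sub>R junit) \<circ>\<^sub>J (x - h *\<^sub>R junit))"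
        unfolding jpos_inv_iff using e(1) by (intro exI[of _ "e/2"]) simp
      then have "jinvertible (x - h *\<^sub>R junit)" by (simp add: jpos_inv_def jinvertible_square_iff)
      then show ?thesis by (simp add: jspectrum_def x_def h_def algebra_simps)
    qed
    then show ?thesis using d by blast
  qed
  then have "open (- jspectrum a)"
    by (auto simp: open_dist dist_real_def)
  moreover have "bounded (jspectrum a)"
    unfolding bounded_iff using jspectrum_bound by (intro exI[of _ "norm a"]) auto
  ultimately show ?thesis by (simp add: compact_eq_bounded_closed closed_def)
qed

subsection \<open>Continuous functional calculus\<close>

text \<open>The functional calculus as a relation: the same polynomials approximate f on the
  spectrum and X in norm. In this form its algebraic rules can be proved before existence is known,
  and values of f off the spectrum are irrelevant.\<close>

definition japprox :: "'a::unital_jb_algebra \<Rightarrow> (real \<Rightarrow> real) \<Rightarrow> 'a \<Rightarrow> bool" where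
  "japprox a f X \<longleftrightarrow>
    (\<forall>e>0. \<exists>p. (\<forall>t\<in>jspectrum a. \<bar>f t - poly p t\<bar> \<le> e) \<and> norm (X - jpoly p a) \<le> e)"

lemma japproxE:
  assumes "japprox a f X" "e > 0"
  obtains p where "\<And>t. t \<in> jspectrum a \<Longrightarrow> \<bar>f t - poly p t\<bar> \<le> e" "norm (X - jpoly p a) \<le> e"
  using assms unfolding japprox_def by blast

lemma japprox_norm_le:
  assumes X: "japprox a f X" and "0 \<le> M" and M: "\<And>t. t \<in> jspectrum a \<Longrightarrow> \<bar>f t\<bar> \<le> M"
  shows "norm X \<le> M"
proof (rule field_le_epsilon)
  fix e :: real assume "e > 0"
  then obtain p where p: "\<And>t. t \<in> jspectrum a \<Longrightarrow> \<bar>f t - poly p t\<bar> \<le> e / 2" "norm (X - jpoly p a) \<le> e / 2"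
    using japproxE[OF X, of "e / 2"] by auto
  have "norm (jpoly p a) \<le> M + e / 2"
  proof (rule norm_jpoly_le)
    fix t assume "t \<in> jspectrum a"
    then show "\<bar>poly p t\<bar> \<le> M + e / 2" using p(1)[of t] M[of t] by linarith
  qed (use \<open>e > 0\<close> \<open>0 \<le> M\<close> in simp)
  then show "norm X \<le> M + e" using p(2) norm_triangle_sub[of X "jpoly p a"] by linarith
qed

lemma japprox_le_norm:
  assumes X: "japprox a f X" and t: "t \<in> jspectrum a"
  shows "\<bar>f t\<bar> \<le> norm X"
proof (rule field_le_epsilon)
  fix e :: real assume "e > 0"
  then obtain p where p: "\<And>t. t \<in> jspectrum a \<Longrightarrow> \<bar>f t - poly p t\<bar> \<le> e / 2" "norm (X - jpoly p a) \<le> e / 2"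
    using japproxE[OF X, of "e / 2"] by auto
  have "\<bar>poly p t\<bar> \<le> norm (jpoly p a)" by (rule poly_le_norm_jpoly[OF t])
  moreover have "norm (jpoly p a) \<le> norm X + e / 2"
    using p(2) norm_triangle_sub[of "jpoly p a" X] by (simp add: norm_minus_commute)
  ultimately show "\<bar>f t\<bar> \<le> norm X + e" using p(1)[OF t] by linarith
qed

lemma japprox_jpoly: "japprox a (poly p) (jpoly p a)"
  unfolding japprox_def by (intro allI impI exI[of _ p]) auto

lemma japprox_cong:
  "japprox a f X \<Longrightarrow> (\<And>t. t \<in> jspectrum a \<Longrightarrow> f t = g t) \<Longrightarrow> japprox a g X"
  by (simp add: japprox_def)

lemma japprox_add:
  assumes "japprox a f X" "japprox a g Y"
  shows "japprox a (\<lambda>t. f t + g t) (X + Y)"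
  unfolding japprox_def
proof (intro allI impI)
  fix e :: real assume "e > 0"
  then have e2: "e / 2 > 0" by simp
  obtain p where p: "\<And>t. t \<in> jspectrum a \<Longrightarrow> \<bar>f t - poly p t\<bar> \<le> e / 2" "norm (X - jpoly p a) \<le> e / 2"
    using japproxE[OF assms(1) e2] by blast
  obtain q where q: "\<And>t. t \<in> jspectrum a \<Longrightarrow> \<bar>g t - poly q t\<bar> \<le> e / 2" "norm (Y - jpoly q a) \<le> e / 2"
    using japproxE[OF assms(2) e2] by blast
  have "\<bar>f t + g t - poly (p + q) t\<bar> \<le> e" if "t \<in> jspectrum a" for t
  proof -
    have "f t + g t - poly (p + q) t = (f t - poly p t) + (g t - poly q t)" by simp
    then show ?thesis
      using abs_triangle_ineq[of "f t - poly p t" "g t - poly q t"] p(1)[OF that] q(1)[OF that]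
      by linarith
  qed
  moreover have "norm (X + Y - jpoly (p + q) a) \<le> e"
    using norm_triangle_mono[OF p(2) q(2)] by (simp add: jpoly_add algebra_simps)
  ultimately show "\<exists>p. (\<forall>t\<in>jspectrum a. \<bar>f t + g t - poly p t\<bar> \<le> e) \<and> norm (X + Y - jpoly p a) \<le> e"
    by blast
qed

lemma japprox_mult:
  assumes "japprox a f X" "japprox a g Y"
  shows "japprox a (\<lambda>t. f t * g t) (X \<circ>\<^sub>J Y)"
  unfolding japprox_def
proof (intro allI impI)
  fix e :: real assume "e > 0"
  define S where "S = norm X + norm Y + 1"
  \<comment> \<open>The error of a product is at most norm X * d + d * (norm Y + d); with d <= 1
    this is at most d * S <= e, and the same bound serves for the scalar functions.\<close>
  define d where "d = min 1 (e / S)"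
  have S: "S > 0" by (simp add: S_def add_nonneg_pos)
  have d: "d > 0" "d \<le> 1" using S \<open>e > 0\<close> by (simp_all add: d_def)
  have dS: "d * S \<le> e"
    using S by (simp add: d_def min_def field_simps)
  have bound: "x * d + d * z \<le> e" if "0 \<le> x" "x \<le> norm X" "z \<le> norm Y + d" for x z
  proof -
    have "x * d + d * z \<le> norm X * d + d * (norm Y + 1)"
      using that d by (intro add_mono mult_right_mono mult_left_mono) auto
    also have "\<dots> = d * S" by (simp add: S_def algebra_simps)
    finally show ?thesis using dS by simp
  qed
  obtain p where p: "\<And>t. t \<in> jspectrum a \<Longrightarrow> \<bar>f t - poly p t\<bar> \<le> d" "norm (X - jpoly p a) \<le> d"
    using japproxE[OF assms(1) d(1)] by blast
  obtain q where q: "\<And>t. t \<in> jspectrum a \<Longrightarrow> \<bar>g t - poly q t\<bar> \<le> d" "norm (Y - jpoly q a) \<le> d"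
    using japproxE[OF assms(2) d(1)] by blast
  have "\<bar>f t * g t - poly (p * q) t\<bar> \<le> e" if t: "t \<in> jspectrum a" for t
  proof -
    have "f t * g t - poly (p * q) t = f t * (g t - poly q t) + (f t - poly p t) * poly q t"
      by (simp add: algebra_simps)
    also have "\<bar>\<dots>\<bar> \<le> \<bar>f t\<bar> * \<bar>g t - poly q t\<bar> + \<bar>f t - poly p t\<bar> * \<bar>poly q t\<bar>"
      using abs_triangle_ineq by (simp add: abs_mult[symmetric])
    also have "\<dots> \<le> \<bar>f t\<bar> * d + d * \<bar>poly q t\<bar>"
      using p(1)[OF t] q(1)[OF t] by (intro add_mono mult_mono) auto
    also have "\<dots> \<le> e"
      using japprox_le_norm[OF assms(1) t] japprox_le_norm[OF assms(2) t] q(1)[OF t]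
      by (intro bound) linarith+
    finally show ?thesis .
  qed
  moreover have "norm (X \<circ>\<^sub>J Y - jpoly (p * q) a) \<le> e"
  proof -
    have "X \<circ>\<^sub>J Y - jpoly (p * q) a = X \<circ>\<^sub>J (Y - jpoly q a) + (X - jpoly p a) \<circ>\<^sub>J jpoly q a"
      by (simp add: jpoly_mult jmult_linear)
    also have "norm \<dots> \<le> norm X * norm (Y - jpoly q a) + norm (X - jpoly p a) * norm (jpoly q a)"
      by (intro norm_triangle_mono norm_jmult_le)
    also have "\<dots> \<le> norm X * d + d * norm (jpoly q a)"
      using p(2) q(2) d by (intro add_mono mult_mono) auto
    also have "\<dots> \<le> e"
      using q(2) norm_triangle_sub[of "jpoly q a" Y] by (intro bound) (auto simp: norm_minus_commute)
    finally show ?thesis .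
  qed
  ultimately show "\<exists>p. (\<forall>t\<in>jspectrum a. \<bar>f t * g t - poly p t\<bar> \<le> e) \<and> norm (X \<circ>\<^sub>J Y - jpoly p a) \<le> e"
    by blast
qed

lemma japprox_const: "japprox a (\<lambda>_. c) (c *\<^sub>R junit)"
  using japprox_cong[OF japprox_jpoly[of a "[:c:]"], of "\<lambda>_. c"] by simp

lemma japprox_id: "japprox a (\<lambda>t. t) a"
  using japprox_cong[OF japprox_jpoly[of a "[:0, 1:]"], of "\<lambda>t. t"] by simp

lemma japprox_scaleR: "japprox a f X \<Longrightarrow> japprox a (\<lambda>t. c * f t) (c *\<^sub>R X)"
  using japprox_mult[OF japprox_const, of a f X c] by (simp add: jmult_linear)

lemma japprox_diff: "japprox a f X \<Longrightarrow> japprox a g Y \<Longrightarrow> japprox a (\<lambda>t. f t - g t) (X - Y)"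
  using japprox_add[of a f X "\<lambda>t. (-1) * g t" "(-1) *\<^sub>R Y"] japprox_scaleR[of a g Y "-1"] by simp

lemma japprox_unique:
  assumes "japprox a f X" "japprox a f Y" shows "X = Y"
  using japprox_norm_le[OF japprox_diff[OF assms], of 0] by simp

lemma polynomial_approximation:
  fixes K :: "real set"
  assumes "compact K" "continuous_on K f" "e > 0"
  obtains p where "\<And>t. t \<in> K \<Longrightarrow> \<bar>f t - poly p t\<bar> < e"
proof -
  obtain g where g: "real_polynomial_function g" "\<And>x. x \<in> K \<Longrightarrow> \<bar>f x - g x\<bar> < e"
    using Stone_Weierstrass_real_polynomial_function[OF assms] by blast
  obtain c n where c: "g = (\<lambda>x. \<Sum>i\<le>n. c i * x ^ i)"
    using g(1) real_polynomial_function_iff_sum by blast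
  have "g = poly (\<Sum>i\<le>n. monom (c i) i)"
    by (simp add: c fun_eq_iff poly_sum poly_monom)
  then show thesis using g(2) that by blast
qed

lemma japprox_exists:
  assumes f: "continuous_on (jspectrum a) f"
  shows "\<exists>X. japprox a f X"
proof -
  have "\<exists>p. \<forall>t\<in>jspectrum a. \<bar>f t - poly p t\<bar> < 1 / real (Suc n)" for n
    using polynomial_approximation[OF compact_jspectrum f, of "1 / real (Suc n)"] by (metis of_nat_0_less_iff zero_less_Suc zero_less_divide_1_iff)
  then obtain p where p: "\<And>n t. t \<in> jspectrum a \<Longrightarrow> \<bar>f t - poly (p n) t\<bar> < 1 / real (Suc n)" by metis
  have small: "\<exists>N. \<forall>n\<ge>N. 1 / real (Suc n) < e" if "e > 0" for e :: real
    using LIMSEQ_inverse_real_of_nat[THEN order_tendstoD(2), OF that]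
    by (simp add: eventually_sequentially inverse_eq_divide)
  have bound: "norm (jpoly (p m) a - jpoly (p n) a) \<le> e"
    if "1 / real (Suc m) < e / 2" "1 / real (Suc n) < e / 2" "0 \<le> e" for m n e
    unfolding jpoly_diff[symmetric]
  proof (rule norm_jpoly_le)
    fix t assume "t \<in> jspectrum a"
    then show "\<bar>poly (p m - p n) t\<bar> \<le> e" using p[of t m] p[of t n] that by (simp add: abs_le_iff abs_less_iff)
  qed (use that in simp)
  have "Cauchy (\<lambda>n. jpoly (p n) a)"
  proof (rule CauchyI)
    fix e :: real assume "e > 0"
    obtain N where N: "\<forall>n\<ge>N. 1 / real (Suc n) < e / 2 / 2" using small[of "e / 2 / 2"] \<open>e > 0\<close> by auto
    have "norm (jpoly (p m) a - jpoly (p n) a) < e" if "m \<ge> N" "n \<ge> N" for m n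
      using bound[of m "e/2" n] N that \<open>e > 0\<close> by auto
    then show "\<exists>M. \<forall>m\<ge>M. \<forall>n\<ge>M. norm (jpoly (p m) a - jpoly (p n) a) < e" by blast
  qed
  then obtain X where X: "(\<lambda>n. jpoly (p n) a) \<longlonglongrightarrow> X" by (auto simp: Cauchy_convergent_iff convergent_def)
  have "japprox a f X"
    unfolding japprox_def
  proof (intro allI impI)
    fix e :: real assume "e > 0"
    obtain N where N: "\<forall>n\<ge>N. 1 / real (Suc n) < e" using small[OF \<open>e > 0\<close>] by blast
    obtain M where M: "\<forall>n\<ge>M. norm (jpoly (p n) a - X) < e" using LIMSEQ_D[OF X \<open>e > 0\<close>] by blast
    define n where "n = max M N"
    show "\<exists>p. (\<forall>t\<in>jspectrum a. \<bar>f t - poly p t\<bar> \<le> e) \<and> norm (X - jpoly p a) \<le> e"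
    proof (intro exI[of _ "p n"] conjI ballI)
      fix t assume "t \<in> jspectrum a"
      then show "\<bar>f t - poly (p n) t\<bar> \<le> e"
        using p[of t n] N[rule_format, of n] by (simp add: n_def)
    next
      show "norm (X - jpoly (p n) a) \<le> e"
        using M[rule_format, of n] by (simp add: n_def norm_minus_commute)
    qed
  qed
  then show ?thesis by blast
qed

lemma japprox_limit:
  assumes "japprox a f X" "e > 0"
  shows "\<exists>Y\<in>range (\<lambda>p. jpoly p a). dist Y X < e"
proof -
  obtain p where "norm (X - jpoly p a) \<le> e / 2" using japproxE[OF assms(1), of "e / 2"] assms(2) by auto
  then have "dist (jpoly p a) X < e" using assms(2) by (simp add: dist_norm norm_minus_commute)
  then show ?thesis by blast
qed

text \<open>Norm convergence of p_n(a) makes the p_n uniformly Cauchy on the spectrum, so their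
  uniform limit is a continuous function representing X. This is the surjectivity half of the
  calculus.\<close>

lemma closure_jpoly_imp_japprox:
  assumes "X \<in> closure (range (\<lambda>p. jpoly p a))"
  shows "\<exists>f. continuous_on (jspectrum a) f \<and> japprox a f X"
proof -
  let ?K = "jspectrum a"
  obtain x where x: "\<forall>n. x n \<in> range (\<lambda>p. jpoly p a)" "x \<longlonglongrightarrow> X"
    using assms unfolding closure_sequential by blast
  then have "\<forall>n. \<exists>p. x n = jpoly p a" by blast
  then obtain p where "\<forall>n. x n = jpoly (p n) a" by metis
  then have X: "(\<lambda>n. jpoly (p n) a) \<longlonglongrightarrow> X" using x(2) by presburger
  have "uniformly_Cauchy_on ?K (\<lambda>n. poly (p n))"
    unfolding uniformly_Cauchy_on_def
  proof (intro allI impI)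
    fix e :: real assume "e > 0"
    obtain N where N: "\<forall>m\<ge>N. \<forall>n\<ge>N. norm (jpoly (p m) a - jpoly (p n) a) < e"
      using CauchyD[OF LIMSEQ_imp_Cauchy[OF X] \<open>e > 0\<close>] by blast
    have "dist (poly (p m) t) (poly (p n) t) < e" if "t \<in> ?K" "m \<ge> N" "n \<ge> N" for t m n
    proof -
      have "dist (poly (p m) t) (poly (p n) t) \<le> norm (jpoly (p m) a - jpoly (p n) a)"
        using poly_le_norm_jpoly[OF that(1), of "p m - p n"] by (simp add: dist_real_def jpoly_diff)
      also have "\<dots> < e" using N that by blast
      finally show ?thesis .
    qed
    then show "\<exists>M. \<forall>x\<in>?K. \<forall>m\<ge>M. \<forall>n\<ge>M. dist (poly (p m) x) (poly (p n) x) < e" by blast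
  qed
  then obtain f where f: "uniform_limit ?K (\<lambda>n. poly (p n)) f sequentially"
    using uniformly_convergent_eq_Cauchy uniformly_convergent_on_def by blast
  have "continuous_on ?K f"
    by (rule uniform_limit_theorem[OF _ f]) (auto intro!: always_eventually continuous_intros)
  moreover have "japprox a f X"
    unfolding japprox_def
  proof (intro allI impI)
    fix e :: real assume "e > 0"
    have "\<forall>\<^sub>F n in sequentially. \<forall>t\<in>?K. dist (poly (p n) t) (f t) < e"
      using uniform_limitD[OF f \<open>e > 0\<close>] .
    moreover have "\<forall>\<^sub>F n in sequentially. dist (jpoly (p n) a) X < e"
      using tendstoD[OF X \<open>e > 0\<close>] .
    ultimately have "\<forall>\<^sub>F n in sequentially. (\<forall>t\<in>?K. dist (poly (p n) t) (f t) < e) \<and> dist (jpoly (p n) a) X < e"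
      by (rule eventually_conj)
    then obtain n where "\<forall>t\<in>?K. dist (poly (p n) t) (f t) < e" "dist (jpoly (p n) a) X < e"
      using eventually_happens[of _ sequentially] by auto
    then have "\<forall>t\<in>?K. \<bar>f t - poly (p n) t\<bar> < e" "norm (X - jpoly (p n) a) < e"
      by (simp_all add: dist_norm abs_minus_commute norm_minus_commute[of X])
    then have "(\<forall>t\<in>?K. \<bar>f t - poly (p n) t\<bar> \<le> e) \<and> norm (X - jpoly (p n) a) \<le> e"
      by (simp add: less_imp_le)
    then show "\<exists>p. (\<forall>t\<in>?K. \<bar>f t - poly p t\<bar> \<le> e) \<and> norm (X - jpoly p a) \<le> e" ..
  qed
  ultimately show ?thesis by blast
qed

lemma sup_norm_on_eqI:
  assumes "0 \<le> M" and "\<And>t. t \<in> K \<Longrightarrow> \<bar>f t\<bar> \<le> M"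
    and "\<And>N. 0 \<le> N \<Longrightarrow> (\<And>t. t \<in> K \<Longrightarrow> \<bar>f t\<bar> \<le> N) \<Longrightarrow> M \<le> N"
  shows "sup_norm_on K f = M"
  unfolding sup_norm_on_def by (rule cSup_eq_non_empty) (use assms in auto)

lemma norm_japprox: "japprox a f X \<Longrightarrow> norm X = sup_norm_on (jspectrum a) f"
  by (rule sup_norm_on_eqI[symmetric]) (auto intro: japprox_le_norm japprox_norm_le)

lemma jpoly_mem_closed_jsubalgebra:
  assumes "closed_jsubalgebra S" "a \<in> S" "junit \<in> S"
  shows "jpoly p a \<in> S"
  using assms unfolding closed_jsubalgebra_def
  by (induction p) (auto simp: subspace_0 subspace_add subspace_scale)

text \<open>The set has two descriptions: as the closure of the polynomials in a it is closed and
  lies in every closed subalgebra containing a and the unit; as the set of values of the calculus it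
  is visibly closed under sums and products.\<close>

lemma japprox_image_eq_hull:
  "{X. \<exists>f. continuous_on (jspectrum a) f \<and> japprox a f X} = closed_jsubalgebra hull {a, junit}"
  (is "?R = ?H")
proof
  have R: "?R = closure (range (\<lambda>p. jpoly p a))"
  proof
    show "?R \<subseteq> closure (range (\<lambda>p. jpoly p a))"
    proof
      fix X assume "X \<in> ?R"
      then obtain f where "japprox a f X" by blast
      then show "X \<in> closure (range (\<lambda>p. jpoly p a))"
        unfolding closure_approachable using japprox_limit by blast
    qed
    show "closure (range (\<lambda>p. jpoly p a)) \<subseteq> ?R"
      using closure_jpoly_imp_japprox by blast
  qed
  show "?R \<subseteq> ?H"
    unfolding hull_def R
  proof (rule Inter_greatest)
    fix T assume "T \<in> {t. closed_jsubalgebra t \<and> {a, junit} \<subseteq> t}"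
    then have T: "closed_jsubalgebra T" "a \<in> T" "junit \<in> T" by auto
    then have "range (\<lambda>p. jpoly p a) \<subseteq> T" using jpoly_mem_closed_jsubalgebra by blast
    moreover have "closed T" using T(1) closed_jsubalgebra_def by blast
    ultimately show "closure (range (\<lambda>p. jpoly p a)) \<subseteq> T" by (rule closure_minimal)
  qed
  have "closed_jsubalgebra ?R"
    unfolding closed_jsubalgebra_def
  proof (intro conjI ballI)
    show "subspace ?R"
      unfolding subspace_def
    proof (intro conjI ballI allI)
      show "0 \<in> ?R" using japprox_const[of a 0] by (auto intro!: exI[of _ "\<lambda>_. 0"])
    next
      fix X Y assume "X \<in> ?R" "Y \<in> ?R"
      then show "X + Y \<in> ?R" using japprox_add continuous_on_add by blast
    next
      fix c X assume "X \<in> ?R"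
      then show "c *\<^sub>R X \<in> ?R" using japprox_scaleR continuous_on_mult_left by blast
    qed
    show "X \<circ>\<^sub>J Y \<in> ?R" if "X \<in> ?R" "Y \<in> ?R" for X Y
      using that japprox_mult continuous_on_mult by blast
    show "closed ?R" unfolding R by simp
  qed
  moreover have "a \<in> ?R" using japprox_id continuous_on_id by blast
  moreover have "junit \<in> ?R" using japprox_const[of a 1] by (auto intro!: exI[of _ "\<lambda>_. 1"])
  ultimately show "?H \<subseteq> ?R" by (intro hull_minimal) auto
qed

lemma is_jcalculus_exists: "\<exists>\<Phi>. is_jcalculus a \<Phi>"
proof -
  define \<Phi> where "\<Phi> f = (THE X. japprox a f X)" for f
  have \<Phi>: "\<Phi> f = X" if "japprox a f X" for f X
    unfolding \<Phi>_def using that japprox_unique by blast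
  have approx: "japprox a f (\<Phi> f)" if "continuous_on (jspectrum a) f" for f
    using japprox_exists[OF that] \<Phi> by blast
  have img: "\<Phi> ` {f. continuous_on (jspectrum a) f} = closed_jsubalgebra hull {a, junit}"
    unfolding japprox_image_eq_hull[symmetric] using \<Phi> approx by blast
  have "is_jcalculus a \<Phi>"
    unfolding is_jcalculus_def Let_def img
  proof (intro conjI ballI allI)
    show "\<Phi> (\<lambda>t. t) = a" "\<Phi> (\<lambda>_. 1) = junit"
      using \<Phi>[OF japprox_id] \<Phi>[OF japprox_const, of 1] by simp_all
  qed (simp_all add: \<Phi>[OF japprox_add] \<Phi>[OF japprox_mult] \<Phi>[OF japprox_scaleR] approx norm_japprox)
  then show ?thesis by blast
qed

text \<open>Uniqueness of the calculus, on which the definite description in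
  \<open>jcalculus\<close> rests: the algebraic laws fix the values on polynomials, and the isometry
  extends them to uniform limits.\<close>

lemma is_jcalculus_japprox:
  assumes \<Phi>: "is_jcalculus a \<Phi>" and f: "continuous_on (jspectrum a) f"
  shows "japprox a f (\<Phi> f)"
proof -
  let ?K = "jspectrum a"
  have add: "\<Phi> (\<lambda>t. f t + g t) = \<Phi> f + \<Phi> g" and mult: "\<Phi> (\<lambda>t. f t * g t) = \<Phi> f \<circ>\<^sub>J \<Phi> g"
    if "continuous_on ?K f" "continuous_on ?K g" for f g
    using \<Phi> that unfolding is_jcalculus_def Let_def by blast+
  have scale: "\<Phi> (\<lambda>t. r * f t) = r *\<^sub>R \<Phi> f" and nrm: "norm (\<Phi> f) = sup_norm_on ?K f"
    if "continuous_on ?K f" for f r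
    using \<Phi> that unfolding is_jcalculus_def Let_def by blast+
  have id: "\<Phi> (\<lambda>t. t) = a" and one: "\<Phi> (\<lambda>_. 1) = junit"
    using \<Phi> unfolding is_jcalculus_def Let_def by blast+
  have const: "\<Phi> (\<lambda>_. c) = c *\<^sub>R junit" for c
    using scale[of "\<lambda>_. 1" c] one by simp
  have cp: "continuous_on ?K (poly p)" for p by (intro continuous_intros)
  have poly: "\<Phi> (poly p) = jpoly p a" for p
  proof (induction p)
    case 0
    then show ?case using const[of 0] by (simp add: poly_0 [abs_def])
  next
    case (pCons c p)
    have "poly (pCons c p) = (\<lambda>t. c + t * poly p t)" by auto
    then have "\<Phi> (poly (pCons c p)) = \<Phi> (\<lambda>_. c) + \<Phi> (\<lambda>t. t) \<circ>\<^sub>J \<Phi> (poly p)"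
      using add[of "\<lambda>_. c" "\<lambda>t. t * poly p t"] mult[of "\<lambda>t. t" "poly p"] cp[of p]
      by (simp add: continuous_intros)
    then show ?case by (simp only: const id pCons jpoly_pCons)
  qed
  show ?thesis
    unfolding japprox_def
  proof (intro allI impI)
    fix e :: real assume "e > 0"
    obtain p where p: "\<And>t. t \<in> ?K \<Longrightarrow> \<bar>f t - poly p t\<bar> < e"
      using polynomial_approximation[OF compact_jspectrum f \<open>e > 0\<close>] by blast
    have "\<Phi> f - jpoly p a = \<Phi> (\<lambda>t. f t + (- 1) * poly p t)"
      using add[OF f, of "\<lambda>t. (- 1) * poly p t"] scale[of "poly p" "- 1"] cp[of p] poly[of p]
      by (simp add: continuous_intros)
    then have "norm (\<Phi> f - jpoly p a) = sup_norm_on ?K (\<lambda>t. f t + (- 1) * poly p t)"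
      using f cp[of p] by (simp only: nrm continuous_intros)
    also have "\<dots> \<le> e"
      unfolding sup_norm_on_def by (rule cSup_least) (use p \<open>e > 0\<close> in \<open>auto simp: less_imp_le\<close>)
    finally show "\<exists>p. (\<forall>t\<in>?K. \<bar>f t - poly p t\<bar> \<le> e) \<and> norm (\<Phi> f - jpoly p a) \<le> e"
      using p less_imp_le by blast
  qed
qed

lemma jcalculus_japprox:
  assumes f: "continuous_on (jspectrum a) f"
  shows "japprox a f (jcalculus f a)"
proof -
  obtain \<Phi> where \<Phi>: "is_jcalculus a \<Phi>" using is_jcalculus_exists by blast
  have "jcalculus f a = \<Phi> f"
    unfolding jcalculus_def
    using is_jcalculus_japprox[OF _ f] japprox_unique \<Phi> by (intro the_equality) blast+
  then show ?thesis using is_jcalculus_japprox[OF \<Phi> f] by simp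
qed

lemma jcalculus_eqI:
  assumes "continuous_on (jspectrum a) f" "japprox a f X" shows "jcalculus f a = X"
  using japprox_unique jcalculus_japprox[OF assms(1)] assms(2) by blast

section \<open>Rules for computing with the functional calculus\<close>

lemma jcalculus_add:
  "continuous_on (jspectrum a) f \<Longrightarrow> continuous_on (jspectrum a) g \<Longrightarrow>
    jcalculus (\<lambda>t. f t + g t) a = jcalculus f a + jcalculus g a"
  by (intro jcalculus_eqI japprox_add jcalculus_japprox continuous_intros)

lemma jcalculus_diff:
  "continuous_on (jspectrum a) f \<Longrightarrow> continuous_on (jspectrum a) g \<Longrightarrow>
    jcalculus (\<lambda>t. f t - g t) a = jcalculus f a - jcalculus g a"
  by (intro jcalculus_eqI japprox_diff jcalculus_japprox continuous_intros)

lemma jcalculus_mult: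
  "continuous_on (jspectrum a) f \<Longrightarrow> continuous_on (jspectrum a) g \<Longrightarrow>
    jcalculus (\<lambda>t. f t * g t) a = jcalculus f a \<circ>\<^sub>J jcalculus g a"
  by (intro jcalculus_eqI japprox_mult jcalculus_japprox continuous_intros)

lemma jcalculus_scaleR:
  "continuous_on (jspectrum a) f \<Longrightarrow> jcalculus (\<lambda>t. c * f t) a = c *\<^sub>R jcalculus f a"
  by (intro jcalculus_eqI japprox_scaleR jcalculus_japprox continuous_intros)

lemma jcalculus_const: "jcalculus (\<lambda>_. c) a = c *\<^sub>R junit"
  by (intro jcalculus_eqI japprox_const continuous_intros)

lemma jcalculus_id: "jcalculus (\<lambda>t. t) a = a"
  by (intro jcalculus_eqI japprox_id continuous_intros)

lemma jcalculus_cong: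
  assumes "continuous_on (jspectrum a) f" "\<And>t. t \<in> jspectrum a \<Longrightarrow> f t = g t"
  shows "jcalculus f a = jcalculus g a"
proof -
  have "continuous_on (jspectrum a) g" using assms continuous_on_cong by metis
  then show ?thesis
    using japprox_cong[OF jcalculus_japprox[OF assms(1)] assms(2)] by (intro jcalculus_eqI[symmetric])
qed

lemma norm_jcalculus_le:
  "continuous_on (jspectrum a) f \<Longrightarrow> 0 \<le> M \<Longrightarrow> (\<And>t. t \<in> jspectrum a \<Longrightarrow> \<bar>f t\<bar> \<le> M) \<Longrightarrow>
    norm (jcalculus f a) \<le> M"
  by (rule japprox_norm_le[OF jcalculus_japprox])

lemma le_norm_jcalculus:
  "continuous_on (jspectrum a) f \<Longrightarrow> t \<in> jspectrum a \<Longrightarrow> \<bar>f t\<bar> \<le> norm (jcalculus f a)"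
  by (rule japprox_le_norm[OF jcalculus_japprox])

lemma jcalculus_sum:
  assumes "\<And>i. i \<in> I \<Longrightarrow> continuous_on (jspectrum a) (f i)"
  shows "jcalculus (\<lambda>t. \<Sum>i\<in>I. f i t) a = (\<Sum>i\<in>I. jcalculus (f i) a)"
  using assms
  by (induction I rule: infinite_finite_induct)
    (simp_all add: jcalculus_const jcalculus_add continuous_on_sum)

lemma jpos_jcalculus:
  assumes "continuous_on (jspectrum a) f" "\<And>t. t \<in> jspectrum a \<Longrightarrow> 0 \<le> f t"
  shows "jpos (jcalculus f a)"
proof -
  have c: "continuous_on (jspectrum a) (\<lambda>t. sqrt (f t))" using assms(1) by (intro continuous_intros)
  have "jcalculus f a = jcalculus (\<lambda>t. sqrt (f t) * sqrt (f t)) a"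
    using assms by (intro jcalculus_cong) auto
  then show ?thesis by (simp only: jcalculus_mult[OF c c] jpos_square)
qed

lemma is_jinverse_jcalculus:
  assumes f: "continuous_on (jspectrum a) f" and nz: "\<And>t. t \<in> jspectrum a \<Longrightarrow> f t \<noteq> 0"
  shows "is_jinverse (jcalculus f a) (jcalculus (\<lambda>t. inverse (f t)) a)"
proof -
  have i: "continuous_on (jspectrum a) (\<lambda>t. inverse (f t))"
    using f nz by (intro continuous_on_inverse) auto
  have 1: "jcalculus f a \<circ>\<^sub>J jcalculus (\<lambda>t. inverse (f t)) a = jcalculus (\<lambda>_. 1) a"
    unfolding jcalculus_mult[OF f i, symmetric]
    by (rule jcalculus_cong) (use f i nz in \<open>auto intro!: continuous_intros\<close>)
  have ff: "continuous_on (jspectrum a) (\<lambda>t. f t * f t)" using f by (intro continuous_intros)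
  have 2: "(jcalculus f a \<circ>\<^sub>J jcalculus f a) \<circ>\<^sub>J jcalculus (\<lambda>t. inverse (f t)) a = jcalculus f a"
    unfolding jcalculus_mult[OF f f, symmetric] jcalculus_mult[OF ff i, symmetric]
    by (rule jcalculus_cong) (use ff f i nz in \<open>auto intro!: continuous_intros\<close>)
  show ?thesis using 1 2 by (simp add: is_jinverse_def jcalculus_const)
qed

lemma jspectrum_jcalculus:
  assumes f: "continuous_on (jspectrum a) f"
  shows "jspectrum (jcalculus f a) = f ` jspectrum a"
proof (intro equalityI subsetI)
  fix r assume r: "r \<in> jspectrum (jcalculus f a)"
  have "jcalculus (\<lambda>t. f t - r) a = jcalculus f a - r *\<^sub>R junit"
    using f by (simp add: jcalculus_diff jcalculus_const)
  then have "\<not> jinvertible (jcalculus (\<lambda>t. f t - r) a)" using r by (simp add: jspectrum_def)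
  then have "\<not> (\<forall>t\<in>jspectrum a. f t - r \<noteq> 0)"
    using is_jinverse_jcalculus[OF continuous_on_diff[OF f continuous_on_const], of r]
    unfolding jinvertible_def by blast
  then show "r \<in> f ` jspectrum a" by auto
next
  fix r assume "r \<in> f ` jspectrum a"
  then obtain t where t: "t \<in> jspectrum a" and r: "r = f t" by blast
  show "r \<in> jspectrum (jcalculus f a)"
  proof (rule ccontr)
    assume "r \<notin> jspectrum (jcalculus f a)"
    \<comment> \<open>The norm formula detects only the least spectral value. For g^2, which is
      nonnegative, the zero at t forces that value to be 0, so the square of the supposedly
      invertible g(a) would be non-invertible.\<close>
    define g where "g = (\<lambda>t. f t - r)"
    have g: "continuous_on (jspectrum a) g" using f unfolding g_def by (intro continuous_intros)
    have gg: "continuous_on (jspectrum a) (\<lambda>t. g t * g t)" using g by (intro continuous_intros)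
    have "jinvertible (jcalculus g a)"
      using \<open>r \<notin> jspectrum (jcalculus f a)\<close> f unfolding g_def
      by (simp add: jspectrum_def jcalculus_diff jcalculus_const)
    then have inv: "jinvertible (jcalculus (\<lambda>t. g t * g t) a)"
      by (simp add: jcalculus_mult[OF g g] jinvertible_square_iff)
    have pos: "jpos (jcalculus (\<lambda>t. g t * g t) a)" by (simp add: jcalculus_mult[OF g g] jpos_square)
    define s where "s = norm (jcalculus (\<lambda>t. g t * g t) a)"
    have "norm (s *\<^sub>R junit - jcalculus (\<lambda>t. g t * g t) a) \<le> s"
      using pos jpos_iff_norm s_def by blast
    moreover have "\<bar>s - g t * g t\<bar> \<le> norm (s *\<^sub>R junit - jcalculus (\<lambda>t. g t * g t) a)"
      using le_norm_jcalculus[of a "\<lambda>t. s - g t * g t" t] gg t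
      by (simp add: jcalculus_diff jcalculus_const continuous_on_diff)
    moreover have "s \<ge> 0" "g t = 0" by (simp_all add: s_def g_def r)
    ultimately have eq: "s - norm (s *\<^sub>R junit - jcalculus (\<lambda>t. g t * g t) a) = 0" by simp
    have "(junit::'a) \<noteq> 0" using t jspectrum_trivial by auto
    then have "0 \<in> jspectrum (jcalculus (\<lambda>t. g t * g t) a)"
      using jspectrum_min[of "jcalculus (\<lambda>t. g t * g t) a" s] eq s_def by simp
    then show False using inv by (simp add: jspectrum_def)
  qed
qed

lemma jpoly_jcalculus:
  assumes f: "continuous_on (jspectrum a) f"
  shows "jpoly p (jcalculus f a) = jcalculus (\<lambda>t. poly p (f t)) a"
proof (induction p)
  case 0
  then show ?case by (simp add: jcalculus_const)
next
  case (pCons c p)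
  have "continuous_on (jspectrum a) (\<lambda>t. poly p (f t))" using f by (intro continuous_intros)
  then show ?case
    using f by (simp add: pCons jcalculus_add jcalculus_mult jcalculus_const continuous_intros)
qed

lemma jcalculus_compose:
  assumes f: "continuous_on (jspectrum a) f" and g: "continuous_on (f ` jspectrum a) g"
  shows "jcalculus g (jcalculus f a) = jcalculus (\<lambda>t. g (f t)) a"
proof -
  have gf: "continuous_on (jspectrum a) (\<lambda>t. g (f t))" by (rule continuous_on_compose2[OF g f]) auto
  have "norm (jcalculus g (jcalculus f a) - jcalculus (\<lambda>t. g (f t)) a) \<le> 0"
  proof (rule field_le_epsilon)
    fix e :: real assume "e > 0"
    have "japprox (jcalculus f a) g (jcalculus g (jcalculus f a))"
      by (rule jcalculus_japprox) (simp add: jspectrum_jcalculus[OF f] g)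
    then obtain p where p: "\<And>t. t \<in> jspectrum (jcalculus f a) \<Longrightarrow> \<bar>g t - poly p t\<bar> \<le> e / 2"
      "norm (jcalculus g (jcalculus f a) - jpoly p (jcalculus f a)) \<le> e / 2"
      using japproxE[of _ g _ "e / 2"] \<open>e > 0\<close> by (metis half_gt_zero)
    have pf: "continuous_on (jspectrum a) (\<lambda>t. poly p (f t))" using f by (intro continuous_intros)
    have "norm (jcalculus (\<lambda>t. g (f t) - poly p (f t)) a) \<le> e / 2"
      using p(1) \<open>e > 0\<close> by (intro norm_jcalculus_le continuous_on_diff gf pf) (auto simp: jspectrum_jcalculus[OF f])
    then have "norm (jpoly p (jcalculus f a) - jcalculus (\<lambda>t. g (f t)) a) \<le> e / 2"
      by (simp add: jcalculus_diff[OF gf pf] jpoly_jcalculus[OF f] norm_minus_commute)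
    with p(2) have "norm ((jcalculus g (jcalculus f a) - jpoly p (jcalculus f a))
        + (jpoly p (jcalculus f a) - jcalculus (\<lambda>t. g (f t)) a)) \<le> e / 2 + e / 2"
      by (rule norm_triangle_mono)
    then show "norm (jcalculus g (jcalculus f a) - jcalculus (\<lambda>t. g (f t)) a) \<le> 0 + e" by simp
  qed
  then show ?thesis by simp
qed

lemma jtriple_jcalculus:
  assumes "continuous_on (jspectrum a) f" "continuous_on (jspectrum a) g"
  shows "jtriple (jcalculus f a) (jcalculus g a) = jcalculus (\<lambda>t. (f t)\<^sup>2 * g t) a"
proof -
  have "jtriple (jcalculus f a) (jcalculus g a)
      = jcalculus (\<lambda>t. 2 * ((f t * g t) * f t) - (f t * f t) * g t) a"
    using assms
    by (simp only: jtriple_def jcalculus_mult jcalculus_const jcalculus_diff continuous_on_mult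
      continuous_on_const jmult_scaleR_left junit_left)
  also have "(\<lambda>t. 2 * ((f t * g t) * f t) - (f t * f t) * g t) = (\<lambda>t. (f t)\<^sup>2 * g t)"
    by (simp add: fun_eq_iff power2_eq_square)
  finally show ?thesis .
qed

subsection \<open>Powers of positive invertible elements\<close>

lemma jpos_inv_jinvertible: "jpos_inv a \<Longrightarrow> jinvertible a"
  by (simp add: jpos_inv_def)

lemma jpos_inv_jpos: "jpos_inv a \<Longrightarrow> jpos a"
  by (simp add: jpos_inv_def jpositive_iff_jpos)

lemma jpos_invI: "jpos a \<Longrightarrow> jinvertible a \<Longrightarrow> jpos_inv a"
  by (simp add: jpos_inv_def jpositive_iff_jpos)

lemma jspectrum_pos: "jpos_inv a \<Longrightarrow> t \<in> jspectrum a \<Longrightarrow> 0 < t"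
  by (force simp: jpos_inv_def jpositive_def jspectrum_def order_less_le)

lemma jpos_inv_jcalculus:
  assumes "continuous_on (jspectrum a) f" "\<And>t. t \<in> jspectrum a \<Longrightarrow> 0 < f t"
  shows "jpos_inv (jcalculus f a)"
proof (rule jpos_invI)
  show "jpos (jcalculus f a)" using assms by (intro jpos_jcalculus) (auto simp: less_imp_le)
  have "f t \<noteq> 0" if "t \<in> jspectrum a" for t using assms(2)[OF that] by simp
  then show "jinvertible (jcalculus f a)"
    using is_jinverse_jcalculus[OF assms(1)] jinvertible_def by blast
qed

lemma jinverse_jcalculus:
  assumes "continuous_on (jspectrum a) f" "\<And>t. t \<in> jspectrum a \<Longrightarrow> f t \<noteq> 0"
  shows "jinverse (jcalculus f a) = jcalculus (\<lambda>t. inverse (f t)) a"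
  by (intro jinverse_eqI is_jinverse_jcalculus assms)

lemma jpos_inv_add: "jpos_inv a \<Longrightarrow> jpos b \<Longrightarrow> jpos_inv (a + b)"
proof -
  assume "jpos_inv a" "jpos b"
  then obtain e where "e > 0" "jpos (a - e *\<^sub>R junit)" unfolding jpos_inv_iff by blast
  then have "jpos ((a - e *\<^sub>R junit) + b)" using jpos_add \<open>jpos b\<close> by blast
  then show ?thesis using \<open>e > 0\<close> unfolding jpos_inv_iff
    by (intro exI[of _ e]) (simp add: algebra_simps)
qed

lemma jpos_inv_scaleR: "jpos_inv a \<Longrightarrow> 0 < c \<Longrightarrow> jpos_inv (c *\<^sub>R a)"
  by (intro jpos_invI jpos_scaleR jinvertible_scaleR) (auto simp: jpos_inv_jpos jpos_inv_jinvertible)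

lemma jpos_inv_junit [simp]: "jpos_inv junit"
  by (intro jpos_invI) auto

lemma continuous_on_powr_jspectrum [continuous_intros]:
  "jpos_inv a \<Longrightarrow> continuous_on (jspectrum a) (\<lambda>t. t powr r)"
  by (intro continuous_intros) (use jspectrum_pos in force)

lemma jpowr_junit_exponents: "jpos_inv a \<Longrightarrow> jpowr a 1 = a" "jpos_inv a \<Longrightarrow> jpowr a 0 = junit"
proof -
  assume a: "jpos_inv a"
  have "jpowr a 1 = jcalculus (\<lambda>t. t) a"
    unfolding jpowr_def using jspectrum_pos[OF a] by (intro jcalculus_cong continuous_intros a) (auto simp: less_imp_le)
  then show "jpowr a 1 = a" by (simp add: jcalculus_id)
  have "jpowr a 0 = jcalculus (\<lambda>t. 1) a"
    unfolding jpowr_def using jspectrum_pos[OF a] by (intro jcalculus_cong continuous_intros a) fastforce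
  then show "jpowr a 0 = junit" by (simp add: jcalculus_const)
qed

lemma jpos_inv_jpowr: "jpos_inv a \<Longrightarrow> jpos_inv (jpowr a r)"
  unfolding jpowr_def by (intro jpos_inv_jcalculus continuous_intros) (auto dest: jspectrum_pos)

lemma jinvertible_jpowr [simp]: "jpos_inv a \<Longrightarrow> jinvertible (jpowr a r)"
  by (simp add: jpos_inv_jpowr jpos_inv_jinvertible)

lemma jpowr_jpowr:
  assumes "jpos_inv a" shows "jpowr (jpowr a r) s = jpowr a (r * s)"
proof -
  have "jpowr (jpowr a r) s = jcalculus (\<lambda>t. (t powr r) powr s) a"
    unfolding jpowr_def
    by (rule jcalculus_compose) (use assms in \<open>auto intro!: continuous_intros dest: jspectrum_pos\<close>)
  then show ?thesis by (simp add: jpowr_def powr_powr)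
qed

lemma jinverse_jpowr:
  assumes "jpos_inv a" shows "jinverse (jpowr a r) = jpowr a (- r)"
  unfolding jpowr_def using jspectrum_pos[OF assms]
  by (subst jinverse_jcalculus) (force simp: powr_minus intro: continuous_on_powr_jspectrum[OF assms])+

lemma jinverse_eq_jpowr: "jpos_inv a \<Longrightarrow> jinverse a = jpowr a (- 1)"
  using jinverse_jpowr[of a 1] by (simp add: jpowr_junit_exponents)

lemma jpos_inv_jinverse: "jpos_inv a \<Longrightarrow> jpos_inv (jinverse a)"
  by (simp add: jinverse_eq_jpowr jpos_inv_jpowr)

lemma jpowr_jinverse: "jpos_inv a \<Longrightarrow> jpowr (jinverse a) r = jpowr a (- r)"
  by (simp add: jinverse_eq_jpowr jpowr_jpowr)

lemma jpowr_scaleR: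
  assumes a: "jpos_inv a" and c: "0 < c"
  shows "jpowr (c *\<^sub>R a) r = (c powr r) *\<^sub>R jpowr a r"
proof -
  have "c *\<^sub>R a = jcalculus (\<lambda>t. c * t) a"
    by (simp add: jcalculus_scaleR jcalculus_id continuous_intros)
  then have "jpowr (c *\<^sub>R a) r = jcalculus (\<lambda>t. (c * t) powr r) a"
    unfolding jpowr_def
    using jspectrum_pos[OF a] c by (simp only:) (intro jcalculus_compose continuous_intros; force)
  also have "\<dots> = jcalculus (\<lambda>t. c powr r * t powr r) a"
    using jspectrum_pos[OF a] c
    by (intro jcalculus_cong continuous_intros) (auto simp: powr_mult less_imp_le)
  finally show ?thesis
    by (simp add: jcalculus_scaleR[OF continuous_on_powr_jspectrum[OF a]] jpowr_def)
qed

lemma jtriple_jpowr: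
  assumes a: "jpos_inv a"
  shows "jtriple (jpowr a r) (jpowr a s) = jpowr a (2 * r + s)"
proof -
  have "jtriple (jpowr a r) (jpowr a s) = jcalculus (\<lambda>t. (t powr r)\<^sup>2 * t powr s) a"
    unfolding jpowr_def by (intro jtriple_jcalculus continuous_intros a)
  also have "\<dots> = jpowr a (2 * r + s)"
    unfolding jpowr_def
    by (intro jcalculus_cong continuous_on_mult continuous_on_power continuous_on_powr_jspectrum[OF a])
      (simp only: power2_eq_square powr_add[symmetric] mult_2)
  finally show ?thesis .
qed

lemma jtriple_jpowr_self:
  assumes a: "jpos_inv a"
  shows "jtriple (jpowr a r) a = jpowr a (2 * r + 1)" "jtriple (jpowr a r) (jinverse a) = jpowr a (2 * r - 1)"
    "jtriple (jpowr a r) junit = jpowr a (2 * r)"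
  using jtriple_jpowr[OF a, of r 1] jtriple_jpowr[OF a, of r "-1"] jtriple_jpowr[OF a, of r 0]
  by (simp_all only: jpowr_junit_exponents[OF a] jinverse_eq_jpowr[OF a, symmetric]) (simp_all)

lemma jtriple_jpowr_cancel:
  assumes a: "jpos_inv a"
  shows "jtriple (jpowr a r) (jtriple (jpowr a (- r)) z) = z"
  using jtriple_jinverse_cancel(1)[OF jinvertible_jpowr[OF a, of r], of z] by (simp add: jinverse_jpowr[OF a])

subsection \<open>Positivity of the quadratic representation\<close>

lemma jpos_inv_jtriple:
  fixes a c :: "'a::unital_jb_algebra"
  assumes a: "jpos_inv a" and c: "jinvertible c"
  shows "jpos_inv (jtriple c a)"
proof (cases "junit = (0::'a)")
  case True
  have "jtriple c a = junit" using trivial_algebra[OF True, of "jtriple c a"] True by (rule trans[OF _ sym])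
  then show ?thesis by simp
next
  case False
  define x where "x t = (1 - t) *\<^sub>R junit + t *\<^sub>R a" for t
  have x: "jpos_inv (x t)" if "0 \<le> t" "t \<le> 1" for t
  proof (cases "t = 0")
    case True
    then show ?thesis by (simp add: x_def)
  next
    case False
    then have "jpos_inv (t *\<^sub>R a + (1 - t) *\<^sub>R junit)"
      using that a by (intro jpos_inv_add jpos_inv_scaleR jpos_scaleR) auto
    then show ?thesis by (simp add: x_def add.commute)
  qed
  define y where "y t = jtriple c (x t)" for t
  have y_eq: "y t = (1 - t) *\<^sub>R (c \<circ>\<^sub>J c) + t *\<^sub>R jtriple c a" for t
    by (simp add: y_def x_def linear_add[OF linear_jtriple] linear_scale[OF linear_jtriple])
  have inv: "jinvertible (y t)" if "0 \<le> t" "t \<le> 1" for t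
    unfolding y_def using x[OF that] c by (simp add: jpos_inv_jinvertible)
  \<comment> \<open>One bound for the norms along the whole segment makes \<open>m t\<close> the
    least spectral value of \<open>y t\<close> by a single formula, continuous in t. At t = 0 the
    element is the square of c, hence positive.\<close>
  define s where "s = norm (c \<circ>\<^sub>J c) + norm (jtriple c a)"
  have s: "norm (y t) \<le> s" if "0 \<le> t" "t \<le> 1" for t
  proof -
    have "norm (y t) \<le> (1 - t) * norm (c \<circ>\<^sub>J c) + t * norm (jtriple c a)"
      unfolding y_eq by (rule order.trans[OF norm_triangle_ineq]) (use that in simp)
    also have "\<dots> \<le> 1 * norm (c \<circ>\<^sub>J c) + 1 * norm (jtriple c a)"
      using that by (intro add_mono mult_right_mono) auto
    finally show ?thesis by (simp add: s_def)
  qed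
  define m where "m t = s - norm (s *\<^sub>R junit - y t)" for t
  have m_ne: "m t \<noteq> 0" if "0 \<le> t" "t \<le> 1" for t
    using jspectrum_min[OF False s[OF that]] inv[OF that] by (auto simp: m_def jspectrum_def)
  have m_cont: "continuous_on {0..1} m"
    unfolding m_def y_eq by (intro continuous_intros)
  have pos_iff: "jpos (y t) \<longleftrightarrow> m t \<ge> 0" if "0 \<le> t" "t \<le> 1" for t
    using jpos_iff_norm[OF s[OF that]] by (auto simp: m_def)
  have m0: "m 0 \<ge> 0" using pos_iff[of 0] jpos_square[of c] by (simp add: y_eq)
  have "m 1 \<ge> 0"
  proof (rule ccontr)
    assume "\<not> m 1 \<ge> 0"
    then obtain t where "0 \<le> t" "t \<le> 1" "m t = 0"
      using IVT2'[of m 1 0 0] m0 m_cont by auto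
    then show False using m_ne by blast
  qed
  then have "jpos (y 1)" using pos_iff by simp
  then show ?thesis using inv[of 1] by (intro jpos_invI) (simp_all add: y_eq)
qed

lemma jpos_jtriple:
  assumes "jpos a" "jinvertible c" shows "jpos (jtriple c a)"
proof (rule jpos_limit)
  have "(\<lambda>n. jtriple c a + inverse (real (Suc n)) *\<^sub>R (c \<circ>\<^sub>J c)) \<longlonglongrightarrow> jtriple c a + 0 *\<^sub>R (c \<circ>\<^sub>J c)"
    by (intro tendsto_intros LIMSEQ_inverse_real_of_nat)
  then show "(\<lambda>n. jtriple c a + inverse (real (Suc n)) *\<^sub>R (c \<circ>\<^sub>J c)) \<longlonglongrightarrow> jtriple c a" by simp
  fix n
  have "jpos_inv (inverse (real (Suc n)) *\<^sub>R junit + a)"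
    using assms(1) by (intro jpos_inv_add jpos_inv_scaleR) auto
  then have "jpos_inv (jtriple c (inverse (real (Suc n)) *\<^sub>R junit + a))"
    using assms(2) by (rule jpos_inv_jtriple)
  then show "jpos (jtriple c a + inverse (real (Suc n)) *\<^sub>R (c \<circ>\<^sub>J c))"
    by (simp only: linear_add[OF linear_jtriple] linear_scale[OF linear_jtriple] jtriple_junit_right
      jpos_inv_jpos add.commute)
qed

subsection \<open>Approximation of power functions\<close>

text \<open>The integrand t^l x / (x + t), with respect to dt / t, written in the variable v = ln t
  - ln x and divided by x^l; see \<open>powr_kernel_eq\<close>. The integral over v is therefore a
  constant independent of x.\<close>

definition powr_kernel :: "real \<Rightarrow> real \<Rightarrow> real" where
  "powr_kernel l v = exp (l * v) / (1 + exp v)"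

lemma one_plus_exp_pos: "0 < 1 + exp (v::real)"
  by (simp add: add_pos_pos)

lemma powr_kernel_pos: "0 < powr_kernel l v"
  by (simp add: powr_kernel_def one_plus_exp_pos)

text \<open>The logarithm of the kernel has derivative l - exp v / (1 + exp v), which lies in
  [-1, 1] for l in [0, 1].\<close>

lemma powr_kernel_add_le:
  assumes "0 \<le> l" "l \<le> 1"
  shows "powr_kernel l (v + s) \<le> exp \<bar>s\<bar> * powr_kernel l v"
proof -
  have "exp (l * s) * (1 + exp v) \<le> exp \<bar>s\<bar> * (1 + exp (v + s))"
  proof (cases "0 \<le> s")
    case True
    have "l * s \<le> s" using mult_right_mono[OF assms(2) True] by simp
    then show ?thesis using True by (intro mult_mono) (auto simp: add_nonneg_nonneg)
  next
    case False
    have "l * s \<le> 0" using False assms by (simp add: mult_nonneg_nonpos)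
    then have "exp (l * s) * (1 + exp v) \<le> 1 * (1 + exp v)" by (intro mult_right_mono) (auto simp: add_nonneg_nonneg)
    also have "\<dots> \<le> exp (- s) * (1 + exp (v + s))"
      using False by (simp add: algebra_simps exp_add[symmetric])
    finally show ?thesis using False by simp
  qed
  from mult_left_mono[OF this, of "exp (l * v)"]
  have "exp (l * (v + s)) * (1 + exp v) \<le> exp \<bar>s\<bar> * exp (l * v) * (1 + exp (v + s))"
    by (simp only: distrib_left[of l] exp_add[of "l * v"] mult.assoc mult.left_commute exp_ge_zero)
  then have "exp (l * (v + s)) \<le> exp \<bar>s\<bar> * exp (l * v) * (1 + exp (v + s)) / (1 + exp v)"
    by (simp only: pos_le_divide_eq one_plus_exp_pos)
  also have "\<dots> = exp \<bar>s\<bar> * powr_kernel l v * (1 + exp (v + s))"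
    by (simp add: powr_kernel_def)
  finally show ?thesis
    unfolding powr_kernel_def[of l "v + s"] by (simp only: pos_divide_le_eq one_plus_exp_pos)
qed

text \<open>The kernel decays like exp (l v) to the left and like exp (-(1 - l) v) to the right. The
  common rate min l (1 - l) is positive only for 0 < l < 1.\<close>

lemma powr_kernel_tail:
  assumes "0 \<le> l" "l \<le> 1" "0 \<le> r" "r \<le> \<bar>v\<bar>"
  shows "powr_kernel l v \<le> exp (- (min l (1 - l) * r))"
proof (cases "0 \<le> v")
  case True
  have "powr_kernel l v \<le> exp (l * v) / exp v"
    unfolding powr_kernel_def by (intro divide_left_mono) (auto simp: one_plus_exp_pos)
  also have "\<dots> = exp (- ((1 - l) * v))" by (simp add: exp_diff[symmetric] algebra_simps)
  also have "\<dots> \<le> exp (- (min l (1 - l) * r))"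
    using assms True mult_mono[of "min l (1 - l)" "1 - l" r v] by simp
  finally show ?thesis .
next
  case False
  have "powr_kernel l v \<le> exp (l * v) / 1"
    unfolding powr_kernel_def by (intro divide_left_mono) (auto simp: one_plus_exp_pos)
  also have "\<dots> = exp (- (l * (- v)))" by simp
  also have "\<dots> \<le> exp (- (min l (1 - l) * r))"
    using assms False mult_mono[of "min l (1 - l)" l r "- v"] by simp
  finally show ?thesis .
qed

lemma sum_powr_kernel_tail:
  fixes N J :: int and F :: "int set" and l h :: real
  assumes l: "0 \<le> l" "l \<le> 1" and h: "0 < h" and "0 \<le> J" "J \<le> N" and F: "finite F" "card F \<le> n"
    and big: "\<And>k. k \<in> F \<Longrightarrow> N - J \<le> \<bar>k\<bar>"
  shows "(\<Sum>k\<in>F. powr_kernel l (k * h)) \<le> n * exp (- (min l (1 - l) * (real_of_int (N - J) * h)))"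
proof -
  have "(\<Sum>k\<in>F. powr_kernel l (k * h)) \<le> (\<Sum>k\<in>F. exp (- (min l (1 - l) * (real_of_int (N - J) * h))))"
  proof (intro sum_mono powr_kernel_tail l)
    fix k assume "k \<in> F"
    then have "real_of_int (N - J) \<le> real_of_int \<bar>k\<bar>" using big of_int_le_iff by blast
    then show "real_of_int (N - J) * h \<le> \<bar>k * h\<bar>" using h by (simp add: abs_mult mult_right_mono)
    show "0 \<le> real_of_int (N - J) * h" using assms by simp
  qed
  also have "\<dots> \<le> n * exp (- (min l (1 - l) * (real_of_int (N - J) * h)))" using F by (simp add: mult_right_mono)
  finally show ?thesis .
qed

text \<open>Up to a factor \<open>exp h\<close>, the Riemann sum with mesh \<open>h\<close> does not depend on \<open>y\<close>, because
  translating \<open>y\<close> by \<open>h\<close> only shifts the summation index.\<close>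

lemma sum_powr_kernel_shift:
  fixes N J :: int and l h y :: real
  assumes l: "0 \<le> l" "l \<le> 1" and h: "0 < h" and J: "0 \<le> J" "J \<le> N" and y: "\<bar>y\<bar> + h \<le> J * h"
  defines "D \<equiv> (\<Sum>k=-N..N. powr_kernel l (k * h))"
    and "T \<equiv> 2 * J * exp (- (min l (1 - l) * (real_of_int (N - J) * h)))"
  shows "(\<Sum>k=-N..N. powr_kernel l (k * h - y)) \<le> exp h * (D + T)"
    and "exp (- h) * (D - T) \<le> (\<Sum>k=-N..N. powr_kernel l (k * h - y))"
proof -
  let ?g = "\<lambda>k::int. powr_kernel l (k * h)"
  \<comment> \<open>Rounding y to the mesh point j h costs the factor exp h. The summand h in the
    hypothesis on y absorbs the rounding when y is negative, so that |j| <= J.\<close>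
  define j where "j = \<lfloor>y / h\<rfloor>"
  have "real_of_int j \<le> y / h" "y / h < real_of_int j + 1" by (simp_all add: j_def floor_correct)
  then have j1: "j * h \<le> y" "y < j * h + h" using h by (simp_all add: field_simps)
  have "real_of_int j * h \<le> real_of_int J * h"
    using j1(1) y h abs_ge_self[of y] by linarith
  moreover have "real_of_int (- j) * h \<le> real_of_int J * h"
    unfolding of_int_minus mult_minus_left using j1(2) y abs_ge_minus_self[of y] by linarith
  ultimately have "j \<le> J" "- j \<le> J"
    using h by (simp_all only: mult_le_cancel_right_pos of_int_le_iff)
  then have "\<bar>j\<bar> \<le> J" by simp
  have shift: "(\<Sum>k=-N..N. ?g (k - j)) = sum ?g {-N-j..N-j}"
    by (rule sum.reindex_bij_witness[of _ "\<lambda>k. k + j" "\<lambda>k. k - j"]) auto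
  have near: "\<bar>j * h - y\<bar> \<le> h" using j1 by linarith
  have up: "powr_kernel l (k * h - y) \<le> exp h * ?g (k - j)" for k
  proof -
    have "powr_kernel l (k * h - y) \<le> exp \<bar>j * h - y\<bar> * ?g (k - j)"
      using powr_kernel_add_le[OF l, of "(k - j) * h" "j * h - y"] by (simp add: algebra_simps)
    also have "\<dots> \<le> exp h * ?g (k - j)" using near powr_kernel_pos[of l] by (intro mult_right_mono) (auto simp: less_imp_le)
    finally show ?thesis .
  qed
  have lo: "exp (- h) * ?g (k - j) \<le> powr_kernel l (k * h - y)" for k
  proof -
    have "?g (k - j) \<le> exp \<bar>y - j * h\<bar> * powr_kernel l (k * h - y)"
      using powr_kernel_add_le[OF l, of "k * h - y" "y - j * h"] by (simp add: algebra_simps)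
    also have "\<dots> \<le> exp h * powr_kernel l (k * h - y)"
      using near powr_kernel_pos[of l] by (intro mult_right_mono) (auto simp: less_imp_le abs_minus_commute)
    finally show ?thesis by (simp add: exp_minus field_simps)
  qed
  \<comment> \<open>A shift by at most J changes the window -N..N only near its ends; the enlarged
    window gains 2 J indices and the shrunken one loses 2 J, all of absolute value at least N -
    J.\<close>
  have tail: "sum ?g F \<le> T" if "finite F" "card F \<le> nat (2 * J)" "\<And>k. k \<in> F \<Longrightarrow> N - J \<le> \<bar>k\<bar>" for F
    using sum_powr_kernel_tail[OF l h J that] J by (simp add: T_def)
  have nn: "0 \<le> ?g k" for k using powr_kernel_pos[of l] less_imp_le by blast
  have "sum ?g {-N-j..N-j} \<le> sum ?g ({-N..N} \<union> ({-N-J..N+J} - {-N..N}))"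
    using \<open>\<bar>j\<bar> \<le> J\<close> by (intro sum_mono2 nn) auto
  also have "\<dots> = D + sum ?g ({-N-J..N+J} - {-N..N})"
    unfolding D_def by (rule sum.union_disjoint) auto
  also have "\<dots> \<le> D + T"
    using J by (intro add_left_mono tail) (auto simp: card_Diff_subset)
  finally have 1: "sum ?g {-N-j..N-j} \<le> D + T" .
  have "D \<le> sum ?g ({-N-j..N-j} \<union> ({-N..N} - {-(N-J)..N-J}))"
    unfolding D_def using \<open>\<bar>j\<bar> \<le> J\<close> by (intro sum_mono2 nn) auto
  also have "\<dots> \<le> sum ?g {-N-j..N-j} + sum ?g ({-N..N} - {-(N-J)..N-J})"
    using sum_nonneg[of "{-N-j..N-j} \<inter> ({-N..N} - {-(N-J)..N-J})" ?g] nn by (subst sum_Un) auto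
  also have "\<dots> \<le> sum ?g {-N-j..N-j} + T"
    using J by (intro add_left_mono tail) (auto simp: card_Diff_subset)
  finally have 2: "D - T \<le> sum ?g {-N-j..N-j}" by simp
  have "(\<Sum>k=-N..N. powr_kernel l (k * h - y)) \<le> exp h * sum ?g {-N-j..N-j}"
    unfolding shift[symmetric] sum_distrib_left by (intro sum_mono up)
  also have "\<dots> \<le> exp h * (D + T)" using 1 by simp
  finally show "(\<Sum>k=-N..N. powr_kernel l (k * h - y)) \<le> exp h * (D + T)" .
  have "exp (- h) * (D - T) \<le> exp (- h) * sum ?g {-N-j..N-j}" using 2 by simp
  also have "\<dots> \<le> (\<Sum>k=-N..N. powr_kernel l (k * h - y))"
    unfolding shift[symmetric] sum_distrib_left by (intro sum_mono lo)
  finally show "exp (- h) * (D - T) \<le> (\<Sum>k=-N..N. powr_kernel l (k * h - y))" .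
qed

lemma powr_kernel_eq:
  assumes "0 < x"
  shows "exp (l * u) * (x / (x + exp u)) = x powr l * powr_kernel l (u - ln x)"
proof -
  have "1 + exp (u - ln x) = (x + exp u) / x"
    using assms by (simp add: exp_diff field_simps)
  moreover have "exp (l * (u - ln x)) = exp (l * u) / x powr l"
    using assms by (simp add: powr_def exp_diff right_diff_distrib)
  ultimately show ?thesis using assms by (simp add: powr_kernel_def)
qed

text \<open>Dividing the Riemann sum by its value D at x = 1 leaves the ratio S / D, which is near 1
  by the shift estimate. The nodes are t = exp (k h) and the coefficients are nonnegative, so
  combinations of operator means remain means.\<close>

lemma powr_approximation:
  fixes l m M e :: real
  assumes l: "0 < l" "l < 1" and m: "0 < m" "m \<le> M" and e: "0 < e"
  shows "\<exists>(I::int set) c t. finite I \<and> (\<forall>i. 0 \<le> c i \<and> 0 < t i) \<and>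
    (\<forall>x\<in>{m..M}. \<bar>(\<Sum>i\<in>I. c i * (x / (x + t i))) - x powr l\<bar> \<le> e)"
proof -
  define B where "B = M powr l"
  have B: "B > 0" using m by (simp add: B_def)
  \<comment> \<open>The relative error 5 \<eta> covers (1 + \<eta>)^2 - 1, one factor for the mesh
    and one for the tail; B bounds x^l on the interval.\<close>
  define \<eta> where "\<eta> = min 1 (e / (5 * B))"
  have \<eta>: "0 < \<eta>" "\<eta> \<le> 1" "5 * \<eta> * B \<le> e" using B e by (simp_all add: \<eta>_def min_def field_simps)
  define h where "h = ln (1 + \<eta>)"
  have h: "h > 0" "exp h = 1 + \<eta>" using \<eta> by (simp_all add: h_def)
  define L where "L = max \<bar>ln m\<bar> \<bar>ln M\<bar>"
  define J where "J = \<lceil>L / h + 1\<rceil>"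
  have "L \<ge> 0" by (simp add: L_def)
  then have J: "0 \<le> J" "L + h \<le> J * h"
  proof -
    have *: "L / h + 1 \<le> real_of_int J" by (simp add: J_def)
    moreover have "0 \<le> L / h" using \<open>L \<ge> 0\<close> h by simp
    ultimately show "0 \<le> J" by linarith
    have "L + h = (L / h + 1) * h" using h(1) by (simp add: distrib_right)
    then show "L + h \<le> J * h" using mult_right_mono[OF *, of h] h(1) by simp
  qed
  define \<delta> where "\<delta> = min l (1 - l)"
  have "\<delta> > 0" using l by (simp add: \<delta>_def)
  then have "exp (- (\<delta> * h)) < 1" using h by simp
  moreover have "\<eta> / (4 * J + 1) > 0" using \<eta> J by simp
  ultimately obtain n where n: "exp (- (\<delta> * h)) ^ n < \<eta> / (4 * J + 1)"
    using real_arch_pow_inv by blast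
  define N where "N = J + int n"
  define g where "g = (\<lambda>k::int. powr_kernel l (k * h))"
  define D where "D = (\<Sum>k=-N..N. g k)"
  define T where "T = 2 * J * exp (- (\<delta> * (real_of_int (N - J) * h)))"
  have "T = 2 * J * exp (- (\<delta> * h)) ^ n"
    by (simp add: T_def N_def exp_of_nat_mult[symmetric] algebra_simps)
  also have "\<dots> \<le> 2 * J * (\<eta> / (4 * J + 1))" using n J by (intro mult_left_mono) auto
  also have "\<dots> \<le> \<eta> / 2" using J \<eta> by (simp add: field_simps)
  finally have T: "T \<le> \<eta> / 2" .
  have "T \<ge> 0" using J by (simp add: T_def)
  \<comment> \<open>The term k = 0 alone equals 1/2. This converts the absolute tail bound T <=
    \<eta> / 2 into the relative one T <= \<eta> D.\<close>
  have D: "D \<ge> 1 / 2"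
  proof -
    have "g 0 \<le> D" unfolding D_def
      by (rule member_le_sum) (use J N_def powr_kernel_pos in \<open>auto simp: g_def less_imp_le\<close>)
    then show ?thesis by (simp add: g_def powr_kernel_def)
  qed
  have "\<eta> * (1 / 2) \<le> \<eta> * D" using D \<eta> by (intro mult_left_mono) auto
  then have TD: "T \<le> \<eta> * D" using T by linarith
  define c where "c = (\<lambda>k::int. exp (l * (k * h)) / D)"
  have "\<bar>(\<Sum>k=-N..N. c k * (x / (x + exp (k * h)))) - x powr l\<bar> \<le> e" if x: "x \<in> {m..M}" for x
  proof -
    define S where "S = (\<Sum>k=-N..N. powr_kernel l (k * h - ln x))"
    have x0: "x > 0" using x m by auto
    have lnx: "ln m \<le> ln x" "ln x \<le> ln M" using x m by auto
    then have "\<bar>ln x\<bar> + h \<le> J * h" using J by (auto simp: L_def)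
    then have S: "S \<le> exp h * (D + T)" "exp (- h) * (D - T) \<le> S"
      using sum_powr_kernel_shift[of l h J N "ln x"] l h J
      by (auto simp: S_def D_def T_def g_def \<delta>_def N_def)
    have "(\<Sum>k=-N..N. c k * (x / (x + exp (k * h)))) = x powr l * (S / D)"
      unfolding S_def sum_distrib_left sum_divide_distrib c_def
    proof (intro sum.cong refl)
      fix k
      have "exp (l * (k * h)) / D * (x / (x + exp (k * h)))
          = (exp (l * (k * h)) * (x / (x + exp (k * h)))) / D" by simp
      then show "exp (l * (k * h)) / D * (x / (x + exp (k * h))) = x powr l * (powr_kernel l (k * h - ln x) / D)"
        unfolding powr_kernel_eq[OF x0] by simp
    qed
    moreover have "\<bar>S / D - 1\<bar> \<le> 5 * \<eta>"
    proof -
      have "S \<le> (1 + \<eta>) * (D + \<eta> * D)"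
        using S(1) TD \<eta> unfolding h by (smt (verit, ccfv_SIG) mult_left_mono)
      also have "\<dots> = D * (1 + 2 * \<eta> + \<eta> * \<eta>)" by (simp add: algebra_simps)
      also have "\<dots> \<le> D * (1 + 5 * \<eta>)"
        using \<eta> D mult_right_mono[of \<eta> 1 \<eta>] by (intro mult_left_mono) auto
      finally have u: "S / D \<le> 1 + 5 * \<eta>" using D by (simp add: pos_divide_le_eq mult.commute)
      have "1 - \<eta> \<le> exp (- h)"
        using h \<eta> by (simp add: exp_minus field_simps)
      then have "(1 - \<eta>) * (D - \<eta> * D) \<le> exp (- h) * (D - T)"
        using TD \<eta> D by (intro mult_mono) (auto simp: mult_left_le_one_le)
      then have "(1 - \<eta>) * (D - \<eta> * D) \<le> S" using S(2) by linarith
      moreover have "D * (1 - 5 * \<eta>) \<le> (1 - \<eta>) * (D - \<eta> * D)"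
      proof -
        have "(1 - \<eta>) * (D - \<eta> * D) = D * (1 - 2 * \<eta> + \<eta> * \<eta>)" by (simp add: algebra_simps)
        then show ?thesis using D \<eta> by simp
      qed
      ultimately have "1 - 5 * \<eta> \<le> S / D" using D by (simp add: pos_le_divide_eq mult.commute)
      with u show ?thesis by (simp add: abs_le_iff)
    qed
    moreover have "x powr l \<le> B" unfolding B_def using x x0 l by (intro powr_mono2) auto
    ultimately have "\<bar>(\<Sum>k=-N..N. c k * (x / (x + exp (k * h)))) - x powr l\<bar> \<le> B * (5 * \<eta>)"
    proof -
      have "x powr l * (S / D) - x powr l = x powr l * (S / D - 1)" by (simp add: algebra_simps)
      then have "\<bar>x powr l * (S / D) - x powr l\<bar> = x powr l * \<bar>S / D - 1\<bar>" by (simp add: abs_mult)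
      also have "\<dots> \<le> B * (5 * \<eta>)"
        using \<open>\<bar>S / D - 1\<bar> \<le> 5 * \<eta>\<close> \<open>x powr l \<le> B\<close> B by (intro mult_mono) auto
      finally show ?thesis
        using \<open>(\<Sum>k=-N..N. c k * (x / (x + exp (k * h)))) = x powr l * (S / D)\<close> by simp
    qed
    then show ?thesis using \<eta>(3) by (simp add: mult.commute)
  qed
  moreover have "0 \<le> c k \<and> 0 < exp (real_of_int k * h)" for k using D by (simp add: c_def)
  ultimately show ?thesis
    by (intro exI[of _ "{-N..N}"] exI[of _ c] exI[of _ "\<lambda>k. exp (real_of_int k * h)"]) auto
qed

subsection \<open>Inversion is antitone and convex\<close>

lemma jspectrum_ge_one:
  assumes "jpos (z - junit)" "t \<in> jspectrum z" shows "1 \<le> t"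
proof -
  have "t - 1 \<in> jspectrum (z - junit)"
    using assms(2) by (simp add: jspectrum_def scaleR_left_diff_distrib)
  then show ?thesis using assms(1) unfolding jpositive_iff_jpos[symmetric] jpositive_def by auto
qed

section \<open>Reduction of two variables to one by congruence with half powers\<close>

lemma jtriple_diff: "jtriple c (a - b) = jtriple c a - jtriple c b"
  by (rule linear_diff[OF linear_jtriple])

lemma jtriple_add: "jtriple c (a + b) = jtriple c a + jtriple c b"
  by (rule linear_add[OF linear_jtriple])

lemma jtriple_scaleR: "jtriple c (r *\<^sub>R a) = r *\<^sub>R jtriple c a"
  by (rule linear_scale[OF linear_jtriple])

lemmas jtriple_linear = jtriple_add jtriple_diff jtriple_scaleR

lemma jtriple_jpowr_half:
  assumes a: "jpos_inv a"
  shows "jpowr a (1/2) \<circ>\<^sub>J jpowr a (1/2) = a" "jtriple (jpowr a (- (1/2))) a = junit"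
    "jpowr a (- (1/2)) \<circ>\<^sub>J jpowr a (- (1/2)) = jinverse a" "jtriple (jpowr a (1/2)) (jinverse a) = junit"
    "jtriple (jpowr a (1/2)) (jtriple (jpowr a (- (1/2))) z) = z"
    "jtriple (jpowr a (- (1/2))) (jtriple (jpowr a (1/2)) z) = z"
    "jinverse (jpowr a (1/2)) = jpowr a (- (1/2))" "jinverse (jpowr a (- (1/2))) = jpowr a (1/2)"
  using jtriple_jpowr_self[OF a, of "1/2"] jtriple_jpowr_self[OF a, of "- (1/2)"]
    jtriple_jpowr_cancel[OF a, of "1/2" z] jtriple_jpowr_cancel[OF a, of "- (1/2)" z]
    jinverse_jpowr[OF a, of "1/2"] jinverse_jpowr[OF a, of "- (1/2)"]
  by (simp_all add: jpowr_junit_exponents[OF a] jinverse_eq_jpowr[OF a])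

lemma jinverse_eq_jcalculus: "jpos_inv z \<Longrightarrow> jinverse z = jcalculus inverse z"
  using jinverse_jcalculus[of z "\<lambda>t. t"] jspectrum_pos[of z] by (force simp: jcalculus_id)

lemma continuous_on_inverse_jspectrum: "jpos_inv z \<Longrightarrow> continuous_on (jspectrum z) inverse"
  by (intro continuous_on_inverse continuous_on_id) (use jspectrum_pos in force)

text \<open>The congruence by a^(-1/2) moves a to the unit and b to z >= I. The unit and z lie in
  one functional calculus, where the claim is 1 - 1/t >= 0 for t >= 1.\<close>

lemma jinverse_antitone:
  assumes a: "jpos_inv a" and b: "jpos_inv b" and le: "jpos (b - a)"
  shows "jpos (jinverse a - jinverse b)"
proof -
  define z where "z = jtriple (jpowr a (- (1/2))) b"
  have z: "jpos_inv z" unfolding z_def using a b by (intro jpos_inv_jtriple jinvertible_jpowr)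
  have zb: "b = jtriple (jpowr a (1/2)) z" by (simp add: z_def jtriple_jpowr_half[OF a])
  have "z - junit = jtriple (jpowr a (- (1/2))) (b - a)"
    by (simp add: z_def jtriple_linear jtriple_jpowr_half[OF a])
  then have "jpos (z - junit)" using le a by (simp add: jpos_jtriple)
  then have ge: "1 \<le> t" if "t \<in> jspectrum z" for t using jspectrum_ge_one that by blast
  have "jpos (jcalculus (\<lambda>t. 1 - inverse t) z)"
    using ge by (intro jpos_jcalculus continuous_on_diff continuous_on_const continuous_on_inverse_jspectrum z)
      (simp add: inverse_le_1_iff)
  then have "jpos (junit - jinverse z)"
    by (simp add: jcalculus_diff continuous_on_inverse_jspectrum[OF z] jcalculus_const jinverse_eq_jcalculus[OF z])
  then have "jpos (jtriple (jpowr a (- (1/2))) (junit - jinverse z))" using a by (simp add: jpos_jtriple)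
  moreover have "jinverse b = jtriple (jpowr a (- (1/2))) (jinverse z)"
    unfolding zb using a z by (simp add: jpos_inv_jinvertible jtriple_jpowr_half[OF a])
  ultimately show ?thesis by (simp add: jtriple_linear jtriple_jpowr_half[OF a])
qed

lemma jpos_inv_convex:
  assumes "jpos_inv a" "jpos_inv b" "0 \<le> s" "s \<le> 1"
  shows "jpos_inv ((1 - s) *\<^sub>R a + s *\<^sub>R b)"
proof (cases "s = 0")
  case False
  then have "jpos_inv (s *\<^sub>R b + (1 - s) *\<^sub>R a)"
    using assms by (intro jpos_inv_add jpos_inv_scaleR jpos_scaleR) (auto simp: jpos_inv_jpos)
  then show ?thesis by (simp add: add.commute)
qed (use assms in simp)

lemma inverse_convex_real:
  fixes t s :: real
  assumes "0 < t" "0 \<le> s" "s \<le> 1"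
  shows "inverse ((1 - s) + s * t) \<le> (1 - s) + s * inverse t"
proof -
  have p: "0 < (1 - s) + s * t"
    using assms by (cases "s = 0") (auto intro!: add_nonneg_pos)
  have "((1 - s) + s * inverse t) * ((1 - s) + s * t) = 1 + s * (1 - s) * (t - 1)\<^sup>2 / t"
    using assms(1) by (simp add: field_simps power2_eq_square)
  also have "\<dots> \<ge> 1" using assms by simp
  finally show ?thesis using p by (simp add: inverse_eq_divide pos_divide_le_eq)
qed

text \<open>After the congruence that takes a to the unit, all three inverses are functions of the
  single element z, and convexity of t -> 1/t between 1 and t on the spectrum suffices.\<close>

lemma jinverse_convex:
  assumes a: "jpos_inv a" and b: "jpos_inv b" and s: "0 \<le> s" "s \<le> 1"
  shows "jpos ((1 - s) *\<^sub>R jinverse a + s *\<^sub>R jinverse b - jinverse ((1 - s) *\<^sub>R a + s *\<^sub>R b))"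
proof -
  define z where "z = jtriple (jpowr a (- (1/2))) b"
  define w where "w = jcalculus (\<lambda>t. (1 - s) + s * t) z"
  have z: "jpos_inv z" unfolding z_def using a b by (intro jpos_inv_jtriple jinvertible_jpowr)
  have zb: "b = jtriple (jpowr a (1/2)) z" by (simp add: z_def jtriple_jpowr_half[OF a])
  have c: "continuous_on (jspectrum z) (\<lambda>t. (1 - s) + s * t)" by (intro continuous_intros)
  have p: "0 < (1 - s) + s * t" if "t \<in> jspectrum z" for t
    using s jspectrum_pos[OF z that] by (cases "s = 0") (auto intro!: add_nonneg_pos)
  have w: "w = (1 - s) *\<^sub>R junit + s *\<^sub>R z"
    by (simp add: w_def jcalculus_add jcalculus_const jcalculus_scaleR jcalculus_id continuous_intros)
  have winv: "jpos_inv w" unfolding w_def using p by (intro jpos_inv_jcalculus c)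
  have iw: "jinverse w = jcalculus (\<lambda>t. inverse ((1 - s) + s * t)) z"
    unfolding w_def using p by (intro jinverse_jcalculus c) force
  have c': "continuous_on (jspectrum z) (\<lambda>t. inverse ((1 - s) + s * t))"
    using p by (intro continuous_on_inverse c) force
  have c'': "continuous_on (jspectrum z) (\<lambda>t. (1 - s) + s * inverse t)"
    by (intro continuous_on_add continuous_on_mult continuous_on_const continuous_on_inverse_jspectrum z)
  have "jpos (jcalculus (\<lambda>t. ((1 - s) + s * inverse t) - inverse ((1 - s) + s * t)) z)"
    using inverse_convex_real[OF _ s] jspectrum_pos[OF z]
    by (intro jpos_jcalculus continuous_on_diff c' c'') auto
  then have "jpos ((1 - s) *\<^sub>R junit + s *\<^sub>R jinverse z - jinverse w)"
    using continuous_on_inverse_jspectrum[OF z]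
    by (simp add: jcalculus_diff[OF c'' c'] iw jcalculus_add jcalculus_const jcalculus_scaleR
        jinverse_eq_jcalculus[OF z] continuous_intros)
  then have "jpos (jtriple (jpowr a (- (1/2))) ((1 - s) *\<^sub>R junit + s *\<^sub>R jinverse z - jinverse w))"
    using a by (simp add: jpos_jtriple)
  moreover have "jinverse b = jtriple (jpowr a (- (1/2))) (jinverse z)"
    unfolding zb using a z by (simp add: jpos_inv_jinvertible jtriple_jpowr_half[OF a])
  moreover have "jinverse ((1 - s) *\<^sub>R a + s *\<^sub>R b) = jtriple (jpowr a (- (1/2))) (jinverse w)"
  proof -
    have "(1 - s) *\<^sub>R a + s *\<^sub>R b = jtriple (jpowr a (1/2)) w"
      by (simp add: w zb jtriple_linear jtriple_jpowr_half[OF a])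
    then show ?thesis using a winv by (simp add: jpos_inv_jinvertible jtriple_jpowr_half[OF a])
  qed
  ultimately show ?thesis by (simp add: jtriple_linear jtriple_jpowr_half[OF a])
qed

subsection \<open>Operator means\<close>

text \<open>Joint monotonicity, concavity in either variable and congruence covariance, bundled in
  the spirit of Kubo-Ando means. The bundle is stable under nonnegative combinations and pointwise
  limits, so all four properties pass through the approximation together.\<close>

definition jmean :: "('a::unital_jb_algebra \<Rightarrow> 'a \<Rightarrow> 'a) \<Rightarrow> bool" where
  "jmean G \<longleftrightarrow>
    (\<forall>a b c d. jpos_inv a \<and> jpos_inv b \<and> jpos_inv c \<and> jpos_inv d \<and> jpos (c - a) \<and> jpos (d - b) \<longrightarrow>
      jpos (G c d - G a b)) \<and>
    (\<forall>s a b b'. 0 \<le> s \<and> s \<le> 1 \<and> jpos_inv a \<and> jpos_inv b \<and> jpos_inv b' \<longrightarrow>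
      jpos (G a ((1 - s) *\<^sub>R b + s *\<^sub>R b') - ((1 - s) *\<^sub>R G a b + s *\<^sub>R G a b'))) \<and>
    (\<forall>s a a' b. 0 \<le> s \<and> s \<le> 1 \<and> jpos_inv a \<and> jpos_inv a' \<and> jpos_inv b \<longrightarrow>
      jpos (G ((1 - s) *\<^sub>R a + s *\<^sub>R a') b - ((1 - s) *\<^sub>R G a b + s *\<^sub>R G a' b))) \<and>
    (\<forall>a b c. jpos_inv a \<and> jpos_inv b \<and> jinvertible c \<longrightarrow>
      jtriple c (G a b) = G (jtriple c a) (jtriple c b))"

lemma jmeanI:
  assumes "\<And>a b c d. jpos_inv a \<Longrightarrow> jpos_inv b \<Longrightarrow> jpos_inv c \<Longrightarrow> jpos_inv d \<Longrightarrow>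
      jpos (c - a) \<Longrightarrow> jpos (d - b) \<Longrightarrow> jpos (G c d - G a b)"
    and "\<And>s a b b'. 0 \<le> s \<Longrightarrow> s \<le> 1 \<Longrightarrow> jpos_inv a \<Longrightarrow> jpos_inv b \<Longrightarrow> jpos_inv b' \<Longrightarrow>
      jpos (G a ((1 - s) *\<^sub>R b + s *\<^sub>R b') - ((1 - s) *\<^sub>R G a b + s *\<^sub>R G a b'))"
    and "\<And>s a a' b. 0 \<le> s \<Longrightarrow> s \<le> 1 \<Longrightarrow> jpos_inv a \<Longrightarrow> jpos_inv a' \<Longrightarrow> jpos_inv b \<Longrightarrow>
      jpos (G ((1 - s) *\<^sub>R a + s *\<^sub>R a') b - ((1 - s) *\<^sub>R G a b + s *\<^sub>R G a' b))"
    and "\<And>a b c. jpos_inv a \<Longrightarrow> jpos_inv b \<Longrightarrow> jinvertible c \<Longrightarrow>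
      jtriple c (G a b) = G (jtriple c a) (jtriple c b)"
  shows "jmean G"
  using assms unfolding jmean_def by simp

lemma jmeanD:
  assumes "jmean G"
  shows "jpos_inv a \<Longrightarrow> jpos_inv b \<Longrightarrow> jpos_inv c \<Longrightarrow> jpos_inv d \<Longrightarrow>
      jpos (c - a) \<Longrightarrow> jpos (d - b) \<Longrightarrow> jpos (G c d - G a b)"
    and "0 \<le> s \<Longrightarrow> s \<le> 1 \<Longrightarrow> jpos_inv a \<Longrightarrow> jpos_inv b \<Longrightarrow> jpos_inv b' \<Longrightarrow>
      jpos (G a ((1 - s) *\<^sub>R b + s *\<^sub>R b') - ((1 - s) *\<^sub>R G a b + s *\<^sub>R G a b'))"
    and "0 \<le> s \<Longrightarrow> s \<le> 1 \<Longrightarrow> jpos_inv a \<Longrightarrow> jpos_inv a' \<Longrightarrow> jpos_inv b \<Longrightarrow>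
      jpos (G ((1 - s) *\<^sub>R a + s *\<^sub>R a') b - ((1 - s) *\<^sub>R G a b + s *\<^sub>R G a' b))"
    and "jpos_inv a \<Longrightarrow> jpos_inv b \<Longrightarrow> jinvertible k \<Longrightarrow>
      jtriple k (G a b) = G (jtriple k a) (jtriple k b)"
  using assms unfolding jmean_def by simp_all

lemma jmean_cong:
  assumes "jmean G" and eq: "\<And>a b. jpos_inv a \<Longrightarrow> jpos_inv b \<Longrightarrow> G a b = H a b"
  shows "jmean H"
  by (rule jmeanI)
    (simp_all add: eq[symmetric] jmeanD[OF assms(1)] jpos_inv_convex jpos_inv_jtriple)

section \<open>Closure properties of the class of means\<close>

lemma jmean_add: "jmean G \<Longrightarrow> jmean H \<Longrightarrow> jmean (\<lambda>a b. G a b + H a b)"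
proof (rule jmeanI, goal_cases)
  case (1 a b c d)
  then show ?case
    using jpos_add[OF jmeanD(1)[OF 1(1), of a b c d] jmeanD(1)[OF 1(2), of a b c d]] by (simp add: algebra_simps)
next
  case (2 s a b b')
  then show ?case
    using jpos_add[OF jmeanD(2)[OF 2(1), of s a b b'] jmeanD(2)[OF 2(2), of s a b b']] by (simp add: algebra_simps)
next
  case (3 s a a' b)
  then show ?case
    using jpos_add[OF jmeanD(3)[OF 3(1), of s a a' b] jmeanD(3)[OF 3(2), of s a a' b]] by (simp add: algebra_simps)
next
  case (4 a b c)
  then show ?case by (simp add: jtriple_linear jmeanD(4))
qed

lemma jmean_scaleR: "jmean G \<Longrightarrow> 0 \<le> r \<Longrightarrow> jmean (\<lambda>a b. r *\<^sub>R G a b)"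
proof (rule jmeanI, goal_cases)
  case (1 a b c d)
  then show ?case
    using jpos_scaleR[OF jmeanD(1)[OF 1(1), of a b c d] 1(2)] by (simp add: algebra_simps)
next
  case (2 s a b b')
  then show ?case
    using jpos_scaleR[OF jmeanD(2)[OF 2(1), of s a b b'] 2(2)] by (simp add: algebra_simps)
next
  case (3 s a a' b)
  then show ?case
    using jpos_scaleR[OF jmeanD(3)[OF 3(1), of s a a' b] 3(2)] by (simp add: algebra_simps)
next
  case (4 a b c)
  then show ?case by (simp add: jtriple_linear jmeanD(4))
qed

lemma jmean_zero: "jmean (\<lambda>a b. 0)"
  by (rule jmeanI) (simp_all add: linear_0[OF linear_jtriple])

lemma jmean_sum: "(\<And>i. i \<in> I \<Longrightarrow> jmean (G i)) \<Longrightarrow> jmean (\<lambda>a b. \<Sum>i\<in>I. G i a b)"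
  by (induction I rule: infinite_finite_induct) (simp_all add: jmean_zero jmean_add)

lemma jmean_limit:
  assumes G: "\<And>n. jmean (G n)"
    and lim: "\<And>a b. jpos_inv a \<Longrightarrow> jpos_inv b \<Longrightarrow> (\<lambda>n. G n a b) \<longlonglongrightarrow> H a b"
  shows "jmean H"
proof (rule jmeanI)
  fix a b c d :: 'a
  assume *: "jpos_inv a" "jpos_inv b" "jpos_inv c" "jpos_inv d" "jpos (c - a)" "jpos (d - b)"
  have "(\<lambda>n. G n c d - G n a b) \<longlonglongrightarrow> H c d - H a b" by (intro tendsto_intros lim *)
  then show "jpos (H c d - H a b)" by (rule jpos_limit) (rule jmeanD(1)[OF G *])
next
  fix s :: real and a b b' :: 'a
  assume *: "0 \<le> s" "s \<le> 1" "jpos_inv a" "jpos_inv b" "jpos_inv b'"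
  have "(\<lambda>n. G n a ((1 - s) *\<^sub>R b + s *\<^sub>R b') - ((1 - s) *\<^sub>R G n a b + s *\<^sub>R G n a b'))
      \<longlonglongrightarrow> H a ((1 - s) *\<^sub>R b + s *\<^sub>R b') - ((1 - s) *\<^sub>R H a b + s *\<^sub>R H a b')"
    by (intro tendsto_intros lim jpos_inv_convex *)
  then show "jpos (H a ((1 - s) *\<^sub>R b + s *\<^sub>R b') - ((1 - s) *\<^sub>R H a b + s *\<^sub>R H a b'))"
    by (rule jpos_limit) (rule jmeanD(2)[OF G *])
next
  fix s :: real and a a' b :: 'a
  assume *: "0 \<le> s" "s \<le> 1" "jpos_inv a" "jpos_inv a'" "jpos_inv b"
  have "(\<lambda>n. G n ((1 - s) *\<^sub>R a + s *\<^sub>R a') b - ((1 - s) *\<^sub>R G n a b + s *\<^sub>R G n a' b))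
      \<longlonglongrightarrow> H ((1 - s) *\<^sub>R a + s *\<^sub>R a') b - ((1 - s) *\<^sub>R H a b + s *\<^sub>R H a' b)"
    by (intro tendsto_intros lim jpos_inv_convex *)
  then show "jpos (H ((1 - s) *\<^sub>R a + s *\<^sub>R a') b - ((1 - s) *\<^sub>R H a b + s *\<^sub>R H a' b))"
    by (rule jpos_limit) (rule jmeanD(3)[OF G *])
next
  fix a b c :: 'a
  assume *: "jpos_inv a" "jpos_inv b" "jinvertible c"
  have "(\<lambda>n. jtriple c (G n a b)) \<longlonglongrightarrow> jtriple c (H a b)"
    by (rule bounded_linear.tendsto[OF bounded_linear_jtriple lim[OF *(1,2)]])
  moreover have "(\<lambda>n. jtriple c (G n a b)) \<longlonglongrightarrow> H (jtriple c a) (jtriple c b)"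
    unfolding jmeanD(4)[OF G *] by (intro lim jpos_inv_jtriple *)
  ultimately show "jtriple c (H a b) = H (jtriple c a) (jtriple c b)" by (rule LIMSEQ_unique)
qed

lemma jmean_projections: "jmean (\<lambda>a b. a)" "jmean (\<lambda>a b. b)"
  by (rule jmeanI; simp add: algebra_simps)+

text \<open>For t > 0 this is the parallel sum of a and b / t.\<close>

definition jharmonic :: "real \<Rightarrow> 'a::unital_jb_algebra \<Rightarrow> 'a \<Rightarrow> 'a" where
  "jharmonic t a b = jinverse (jinverse a + t *\<^sub>R jinverse b)"

lemma jpos_inv_harmonic_sum:
  "jpos_inv a \<Longrightarrow> jpos_inv b \<Longrightarrow> 0 < t \<Longrightarrow> jpos_inv (jinverse a + t *\<^sub>R jinverse b)"
  by (intro jpos_inv_add jpos_inv_jinverse jpos_inv_jpos jpos_inv_scaleR)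

lemma jtriple_jharmonic:
  assumes a: "jpos_inv a" and b: "jpos_inv b" and t: "0 < t" and c: "jinvertible c"
  shows "jtriple c (jharmonic t a b) = jharmonic t (jtriple c a) (jtriple c b)"
proof -
  have "jinverse (jtriple c a) + t *\<^sub>R jinverse (jtriple c b)
      = jtriple (jinverse c) (jinverse a + t *\<^sub>R jinverse b)"
    using a b c by (simp add: jpos_inv_jinvertible jtriple_linear)
  then show ?thesis
    unfolding jharmonic_def
    using c jpos_inv_jinvertible[OF jpos_inv_harmonic_sum[OF a b t]] by simp
qed

text \<open>The first form supplies the scalar function used in the approximation; the second is
  affine in one inverse, so that convexity of inversion yields concavity in x.\<close>

lemma jharmonic_junit:
  assumes x: "jpos_inv x" and t: "0 < t"
  shows "jharmonic t junit x = jcalculus (\<lambda>u. u / (u + t)) x"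
    and "jharmonic t junit x = junit - t *\<^sub>R jinverse (x + t *\<^sub>R junit)"
proof -
  note pos = jspectrum_pos[OF x]
  have i: "continuous_on (jspectrum x) inverse" by (rule continuous_on_inverse_jspectrum[OF x])
  have c: "continuous_on (jspectrum x) (\<lambda>u. 1 + t * inverse u)"
    by (intro continuous_on_add continuous_on_mult continuous_on_const i)
  have "jinverse junit + t *\<^sub>R jinverse x = jcalculus (\<lambda>u. 1 + t * inverse u) x"
    using i by (simp add: jcalculus_add jcalculus_const jcalculus_scaleR jinverse_eq_jcalculus[OF x] continuous_intros)
  then have "jharmonic t junit x = jcalculus (\<lambda>u. inverse (1 + t * inverse u)) x"
    unfolding jharmonic_def using pos t
    by (simp only:) (intro jinverse_jcalculus c, smt (verit) inverse_positive_iff_positive mult_pos_pos)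
  also have "\<dots> = jcalculus (\<lambda>u. u / (u + t)) x"
  proof (rule jcalculus_cong)
    show "continuous_on (jspectrum x) (\<lambda>u. inverse (1 + t * inverse u))"
      using pos t by (intro continuous_on_inverse c) (smt (verit) inverse_positive_iff_positive mult_pos_pos)
    fix u assume "u \<in> jspectrum x"
    then show "inverse (1 + t * inverse u) = u / (u + t)"
      using pos[of u] t by (simp add: field_simps)
  qed
  finally show 1: "jharmonic t junit x = jcalculus (\<lambda>u. u / (u + t)) x" .
  have d: "continuous_on (jspectrum x) (\<lambda>u. u + t)" by (intro continuous_intros)
  have nz: "u + t \<noteq> 0" if "u \<in> jspectrum x" for u using pos[OF that] t by simp
  have di: "continuous_on (jspectrum x) (\<lambda>u. inverse (u + t))"
    using nz by (intro continuous_on_inverse d) auto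
  have "x + t *\<^sub>R junit = jcalculus (\<lambda>u. u + t) x"
    by (simp add: jcalculus_add jcalculus_const jcalculus_id continuous_intros)
  then have "jinverse (x + t *\<^sub>R junit) = jcalculus (\<lambda>u. inverse (u + t)) x"
    using nz by (simp add: jinverse_jcalculus d)
  then have "junit - t *\<^sub>R jinverse (x + t *\<^sub>R junit) = jcalculus (\<lambda>u. 1 - t * inverse (u + t)) x"
    using di by (simp add: jcalculus_diff jcalculus_const jcalculus_scaleR continuous_intros)
  also have "\<dots> = jcalculus (\<lambda>u. u / (u + t)) x"
  proof (rule jcalculus_cong)
    show "continuous_on (jspectrum x) (\<lambda>u. 1 - t * inverse (u + t))"
      by (intro continuous_on_diff continuous_on_mult continuous_on_const di)
    fix u assume "u \<in> jspectrum x"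
    then have "u + t \<noteq> 0" by (rule nz)
    then show "1 - t * inverse (u + t) = u / (u + t)" by (simp add: divide_simps)
  qed
  finally show "jharmonic t junit x = junit - t *\<^sub>R jinverse (x + t *\<^sub>R junit)" using 1 by simp
qed

lemma jharmonic_eq:
  assumes a: "jpos_inv a" and b: "jpos_inv b" and t: "0 < t"
  shows "jharmonic t a b = jtriple (jpowr a (1/2)) (jharmonic t junit (jtriple (jpowr a (- (1/2))) b))"
proof -
  have z: "jpos_inv (jtriple (jpowr a (- (1/2))) b)" using a b by (intro jpos_inv_jtriple jinvertible_jpowr)
  show ?thesis
    using jtriple_jharmonic[OF jpos_inv_junit z t jinvertible_jpowr[OF a, of "1/2"]]
    by (simp add: jtriple_jpowr_half[OF a])
qed

text \<open>Convexity of inversion does not apply directly to an inverse of a sum of inverses. A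
  congruence takes a to the unit, where \<open>jharmonic_junit(2)\<close> leaves a single inverse
  with a negative coefficient.\<close>

lemma jharmonic_concave_right:
  assumes a: "jpos_inv a" and b: "jpos_inv b" "jpos_inv b'" and t: "0 < t" and s: "0 \<le> s" "s \<le> 1"
  shows "jpos (jharmonic t a ((1 - s) *\<^sub>R b + s *\<^sub>R b')
    - ((1 - s) *\<^sub>R jharmonic t a b + s *\<^sub>R jharmonic t a b'))"
proof -
  define x y where "x = jtriple (jpowr a (- (1/2))) b" and "y = jtriple (jpowr a (- (1/2))) b'"
  have x: "jpos_inv x" "jpos_inv y"
    unfolding x_def y_def using a b by (auto intro: jpos_inv_jtriple jinvertible_jpowr)
  have xt: "jpos_inv (x + t *\<^sub>R junit)" "jpos_inv (y + t *\<^sub>R junit)"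
    using x t by (auto intro!: jpos_inv_add jpos_scaleR)
  define w where "w = (1 - s) *\<^sub>R x + s *\<^sub>R y"
  have w: "jpos_inv w" unfolding w_def by (rule jpos_inv_convex[OF x s])
  have mix: "jtriple (jpowr a (- (1/2))) ((1 - s) *\<^sub>R b + s *\<^sub>R b') = w"
    by (simp add: x_def y_def w_def jtriple_linear)
  have "jpos (t *\<^sub>R ((1 - s) *\<^sub>R jinverse (x + t *\<^sub>R junit) + s *\<^sub>R jinverse (y + t *\<^sub>R junit)
      - jinverse ((1 - s) *\<^sub>R (x + t *\<^sub>R junit) + s *\<^sub>R (y + t *\<^sub>R junit))))"
    using t by (intro jpos_scaleR jinverse_convex xt s) auto
  also have "(1 - s) *\<^sub>R (x + t *\<^sub>R junit) + s *\<^sub>R (y + t *\<^sub>R junit) = w + t *\<^sub>R junit"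
    by (simp add: w_def algebra_simps)
  also have "t *\<^sub>R ((1 - s) *\<^sub>R jinverse (x + t *\<^sub>R junit) + s *\<^sub>R jinverse (y + t *\<^sub>R junit)
      - jinverse (w + t *\<^sub>R junit))
    = jharmonic t junit w
      - ((1 - s) *\<^sub>R jharmonic t junit x + s *\<^sub>R jharmonic t junit y)"
    by (simp add: jharmonic_junit(2)[OF x(1) t] jharmonic_junit(2)[OF x(2) t]
      jharmonic_junit(2)[OF w t] algebra_simps)
  finally have "jpos (jtriple (jpowr a (1/2)) (jharmonic t junit w
      - ((1 - s) *\<^sub>R jharmonic t junit x + s *\<^sub>R jharmonic t junit y)))"
    using a by (simp add: jpos_jtriple)
  then show ?thesis
    by (simp add: jharmonic_eq[OF a b(1) t] jharmonic_eq[OF a b(2) t]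
      jharmonic_eq[OF a jpos_inv_convex[OF b s] t] mix jtriple_linear flip: x_def y_def w_def)
qed

text \<open>Exchanging the arguments replaces t by 1/t up to a positive factor; concavity in the
  left variable thereby reduces to concavity in the right one.\<close>

lemma jharmonic_swap:
  assumes a: "jpos_inv a" and b: "jpos_inv b" and t: "0 < t"
  shows "jharmonic t a b = inverse t *\<^sub>R jharmonic (inverse t) b a"
proof -
  have "jinverse a + t *\<^sub>R jinverse b = t *\<^sub>R (jinverse b + inverse t *\<^sub>R jinverse a)"
    using t by (simp add: algebra_simps)
  then show ?thesis
    unfolding jharmonic_def
    using t jpos_inv_jinvertible[OF jpos_inv_harmonic_sum[OF b a, of "inverse t"]]
    by (simp add: jinverse_scaleR)
qed

lemma jmean_jharmonic:
  assumes t: "0 < t" shows "jmean (jharmonic t)"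
proof (rule jmeanI)
  fix a b c d :: 'a
  assume *: "jpos_inv a" "jpos_inv b" "jpos_inv c" "jpos_inv d" "jpos (c - a)" "jpos (d - b)"
  have "jpos ((jinverse a - jinverse c) + t *\<^sub>R (jinverse b - jinverse d))"
    using * t by (intro jpos_add jpos_scaleR jinverse_antitone) auto
  then have "jpos ((jinverse a + t *\<^sub>R jinverse b) - (jinverse c + t *\<^sub>R jinverse d))"
    by (simp add: algebra_simps)
  then show "jpos (jharmonic t c d - jharmonic t a b)"
    unfolding jharmonic_def using * t by (intro jinverse_antitone jpos_inv_harmonic_sum)
next
  fix s :: real and a b b' :: 'a
  assume "0 \<le> s" "s \<le> 1" "jpos_inv a" "jpos_inv b" "jpos_inv b'"
  then show "jpos (jharmonic t a ((1 - s) *\<^sub>R b + s *\<^sub>R b') - ((1 - s) *\<^sub>R jharmonic t a b + s *\<^sub>R jharmonic t a b'))"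
    using t by (intro jharmonic_concave_right)
next
  fix s :: real and a a' b :: 'a
  assume *: "0 \<le> s" "s \<le> 1" "jpos_inv a" "jpos_inv a'" "jpos_inv b"
  define w where "w = (1 - s) *\<^sub>R a + s *\<^sub>R a'"
  have w: "jpos_inv w" unfolding w_def by (rule jpos_inv_convex) (use * in auto)
  have "jpos (inverse t *\<^sub>R (jharmonic (inverse t) b w
      - ((1 - s) *\<^sub>R jharmonic (inverse t) b a + s *\<^sub>R jharmonic (inverse t) b a')))"
    unfolding w_def using t * by (intro jpos_scaleR jharmonic_concave_right) auto
  then show "jpos (jharmonic t ((1 - s) *\<^sub>R a + s *\<^sub>R a') b - ((1 - s) *\<^sub>R jharmonic t a b + s *\<^sub>R jharmonic t a' b))"
    unfolding w_def[symmetric] using * t w by (simp add: jharmonic_swap[of _ b t] algebra_simps)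
next
  fix a b c :: 'a
  assume "jpos_inv a" "jpos_inv b" "jinvertible c"
  then show "jtriple c (jharmonic t a b) = jharmonic t (jtriple c a) (jtriple c b)"
    using t by (intro jtriple_jharmonic)
qed

subsection \<open>The weighted geometric mean\<close>

lemma jgeomean_eq:
  "jgeomean l a b = jtriple (jpowr a (1/2)) (jpowr (jtriple (jpowr a (- (1/2))) b) l)"
  by (simp add: jgeomean_def)

lemma jpos_inv_jtriple_half: "jpos_inv a \<Longrightarrow> jpos_inv b \<Longrightarrow> jpos_inv (jtriple (jpowr a r) b)"
  by (intro jpos_inv_jtriple jinvertible_jpowr)

lemma sum_jharmonic_eq:
  assumes a: "jpos_inv a" and b: "jpos_inv b" and t: "\<And>i. i \<in> I \<Longrightarrow> 0 < t i"
  shows "(\<Sum>i\<in>I. c i *\<^sub>R jharmonic (t i) a b) = jtriple (jpowr a (1/2))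
    (jcalculus (\<lambda>x. \<Sum>i\<in>I. c i * (x / (x + t i))) (jtriple (jpowr a (- (1/2))) b))"
proof -
  define z where "z = jtriple (jpowr a (- (1/2))) b"
  have z: "jpos_inv z" unfolding z_def by (rule jpos_inv_jtriple_half[OF a b])
  have c: "continuous_on (jspectrum z) (\<lambda>x. x / (x + t i))" if "i \<in> I" for i
    by (intro continuous_intros) (use jspectrum_pos[OF z] t[OF that] in fastforce)
  have "jcalculus (\<lambda>x. \<Sum>i\<in>I. c i * (x / (x + t i))) z = (\<Sum>i\<in>I. jcalculus (\<lambda>x. c i * (x / (x + t i))) z)"
    by (intro jcalculus_sum continuous_on_mult continuous_on_const c)
  also have "\<dots> = (\<Sum>i\<in>I. c i *\<^sub>R jharmonic (t i) junit z)"
    by (intro sum.cong refl) (simp only: jcalculus_scaleR[OF c] jharmonic_junit(1)[OF z t])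
  finally show ?thesis
    using jharmonic_eq[OF a b t]
    by (simp add: z_def linear_sum[OF linear_jtriple] jtriple_scaleR)
qed

lemma jmean_jgeomean_less:
  assumes l: "0 < l" "l < 1"
  shows "jmean (jgeomean l :: 'a::unital_jb_algebra \<Rightarrow> 'a \<Rightarrow> 'a)"
proof -
  \<comment> \<open>The intervals exhaust (0, infinity), so one sequence of coefficients and nodes,
    chosen before a and b, serves every pair; a limit of means demands exactly that.\<close>
  have "\<forall>n. \<exists>(I::int set) c t. finite I \<and> (\<forall>i. 0 \<le> c i \<and> 0 < t i) \<and>
    (\<forall>x\<in>{1 / real (Suc n)..real (Suc n)}. \<bar>(\<Sum>i\<in>I. c i * (x / (x + t i))) - x powr l\<bar> \<le> 1 / real (Suc n))"
  proof (intro allI powr_approximation l)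
    fix n
    have "1 / real (Suc n) \<le> 1" "1 \<le> real (Suc n)" by simp_all
    then show "1 / real (Suc n) \<le> real (Suc n)" by linarith
  qed simp_all
  then obtain I :: "nat \<Rightarrow> int set" and c t where
    ct: "\<And>n i. 0 \<le> c n i" "\<And>n i. 0 < t n i" and
    approx: "\<And>n x. x \<in> {1 / real (Suc n)..real (Suc n)} \<Longrightarrow>
      \<bar>(\<Sum>i\<in>I n. c n i * (x / (x + t n i))) - x powr l\<bar> \<le> 1 / real (Suc n)"
    unfolding choice_iff by blast
  define G :: "nat \<Rightarrow> 'a \<Rightarrow> 'a \<Rightarrow> 'a" where "G = (\<lambda>n a b. \<Sum>i\<in>I n. c n i *\<^sub>R jharmonic (t n i) a b)"
  show ?thesis
  proof (rule jmean_limit[of G])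
    show "jmean (G n)" for n
      unfolding G_def by (intro jmean_sum jmean_scaleR jmean_jharmonic ct)
    fix a b :: 'a assume a: "jpos_inv a" and b: "jpos_inv b"
    define z where "z = jtriple (jpowr a (- (1/2))) b"
    have z: "jpos_inv z" unfolding z_def by (rule jpos_inv_jtriple_half[OF a b])
    define f where "f = (\<lambda>n x. \<Sum>i\<in>I n. c n i * (x / (x + t n i)))"
    have f: "continuous_on (jspectrum z) (f n)" for n
      unfolding f_def
    proof (intro continuous_intros ballI)
      fix i x assume "x \<in> jspectrum z"
      then show "x + t n i \<noteq> 0" using jspectrum_pos[OF z, of x] ct(2)[of n i] by linarith
    qed
    \<comment> \<open>The spectrum of z lies in [e, norm z], hence in all but finitely many of the
      approximation intervals.\<close>
    obtain e where e: "e > 0" "jpos (z - e *\<^sub>R junit)" using z jpos_inv_iff by blast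
    have lower: "e \<le> x" if "x \<in> jspectrum z" for x
    proof -
      have "x - e \<in> jspectrum (z - e *\<^sub>R junit)"
        using that by (simp add: jspectrum_def scaleR_left_diff_distrib)
      then show ?thesis using e(2) unfolding jpositive_iff_jpos[symmetric] jpositive_def by auto
    qed
    have upper: "x \<le> norm z" if "x \<in> jspectrum z" for x using jspectrum_bound[OF that] by simp
    obtain N :: nat where N: "1 / e \<le> real N" "norm z \<le> real N"
      using real_arch_simple[of "max (1 / e) (norm z)"] by auto
    have est: "norm (jcalculus (f n) z - jpowr z l) \<le> 1 / real (Suc n)" if "n \<ge> N" for n
    proof -
      have "1 / e \<le> real (Suc n)" "norm z \<le> real (Suc n)" using N that by linarith+
      then have "1 / real (Suc n) \<le> e" using e(1) by (simp add: field_simps)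
      have "norm (jcalculus (\<lambda>x. f n x - x powr l) z) \<le> 1 / real (Suc n)"
      proof (intro norm_jcalculus_le continuous_on_diff f continuous_on_powr_jspectrum z)
        fix x assume "x \<in> jspectrum z"
        then have "x \<in> {1 / real (Suc n)..real (Suc n)}"
          using lower[of x] upper[of x] \<open>1 / real (Suc n) \<le> e\<close> \<open>norm z \<le> real (Suc n)\<close> by simp
        then show "\<bar>f n x - x powr l\<bar> \<le> 1 / real (Suc n)" unfolding f_def by (rule approx)
      qed simp
      then show ?thesis by (simp only: jcalculus_diff[OF f continuous_on_powr_jspectrum[OF z]] jpowr_def)
    qed
    have "(\<lambda>n. jcalculus (f n) z - jpowr z l) \<longlonglongrightarrow> 0"
      by (rule Lim_null_comparison[OF _ LIMSEQ_inverse_real_of_nat])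
        (use est in \<open>auto simp: eventually_sequentially inverse_eq_divide\<close>)
    then have "(\<lambda>n. jcalculus (f n) z) \<longlonglongrightarrow> jpowr z l" by (rule LIM_zero_cancel)
    then have "(\<lambda>n. jtriple (jpowr a (1/2)) (jcalculus (f n) z)) \<longlonglongrightarrow> jtriple (jpowr a (1/2)) (jpowr z l)"
      by (rule bounded_linear.tendsto[OF bounded_linear_jtriple])
    then show "(\<lambda>n. G n a b) \<longlonglongrightarrow> jgeomean l a b"
      by (simp add: G_def jgeomean_eq f_def z_def sum_jharmonic_eq[OF a b ct(2)])
  qed
qed

lemma jgeomean_endpoints:
  assumes "jpos_inv a" "jpos_inv b"
  shows "jgeomean 0 a b = a" "jgeomean 1 a b = b"
  using assms
  by (simp_all add: jgeomean_eq jpowr_junit_exponents jpos_inv_jtriple_half jtriple_jpowr_half)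

lemma jmean_jgeomean:
  assumes "0 \<le> l" "l \<le> 1" shows "jmean (jgeomean l)"
proof -
  consider "l = 0" | "l = 1" | "0 < l" "l < 1" using assms by linarith
  then show ?thesis
  proof cases
    case 1
    then show ?thesis
      by (auto intro: jmean_cong[OF jmean_projections(1)] simp: jgeomean_endpoints)
  next
    case 2
    then show ?thesis
      by (auto intro: jmean_cong[OF jmean_projections(2)] simp: jgeomean_endpoints)
  qed (rule jmean_jgeomean_less)
qed

lemma jgeomean_scaleR:
  assumes a: "jpos_inv a" and b: "jpos_inv b" and r: "0 < r" "0 < s"
  shows "jgeomean l (r *\<^sub>R a) (s *\<^sub>R b) = (r powr (1 - l) * s powr l) *\<^sub>R jgeomean l a b"
proof -
  let ?z = "jtriple (jpowr a (- (1/2))) b"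
  have sq: "(r powr (1/2))\<^sup>2 = r" "(r powr (- (1/2)))\<^sup>2 = inverse r"
    using r(1) by (simp_all only: power2_eq_square powr_add[symmetric])
      (simp_all add: powr_minus)
  have z: "jtriple (jpowr (r *\<^sub>R a) (- (1/2))) (s *\<^sub>R b) = (inverse r * s) *\<^sub>R ?z"
    unfolding jpowr_scaleR[OF a r(1)] jtriple_scaleR_left jtriple_scaleR sq by simp
  have "jgeomean l (r *\<^sub>R a) (s *\<^sub>R b) = (r * (inverse r * s) powr l) *\<^sub>R jgeomean l a b"
    using jpowr_scaleR[OF jpos_inv_jtriple_half[OF a b, of "- (1/2)"], of "inverse r * s" l] r
    unfolding jgeomean_eq z jpowr_scaleR[OF a r(1)] jtriple_scaleR_left sq
    by (simp only: positive_imp_inverse_positive mult_pos_pos jtriple_scaleR scaleR_scaleR simp_thms)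
  also have "r * (inverse r * s) powr l = r powr (1 - l) * s powr l"
  proof -
    have "(inverse r * s) powr l = s powr l / r powr l"
      using r by (simp add: powr_mult inverse_powr divide_inverse mult.commute)
    then show ?thesis using r by (simp add: powr_diff)
  qed
  finally show ?thesis .
qed

text \<open>Inverting the triple replaces a^(1/2) by a^(-1/2) and z^l by z^(-l), the l-th power of
  the inverse of z. That inverse is {a^(1/2) b^(-1) a^(1/2)}, the element formed from the inverses
  of a and b.\<close>

lemma jinverse_jgeomean:
  assumes a: "jpos_inv a" and b: "jpos_inv b"
  shows "jinverse (jgeomean l a b) = jgeomean l (jinverse a) (jinverse b)"
proof -
  let ?z = "jtriple (jpowr a (- (1/2))) b"
  have z: "jpos_inv ?z" by (rule jpos_inv_jtriple_half[OF a b])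
  have "jinverse (jgeomean l a b) = jtriple (jpowr a (- (1/2))) (jpowr ?z (- l))"
    using a z by (simp add: jgeomean_eq jinverse_jpowr jtriple_jpowr_half[OF a])
  also have "jpowr ?z (- l) = jpowr (jinverse ?z) l" by (simp add: jpowr_jinverse[OF z])
  also have "jinverse ?z = jtriple (jpowr a (1/2)) (jinverse b)"
    using a b by (simp add: jpos_inv_jinvertible jtriple_jpowr_half[OF a])
  finally show ?thesis by (simp add: jgeomean_eq jpowr_jinverse[OF a])
qed

theorem proposition6:
  fixes l :: real
  assumes "0 \<le> l" and "l \<le> 1"
  shows
    "(\<forall>(A::'a::unital_jb_algebra) B (\<alpha>::real) (\<beta>::real).
        jpos_inv A \<and> jpos_inv B \<and> 0 < \<alpha> \<and> 0 < \<beta> \<longrightarrow>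
        jgeomean l (\<alpha> *\<^sub>R A) (\<beta> *\<^sub>R B) = (\<alpha> powr (1 - l) * \<beta> powr l) *\<^sub>R jgeomean l A B) \<and>
     (\<forall>(A::'a) B C D.
        jpos_inv A \<and> jpos_inv B \<and> jpos_inv C \<and> jpos_inv D \<and> A \<le>\<^sub>J C \<and> B \<le>\<^sub>J D \<longrightarrow>
        jgeomean l A B \<le>\<^sub>J jgeomean l C D) \<and>
     (\<forall>t (A::'a) B\<^sub>1 B\<^sub>2.
        0 \<le> t \<and> t \<le> 1 \<and> jpos_inv A \<and> jpos_inv B\<^sub>1 \<and> jpos_inv B\<^sub>2 \<longrightarrow>
        (1 - t) *\<^sub>R jgeomean l A B\<^sub>1 + t *\<^sub>R jgeomean l A B\<^sub>2
          \<le>\<^sub>J jgeomean l A ((1 - t) *\<^sub>R B\<^sub>1 + t *\<^sub>R B\<^sub>2)) \<and>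
     (\<forall>t (A\<^sub>1::'a) A\<^sub>2 B.
        0 \<le> t \<and> t \<le> 1 \<and> jpos_inv A\<^sub>1 \<and> jpos_inv A\<^sub>2 \<and> jpos_inv B \<longrightarrow>
        (1 - t) *\<^sub>R jgeomean l A\<^sub>1 B + t *\<^sub>R jgeomean l A\<^sub>2 B
          \<le>\<^sub>J jgeomean l ((1 - t) *\<^sub>R A\<^sub>1 + t *\<^sub>R A\<^sub>2) B) \<and>
     (\<forall>(A::'a) B C.
        jpos_inv A \<and> jpos_inv B \<and> jinvertible C \<longrightarrow>
        jtriple C (jgeomean l A B) = jgeomean l (jtriple C A) (jtriple C B)) \<and>
     (\<forall>(A::'a) B.
        jpos_inv A \<and> jpos_inv B \<longrightarrow>
        jinverse (jgeomean l A B) = jgeomean l (jinverse A) (jinverse B))"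
  unfolding jle_iff_jpos
proof (intro conjI allI impI; elim conjE)
qed (fact jgeomean_scaleR jinverse_jgeomean jmeanD[OF jmean_jgeomean[OF assms]])+

end
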